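(* Let $f:X\to\Delta$ be a projective morphism to the unit disc which is smooth over $\Delta^*=\Delta\setminus\{0\}$ and semi-stable at $0$, with a fixed polarization, let $r\ge 1$, and let $H'$, $H$, $W$, $(\langle\,,\,\rangle_k)_k$, $\gamma'$, $\Gamma'$, $\Gamma$, $N'$ and $\mathfrak g$ be the objects attached to these data as in the context. Then there is a fan $\Sigma$ in $\mathfrak g$, consisting of rational nilpotent cones, which satisfies the following (1) and (2). (1) For any $\sigma\in\Sigma$, $\sigma$ is admissible for $W$ and the restriction of any element of $\sigma$ to $H'_{\mathbb R}$ is contained in $\mathbb R_{\ge 0}N'$. Furthermore, $\Sigma$ is strongly compatible with $\Gamma$. (2) (Relative completeness.) Let $\sigma$ be any rational nilpotent cone in $\mathfrak g$ which is admissible for $W$ such that the restriction of any element of $\sigma$ to $H'_{\mathbb R}$ is contained in $\mathbb R_{\ge 0}N'$. Then there exists a finite subdivision $\{\sigma_j\}$ of $\sigma$ such that each $\sigma_j$ is contained in some element of $\Sigma$.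
   Context: **Geometric setting.** Let $\Delta=\{q\in\mathbb C : |q|<1\}$, $\Delta^*=\Delta\setminus\{0\}$, let $f:X\to\Delta$ be a projective morphism which is smooth over $\Delta^*$ and semi-stable at $q=0$ (so $X$ is a complex manifold and $f^{-1}(0)$ is a reduced divisor with normal crossings, as in the usual definition of semi-stable degeneration). Fix a polarization of $X/\Delta$, an integer $r\ge 1$ and a point $s\in\Delta^*$. Write $A_{K}=A\otimes_{\mathbb Z}K$ for an abelian group $A$ and $K=\mathbb Q,\mathbb R$. * $H'$ is the stalk at $s$ of $(R^{2r-1}f_*\mathbb Z/\text{torsion})(r)|_{\Delta^*}$, i.e. $H'=H^{2r-1}(X_s,\mathbb Z)/\text{torsion}$, Tate-twisted by $r$ so that it has weight $-1$; it is a free $\mathbb Z$-module of finite rank. Let $H=H'\oplus\mathbb Z$. * $W$ is the increasing filtration on $H_{\mathbb Q}$ with $W_{-2}=0$, $W_{-1}=H'_{\mathbb Q}$, $W_0=H_{\mathbb Q}$; so $\mathrm{gr}^W_0=\mathbb Q$, $\mathrm{gr}^W_{-1}=H'_{\mathbb Q}$ and the other graded pieces vanish. The induced filtration on $H_{\mathbb R}$ is also denoted $W$. * $\langle\,,\,\rangle_0:\mathbb Z\times\mathbb Z\to\mathbb Q$ is $(a,b)\mapsto ab$, and $\langle\,,\,\rangle'=\langle\,,\,\rangle_{-1}:H'\times H'\to\mathbb Q$ is the (non-degenerate, antisymmetric, monodromy-invariant) pairing defined by the polarization of $X/\Delta$, i.e. the one polarizing the variation of Hodge structure $H^{2r-1}(X^*/\Delta^*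 )(r)$ of weight $-1$, where $X^*=f^{-1}(\Delta^* )$. * $\gamma':H'\to H'$ is the local monodromy, i.e. the action of the standard generator of $\pi_1(\Delta^* )$; it is unipotent. $\Gamma'\subset \mathrm{Aut}(H',\langle\,,\,\rangle')$ is the group generated by $\gamma'$. * $G_{\mathbb Z}=\mathrm{Aut}(H,W,(\langle\,,\,\rangle_k)_k)$ is the group of automorphisms of $H$ preserving $W$ and inducing isometries of $\langle\,,\,\rangle_k$ on $\mathrm{gr}^W_k$ for $k=0,-1$. $\Gamma\subset G_{\mathbb Z}$ is the subgroup of all elements whose restriction to $H'$ lies in $\Gamma'$. * $N'=\log(\gamma'):H'_{\mathbb Q}\to H'_{\mathbb Q}$ (nilpotent), extended also to $H'_{\mathbb R}$. * $\mathfrak g=\mathrm{End}(H_{\mathbb R},W,(\langle\,,\,\rangle_k)_k)$ is the Lie algebra of all linear maps $h:H_{\mathbb R}\to H_{\mathbb R}$ preserving $W$ whose induced maps $h_k$ on $\mathrm{gr}^W_k$ satisfy $\langle h_k(x),y\rangle_k+\langle x,h_k(y)\rangle_k=0$ for $k=0,-1$. $\mathfrak g_{\mathbb Q}$ is its natural $\mathbb Q$-form (those $h$ preserving $H_{\mathbb Q}$). **Cones and fans.** * A nilpotent cone $\sigma$ in $\mathfrak g$ is a cone over $\mathbb R_{\ge0}$ in $\mathfrak g$ generated by a finite number of mutually commutative nilpotent elements of $\mathfrak g$ and which is sharp, i.e. $\sigma\cap(-\sigma)=\{0\}$. It is rational if its generators as an $\mathbb R_{\ge0}$-cone can be taken in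 $\mathfrak g_{\mathbb Q}$. * A fan in $\mathfrak g$ is a non-empty set $\Sigma$ of rational nilpotent cones in $\mathfrak g$ such that every face of an element of $\Sigma$ belongs to $\Sigma$, and for $\sigma,\tau\in\Sigma$ the intersection $\sigma\cap\tau$ is a face of both $\sigma$ and $\tau$. (It may be infinite.) * A finite subdivision of a rational nilpotent cone $\sigma$ is a finite fan $\{\sigma_j\}$ of rational cones whose union is $\sigma$. * A nilpotent cone $\sigma$ is admissible for $W$ if, for any $N\in\sigma$, there exists the $W$-relative $N$-filtration $M=M(N,W)$, i.e. the (finite, increasing) filtration $M$ on $H_{\mathbb R}$ satisfying $NM_k\subset M_{k-2}$ for any $k$ and such that $N^l:\mathrm{gr}^M_{k+l}\mathrm{gr}^W_k\to\mathrm{gr}^M_{k-l}\mathrm{gr}^W_k$ is an isomorphism for any $k$ and any $l\ge0$; and furthermore this filtration $M(N,W)$ depends only on the smallest face of $\sigma$ containing $N$. * $\Sigma$ is compatible with $\Gamma$ if $\mathrm{Ad}(\gamma)(\sigma)=\gamma\sigma\gamma^{-1}\in\Sigma$ for all $\gamma\in\Gamma$, $\sigma\in\Sigma$. It is strongly compatible with $\Gamma$ if it is compatible with $\Gamma$ and, for every $\sigma\in\Sigma$, any element of $\sigma$ is a (finite) sum of elements of the form $aN$ with $a\in\mathbb R_{\ge0}$ and $N\in\sigma$ such that $\exp(N)\in\Gamma$. *)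

theory Defs
  imports
    "HOL-Analysis.Analysis"
    "HOL-Homology.Homology"
    "HOL-Library.Function_Algebras"
begin

section \<open>Semi-stable degenerations over the unit disc\<close>

definition holo_on :: "(complex^'d) set \<Rightarrow> (complex^'d \<Rightarrow> complex^'e) \<Rightarrow> bool" where
  "holo_on S g \<longleftrightarrow>
     (\<forall>z\<in>S. \<exists>D. (g has_derivative D) (at z) \<and> (\<forall>c v. D (c *s v) = c *s D v))"

text \<open>
  A complex manifold of pure dimension \<open>CARD('d)\<close> is a topology together with an atlas, i.e. a set
  of pairs (domain, coordinate map). The predicate \<open>holo_chart X A\<close> describes the charts of the
  maximal atlas generated by \<open>A\<close>.
\<close>

definition holo_chart ::
  "'a topology \<Rightarrow> ('a set \<times> ('a \<Rightarrow> complex^'d)) set \<Rightarrow> 'a set \<Rightarrow> ('a \<Rightarrow> complex^'d) \<Rightarrow> bool" where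
  "holo_chart X A U \<phi> \<longleftrightarrow>
     openin X U \<and> open (\<phi> ` U) \<and>
     homeomorphic_map (subtopology X U) (top_of_set (\<phi> ` U)) \<phi> \<and>
     (\<forall>(V, \<psi>) \<in> A. holo_on (\<phi> ` (U \<inter> V)) (\<psi> \<circ> inv_into U \<phi>) \<and>
                   holo_on (\<psi> ` (U \<inter> V)) (\<phi> \<circ> inv_into V \<psi>))"

definition complex_manifold ::
  "'a topology \<Rightarrow> ('a set \<times> ('a \<Rightarrow> complex^'d)) set \<Rightarrow> bool" where
  "complex_manifold X A \<longleftrightarrow>
     Hausdorff_space X \<and> second_countable X \<and>
     \<Union> (fst ` A) = topspace X \<and> (\<forall>(U, \<phi>) \<in> A. holo_chart X A U \<phi>)"

text \<open>
  Smooth over the punctured disc: \<open>f\<close> is locally a coordinate function. Semi-stable at \<open>0\<close>: \<open>f\<close> is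
  locally a product of distinct coordinate functions, i.e. the fibre over \<open>0\<close> is a reduced divisor
  with (not necessarily simple) normal crossings.
\<close>

definition semistable_degeneration ::
  "'a topology \<Rightarrow> ('a set \<times> ('a \<Rightarrow> complex^'d)) set \<Rightarrow> ('a \<Rightarrow> complex) \<Rightarrow> bool" where
  "semistable_degeneration X A f \<longleftrightarrow>
     complex_manifold X A \<and> f ` topspace X \<subseteq> ball 0 1 \<and>
     (\<forall>p \<in> topspace X. f p \<noteq> 0 \<longrightarrow>
        (\<exists>U \<phi> i. holo_chart X A U \<phi> \<and> p \<in> U \<and> (\<forall>x\<in>U. f x = \<phi> x $ i))) \<and>
     (\<forall>p \<in> topspace X. f p = 0 \<longrightarrow>
        (\<exists>U \<phi> I. holo_chart X A U \<phi> \<and> p \<in> U \<and> I \<noteq> {} \<and> \<phi> p = 0 \<and>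
                  (\<forall>x\<in>U. f x = (\<Prod>i\<in>I. \<phi> x $ i))))"

text \<open>
  The points of projective space \<open>P(complex^'n)\<close> are the lines through the origin, with the
  quotient topology.
\<close>

definition cline :: "complex^'n \<Rightarrow> (complex^'n) set" where
  "cline z = range (\<lambda>c. c *s z)"

definition proj_space :: "(complex^'n) set topology" where
  "proj_space =
     topology (\<lambda>U. U \<subseteq> cline ` (- {0}) \<and> open {z. z \<noteq> 0 \<and> cline z \<in> U})"

lemma openin_proj_space:
  fixes U :: "(complex^'n) set set"
  shows "openin proj_space U \<longleftrightarrow> U \<subseteq> cline ` (- {0}) \<and> open {z. z \<noteq> 0 \<and> cline z \<in> U}"
proof -
  have "istopology (\<lambda>U. U \<subseteq> cline ` (- {0 :: complex^'n}) \<and> open {z. z \<noteq> 0 \<and> cline z \<in> U})"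
    unfolding istopology_def
  proof (intro conjI allI impI)
    fix S T :: "(complex^'n) set set"
    assume S: "S \<subseteq> cline ` (- {0}) \<and> open {z. z \<noteq> 0 \<and> cline z \<in> S}"
      and T: "T \<subseteq> cline ` (- {0}) \<and> open {z. z \<noteq> 0 \<and> cline z \<in> T}"
    show "S \<inter> T \<subseteq> cline ` (- {0})"
      using S by blast
    have "{z. z \<noteq> 0 \<and> cline z \<in> S \<inter> T} =
          {z. z \<noteq> 0 \<and> cline z \<in> S} \<inter> {z. z \<noteq> 0 \<and> cline z \<in> T}"
      by blast
    then show "open {z. z \<noteq> 0 \<and> cline z \<in> S \<inter> T}"
      using S T by auto
  next
    fix K :: "(complex^'n) set set set"
    assume K: "\<forall>S\<in>K. S \<subseteq> cline ` (- {0}) \<and> open {z. z \<noteq> 0 \<and> cline z \<in> S}"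
    show "\<Union> K \<subseteq> cline ` (- {0})"
      using K by blast
    have "{z. z \<noteq> 0 \<and> cline z \<in> \<Union> K} = (\<Union>S\<in>K. {z. z \<noteq> 0 \<and> cline z \<in> S})"
      by blast
    then show "open {z. z \<noteq> 0 \<and> cline z \<in> \<Union> K}"
      using K by auto
  qed
  then show ?thesis
    unfolding proj_space_def by (simp add: topology_inverse')
qed

text \<open>
  \<open>(\<iota>, f)\<close> is a closed embedding of \<open>X\<close> into \<open>P(complex^'n) \<times> \<Delta>\<close>: an injective proper immersion
  which is locally given by holomorphic functions, here the affine coordinates \<open>g\<close> on the piece of
  projective space where the \<open>k\<close>-th homogeneous coordinate is \<open>1\<close>. A morphism to the disc is
  projective iff it admits such an \<open>\<iota>\<close>.
\<close>

definition relative_projective_embedding ::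
  "'a topology \<Rightarrow> ('a set \<times> ('a \<Rightarrow> complex^'d)) set \<Rightarrow> ('a \<Rightarrow> complex) \<Rightarrow>
   ('a \<Rightarrow> (complex^'n) set) \<Rightarrow> bool" where
  "relative_projective_embedding X A f \<iota> \<longleftrightarrow>
     inj_on (\<lambda>x. (\<iota> x, f x)) (topspace X) \<and>
     proper_map X (prod_topology proj_space (top_of_set (ball 0 1))) (\<lambda>x. (\<iota> x, f x)) \<and>
     (\<forall>p \<in> topspace X. \<exists>U \<phi> g k.
        holo_chart X A U \<phi> \<and> p \<in> U \<and> holo_on (\<phi> ` U) g \<and>
        (\<forall>x\<in>U. g (\<phi> x) $ k = 1 \<and> \<iota> x = cline (g (\<phi> x))) \<and>
        (\<forall>D D' v. (g has_derivative D) (at (\<phi> p)) \<longrightarrow>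
           ((f \<circ> inv_into U \<phi>) has_derivative D') (at (\<phi> p)) \<longrightarrow>
           D v = 0 \<longrightarrow> D' v = 0 \<longrightarrow> v = 0))"

definition fibre :: "'a topology \<Rightarrow> ('a \<Rightarrow> complex) \<Rightarrow> complex \<Rightarrow> 'a topology" where
  "fibre X f s = subtopology X {x \<in> topspace X. f x = s}"


section \<open>Singular cochains\<close>

text \<open>
  A cochain is a function on maps out of the standard simplex; only its values on the singular
  simplices of the space and degree under consideration matter. In particular, restriction to a
  subspace does not change the function.
\<close>

type_synonym ('a, 'c) cochain = "((nat \<Rightarrow> real) \<Rightarrow> 'a) \<Rightarrow> 'c"

definition coboundary :: "nat \<Rightarrow> ('a, 'c::comm_ring_1) cochain \<Rightarrow> ('a, 'c) cochain" where
  "coboundary p u \<rho> = (\<Sum>k\<le>Suc p. (-1) ^ k * u (singular_face (Suc p) k \<rho>))"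

definition cocycle :: "nat \<Rightarrow> 'a topology \<Rightarrow> ('a, 'c::comm_ring_1) cochain \<Rightarrow> bool" where
  "cocycle p X u \<longleftrightarrow> (\<forall>\<rho>. singular_simplex (Suc p) X \<rho> \<longrightarrow> coboundary p u \<rho> = 0)"

definition exact_cochain :: "nat \<Rightarrow> 'a topology \<Rightarrow> ('a, 'c::comm_ring_1) cochain \<Rightarrow> bool" where
  "exact_cochain p X u \<longleftrightarrow>
     (if p = 0 then (\<forall>\<rho>. singular_simplex 0 X \<rho> \<longrightarrow> u \<rho> = 0)
      else (\<exists>w. \<forall>\<rho>. singular_simplex p X \<rho> \<longrightarrow> u \<rho> = coboundary (p - 1) w \<rho>))"

text \<open>
  Since \<open>standard_simplex p\<close> consists of sequences vanishing beyond \<open>p\<close>, the front \<open>p\<close>-face is a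
  plain restriction and the back face is a shift.
\<close>

definition cup ::
  "nat \<Rightarrow> nat \<Rightarrow> ('a, 'c::comm_ring_1) cochain \<Rightarrow> ('a, 'c) cochain \<Rightarrow> ('a, 'c) cochain" where
  "cup p q u w \<rho> =
     u (restrict \<rho> (standard_simplex p)) *
     w (restrict (\<lambda>t. \<rho> (\<lambda>i. if i < p then 0 else t (i - p))) (standard_simplex q))"

definition pullback :: "nat \<Rightarrow> ('b \<Rightarrow> 'a) \<Rightarrow> ('a, 'c) cochain \<Rightarrow> ('b, 'c) cochain" where
  "pullback p g u \<rho> = u (simplex_map p g \<rho>)"

definition chain_eval :: "('a, 'c::comm_ring_1) cochain \<Rightarrow> 'a chain \<Rightarrow> 'c" where
  "chain_eval u c = (\<Sum>\<rho>\<in>Poly_Mapping.keys c. of_int (Poly_Mapping.lookup c \<rho>) * u \<rho>)"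


section \<open>Polarizations\<close>

text \<open>
  The first Chern class of \<open>O(1)\<close> is the class of value \<open>1\<close> on a line with its complex orientation.
  The line spanned by the coordinate axes \<open>a\<close>, \<open>b\<close> is represented by a triangle whose interior is
  mapped homeomorphically, preserving orientation, onto the affine line with coordinate
  \<open>z$b / z$a\<close>, and whose boundary is collapsed to the point at infinity; subtracting the constant
  triangle there gives a cycle.
\<close>

definition line_simplex :: "'n \<Rightarrow> 'n \<Rightarrow> (nat \<Rightarrow> real) \<Rightarrow> (complex^'n) set" where
  "line_simplex a b =
     restrict (\<lambda>t. cline (axis a (of_real (t 0 * t 1 * t 2)) +
                          axis b (Complex (t 1 - t 0) (t 2 - t 0)))) (standard_simplex 2)"

definition hyperplane_class :: "((complex^'n) set, int) cochain \<Rightarrow> bool" where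
  "hyperplane_class h \<longleftrightarrow>
     cocycle 2 proj_space h \<and>
     (\<forall>a b. a \<noteq> b \<longrightarrow>
        h (line_simplex a b) - h (restrict (\<lambda>t. cline (axis b 1)) (standard_simplex 2)) = 1)"

text \<open>
  \<open>\<eta>\<close> represents the first Chern class of a relatively ample line bundle on \<open>X / \<Delta>\<close>, a positive
  power of which is the pullback of \<open>O(1)\<close> under the relative embedding \<open>\<iota>\<close>.
\<close>

definition polarization ::
  "'a topology \<Rightarrow> ('a set \<times> ('a \<Rightarrow> complex^'d)) set \<Rightarrow> ('a \<Rightarrow> complex) \<Rightarrow>
   ('a \<Rightarrow> (complex^'n) set) \<Rightarrow> ('a, int) cochain \<Rightarrow> bool" where
  "polarization X A f \<iota> \<eta> \<longleftrightarrow>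
     relative_projective_embedding X A f \<iota> \<and> cocycle 2 X \<eta> \<and>
     (\<exists>h m. hyperplane_class h \<and> m > (0::int) \<and>
        exact_cochain 2 X (\<lambda>\<rho>. m * \<eta> \<rho> - pullback 2 \<iota> h \<rho>))"

text \<open>
  \<open>c\<close> is a cycle representing the fundamental class, for the complex orientation, of the fibre over
  \<open>s \<noteq> 0\<close>, a compact complex manifold of dimension \<open>n = CARD('d) - 1\<close>: at each point it agrees with
  a positively oriented simplex that is affine in a chart one of whose coordinates (the \<open>i\<close>-th) is
  \<open>f\<close>; \<open>e\<close> enumerates the other coordinates. The simplex has its barycentre at the given point.
\<close>

definition chart_simplex ::
  "'d::finite \<Rightarrow> (nat \<Rightarrow> 'd) \<Rightarrow> real \<Rightarrow> (nat \<Rightarrow> real) \<Rightarrow> complex^'d" where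
  "chart_simplex i e \<epsilon> t =
     (\<Sum>l<CARD('d) - 1.
        axis (e l) (of_real \<epsilon> * Complex (t (2 * l + 1) - t 0) (t (2 * l + 2) - t 0)))"

definition fundamental_cycle ::
  "'a topology \<Rightarrow> ('a set \<times> ('a \<Rightarrow> complex^'d)) set \<Rightarrow> ('a \<Rightarrow> complex) \<Rightarrow> complex \<Rightarrow> 'a chain \<Rightarrow> bool"
  where
  "fundamental_cycle X A f s c \<longleftrightarrow>
     (let n = CARD('d) - 1; Xs = fibre X f s in
      singular_relcycle (2 * n) Xs {} c \<and>
      (\<forall>U \<phi> i e \<epsilon> p.
         holo_chart X A U \<phi> \<and> p \<in> U \<and> (\<forall>x\<in>U. f x = \<phi> x $ i) \<and> f p = s \<and>
         bij_betw e {..<n} (- {i}) \<and> \<epsilon> > 0 \<and>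
         (\<forall>t \<in> standard_simplex (2 * n). \<phi> p + chart_simplex i e \<epsilon> t \<in> \<phi> ` U) \<longrightarrow>
         homologous_rel (2 * n) Xs (topspace Xs - {p}) c
           (frag_of (restrict (\<lambda>t. inv_into U \<phi> (\<phi> p + chart_simplex i e \<epsilon> t))
                       (standard_simplex (2 * n))))))"

text \<open>\<open>lefschetz \<eta> k j u\<close> is \<open>\<eta>\<^sup>j \<union> u\<close> for a cochain \<open>u\<close> of degree \<open>k\<close>.\<close>

fun lefschetz ::
  "('a, 'c::comm_ring_1) cochain \<Rightarrow> nat \<Rightarrow> nat \<Rightarrow> ('a, 'c) cochain \<Rightarrow> ('a, 'c) cochain" where
  "lefschetz \<eta> k 0 u = u"
| "lefschetz \<eta> k (Suc j) u = cup 2 (k + 2 * j) \<eta> (lefschetz \<eta> k j u)"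

definition primitive ::
  "nat \<Rightarrow> 'a topology \<Rightarrow> ('a, 'c::comm_ring_1) cochain \<Rightarrow> nat \<Rightarrow> ('a, 'c) cochain \<Rightarrow> bool" where
  "primitive n Y \<eta> m u \<longleftrightarrow>
     cocycle m Y u \<and> exact_cochain (m + 2 * (n + 1 - m)) Y (lefschetz \<eta> m (n + 1 - m) u)"

text \<open>
  The Lefschetz decomposition of degree \<open>k\<close> cohomology of a compact manifold of dimension \<open>n\<close> is
  the sum, over \<open>j\<close> in \<open>lefschetz_range n k\<close>, of \<open>\<eta>\<^sup>j\<close> times the primitive part in degree
  \<open>k - 2j \<le> n - j\<close>.
\<close>

definition lefschetz_range :: "nat \<Rightarrow> nat \<Rightarrow> nat set" where
  "lefschetz_range n k = {j. 2 * j \<le> k \<and> k \<le> n + j}"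

definition lefschetz_decomposition ::
  "nat \<Rightarrow> 'a topology \<Rightarrow> ('a, 'c::comm_ring_1) cochain \<Rightarrow> nat \<Rightarrow> ('a, 'c) cochain \<Rightarrow>
   (nat \<Rightarrow> ('a, 'c) cochain) \<Rightarrow> bool" where
  "lefschetz_decomposition n Y \<eta> k u us \<longleftrightarrow>
     (\<forall>j \<in> lefschetz_range n k. primitive n Y \<eta> (k - 2 * j) (us j)) \<and>
     exact_cochain k Y
       (\<lambda>\<rho>. u \<rho> - (\<Sum>j \<in> lefschetz_range n k. lefschetz \<eta> (k - 2 * j) j (us j) \<rho>))"

text \<open>The Hodge-Riemann form, \<open>c\<close> being a fundamental cycle.\<close>

definition hodge_riemann ::
  "nat \<Rightarrow> 'a chain \<Rightarrow> ('a, 'c::comm_ring_1) cochain \<Rightarrow> nat \<Rightarrow>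
   (nat \<Rightarrow> ('a, 'c) cochain) \<Rightarrow> (nat \<Rightarrow> ('a, 'c) cochain) \<Rightarrow> 'c" where
  "hodge_riemann n c \<eta> k us ws =
     (\<Sum>j \<in> lefschetz_range n k. let m = k - 2 * j in
        (-1) ^ (m * (m - 1) div 2) *
        chain_eval (lefschetz \<eta> (2 * m) (n - m) (cup m m (us j) (ws j))) c)"


section \<open>The lattice, its pairing and its monodromy\<close>

text \<open>
  A free abelian group of finite rank with its real and rational forms: \<open>'v\<close> is the real vector
  space, \<open>B\<close> a basis of the lattice. (A bare \<open>real_vector\<close> is used so that rank \<open>0\<close> is possible.)
\<close>

definition lattice_basis :: "'v::real_vector set \<Rightarrow> bool" where
  "lattice_basis B \<longleftrightarrow> finite B \<and> independent B \<and> span B = UNIV"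

definition zlattice :: "'v::real_vector set \<Rightarrow> 'v set" where
  "zlattice B = {\<Sum>b\<in>B. a b *\<^sub>R b | a. \<forall>b\<in>B. a b \<in> \<int>}"

definition qspace :: "'v::real_vector set \<Rightarrow> 'v set" where
  "qspace B = {\<Sum>b\<in>B. a b *\<^sub>R b | a. \<forall>b\<in>B. a b \<in> \<rat>}"

text \<open>
  \<open>cl\<close> identifies integral cohomology in degree \<open>k\<close> modulo torsion with \<open>zlattice B\<close>.
\<close>

definition cohomology_lattice ::
  "nat \<Rightarrow> 'a topology \<Rightarrow> 'v::real_vector set \<Rightarrow> (('a, int) cochain \<Rightarrow> 'v) \<Rightarrow> bool" where
  "cohomology_lattice k Y B cl \<longleftrightarrow>
     lattice_basis B \<and>
     cl ` {u. cocycle k Y u} = zlattice B \<and>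
     (\<forall>u w. cocycle k Y u \<longrightarrow> cocycle k Y w \<longrightarrow> cl (\<lambda>\<rho>. u \<rho> + w \<rho>) = cl u + cl w) \<and>
     (\<forall>u. cocycle k Y u \<longrightarrow>
        (cl u = 0 \<longleftrightarrow> (\<exists>m>0. exact_cochain k Y (\<lambda>\<rho>. m * u \<rho>))))"

definition is_polarization_pairing ::
  "'a topology \<Rightarrow> ('a set \<times> ('a \<Rightarrow> complex^'d)) set \<Rightarrow> ('a \<Rightarrow> complex) \<Rightarrow> ('a, int) cochain \<Rightarrow>
   complex \<Rightarrow> nat \<Rightarrow> (('a, int) cochain \<Rightarrow> 'v) \<Rightarrow> ('v::real_vector \<Rightarrow> 'v \<Rightarrow> real) \<Rightarrow> bool" where
  "is_polarization_pairing X A f \<eta> s k cl form \<longleftrightarrow>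
     (let n = CARD('d) - 1; Y = fibre X f s; \<eta>' = (\<lambda>\<rho>. of_int (\<eta> \<rho>) :: rat) in
      \<forall>u w us ws c.
        cocycle k Y u \<and> cocycle k Y w \<and> fundamental_cycle X A f s c \<and>
        lefschetz_decomposition n Y \<eta>' k (\<lambda>\<rho>. of_int (u \<rho>)) us \<and>
        lefschetz_decomposition n Y \<eta>' k (\<lambda>\<rho>. of_int (w \<rho>)) ws \<longrightarrow>
        form (cl u) (cl w) = of_rat (hodge_riemann n c \<eta>' k us ws))"

text \<open>
  Monodromy along \<open>t \<mapsto> s exp(2\<pi>it)\<close>: the cohomology of the pullback of the family to \<open>[0,1]\<close>
  restricts isomorphically to the fibres over both ends, which are both the fibre over \<open>s\<close>; \<open>\<gamma>\<close>
  is the resulting map from the cohomology at \<open>t = 0\<close> to that at \<open>t = 1\<close>.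
\<close>

definition loop_family :: "'a topology \<Rightarrow> ('a \<Rightarrow> complex) \<Rightarrow> complex \<Rightarrow> ('a \<times> real) topology" where
  "loop_family X f s =
     subtopology (prod_topology X (top_of_set {0..1})) {(x, t). f x = s * cis (2 * pi * t)}"

definition is_local_monodromy ::
  "'a topology \<Rightarrow> ('a \<Rightarrow> complex) \<Rightarrow> complex \<Rightarrow> nat \<Rightarrow> (('a, int) cochain \<Rightarrow> 'v) \<Rightarrow> ('v \<Rightarrow> 'v) \<Rightarrow> bool"
  where
  "is_local_monodromy X f s k cl \<gamma> \<longleftrightarrow>
     (\<forall>u. cocycle k (loop_family X f s) u \<longrightarrow>
        \<gamma> (cl (pullback k (\<lambda>x. (x, 0)) u)) = cl (pullback k (\<lambda>x. (x, 1)) u))"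

definition nilpotent_map :: "('w::real_vector \<Rightarrow> 'w) \<Rightarrow> bool" where
  "nilpotent_map N \<longleftrightarrow> (\<exists>m. \<forall>x. (N ^^ m) x = 0)"

definition nil_index :: "('w::real_vector \<Rightarrow> 'w) \<Rightarrow> nat" where
  "nil_index N = (LEAST m. \<forall>x. (N ^^ m) x = 0)"

definition nil_exp :: "('w::real_vector \<Rightarrow> 'w) \<Rightarrow> 'w \<Rightarrow> 'w" where
  "nil_exp N x = (\<Sum>k<nil_index N. (1 / fact k) *\<^sub>R (N ^^ k) x)"

definition unipotent_map :: "('w::real_vector \<Rightarrow> 'w) \<Rightarrow> bool" where
  "unipotent_map g \<longleftrightarrow> nilpotent_map (\<lambda>x. g x - x)"

definition unip_log :: "('w::real_vector \<Rightarrow> 'w) \<Rightarrow> 'w \<Rightarrow> 'w" where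
  "unip_log g x =
     (\<Sum>k\<in>{1..<nil_index (\<lambda>x. g x - x)}. ((-1) ^ (k + 1) / real k) *\<^sub>R ((\<lambda>x. g x - x) ^^ k) x)"

text \<open>
  The pairing and the monodromy, extended linearly from the lattice to \<open>'v\<close>, with the standard
  properties that they have in the geometric situation.
\<close>

definition lattice_pairing :: "'v::real_vector set \<Rightarrow> ('v \<Rightarrow> 'v \<Rightarrow> real) \<Rightarrow> bool" where
  "lattice_pairing B form \<longleftrightarrow>
     (\<forall>x. linear (form x)) \<and> (\<forall>y. linear (\<lambda>x. form x y)) \<and>
     (\<forall>x \<in> zlattice B. \<forall>y \<in> zlattice B. form x y \<in> \<rat>) \<and>
     (\<forall>x y. form x y = - form y x) \<and>
     (\<forall>x. (\<forall>y. form x y = 0) \<longrightarrow> x = 0)"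

definition unipotent_lattice_isometry ::
  "'v::real_vector set \<Rightarrow> ('v \<Rightarrow> 'v \<Rightarrow> real) \<Rightarrow> ('v \<Rightarrow> 'v) \<Rightarrow> bool" where
  "unipotent_lattice_isometry B form \<gamma> \<longleftrightarrow>
     linear \<gamma> \<and> bij \<gamma> \<and> \<gamma> ` zlattice B = zlattice B \<and>
     (\<forall>x y. form (\<gamma> x) (\<gamma> y) = form x y) \<and> unipotent_map \<gamma>"


section \<open>The extension by Z and its automorphisms\<close>

text \<open>
  With \<open>'v\<close> for the real form of \<open>H'\<close>, the real form of \<open>H = H' \<oplus> \<int>\<close> is \<open>'v \<times> real\<close>. A map
  preserving \<open>W\<close> induces \<open>gr_minus1\<close> and \<open>gr_0\<close> on the graded pieces \<open>'v\<close> and \<open>real\<close>.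
\<close>

definition H_int :: "'v::real_vector set \<Rightarrow> ('v \<times> real) set" where
  "H_int B = zlattice B \<times> \<int>"

definition H_rat :: "'v::real_vector set \<Rightarrow> ('v \<times> real) set" where
  "H_rat B = qspace B \<times> \<rat>"

definition W :: "int \<Rightarrow> ('v::real_vector \<times> real) set" where
  "W k = (if k \<le> -2 then {0} else if k = -1 then UNIV \<times> {0} else UNIV)"

definition gr_minus1 :: "('v::real_vector \<times> real \<Rightarrow> 'v \<times> real) \<Rightarrow> 'v \<Rightarrow> 'v" where
  "gr_minus1 h u = fst (h (u, 0))"

definition gr_0 :: "('v::real_vector \<times> real \<Rightarrow> 'v \<times> real) \<Rightarrow> real \<Rightarrow> real" where
  "gr_0 h a = snd (h (0, a))"

definition G_int ::
  "'v::real_vector set \<Rightarrow> ('v \<Rightarrow> 'v \<Rightarrow> real) \<Rightarrow> ('v \<times> real \<Rightarrow> 'v \<times> real) set" where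
  "G_int B form =
     {g. linear g \<and> bij g \<and> g ` H_int B = H_int B \<and> (\<forall>k. g ` W k = W k) \<and>
         (\<forall>a b. gr_0 g a * gr_0 g b = a * b) \<and>
         (\<forall>x y. form (gr_minus1 g x) (gr_minus1 g y) = form x y)}"

definition Gamma_H' :: "('v \<Rightarrow> 'v) \<Rightarrow> ('v \<Rightarrow> 'v) set" where
  "Gamma_H' \<gamma> = range (\<lambda>n. \<gamma> ^^ n) \<union> range (\<lambda>n. inv_into UNIV \<gamma> ^^ n)"

definition Gamma_H ::
  "'v::real_vector set \<Rightarrow> ('v \<Rightarrow> 'v \<Rightarrow> real) \<Rightarrow> ('v \<Rightarrow> 'v) \<Rightarrow> ('v \<times> real \<Rightarrow> 'v \<times> real) set" where
  "Gamma_H B form \<gamma> = {g \<in> G_int B form. gr_minus1 g \<in> Gamma_H' \<gamma>}"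

definition lie_g :: "('v::real_vector \<Rightarrow> 'v \<Rightarrow> real) \<Rightarrow> ('v \<times> real \<Rightarrow> 'v \<times> real) set" where
  "lie_g form =
     {h. linear h \<and> (\<forall>k. h ` W k \<subseteq> W k) \<and>
         (\<forall>a b. gr_0 h a * b + a * gr_0 h b = 0) \<and>
         (\<forall>x y. form (gr_minus1 h x) y + form x (gr_minus1 h y) = 0)}"

definition lie_g_rat ::
  "'v::real_vector set \<Rightarrow> ('v \<Rightarrow> 'v \<Rightarrow> real) \<Rightarrow> ('v \<times> real \<Rightarrow> 'v \<times> real) set" where
  "lie_g_rat B form = {h \<in> lie_g form. h ` H_rat B \<subseteq> H_rat B}"


section \<open>Cones and fans\<close>

text \<open>Pointwise scalar multiplication, so that cones of endomorphisms are sets in a real vector space.\<close>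

instantiation "fun" :: (type, real_vector) real_vector
begin

definition scaleR_fun :: "real \<Rightarrow> ('a \<Rightarrow> 'b) \<Rightarrow> 'a \<Rightarrow> 'b" where
  "scaleR_fun a h = (\<lambda>x. a *\<^sub>R h x)"

instance
  by standard (simp_all add: scaleR_fun_def plus_fun_def scaleR_add_right scaleR_add_left)

end

type_synonym 'v endo = "'v \<times> real \<Rightarrow> 'v \<times> real"

definition nilpotent_cone :: "('v::real_vector \<Rightarrow> 'v \<Rightarrow> real) \<Rightarrow> 'v endo set \<Rightarrow> bool" where
  "nilpotent_cone form \<sigma> \<longleftrightarrow>
     (\<exists>S. finite S \<and> S \<subseteq> lie_g form \<and> (\<forall>N\<in>S. nilpotent_map N) \<and>
          (\<forall>N\<in>S. \<forall>N'\<in>S. N \<circ> N' = N' \<circ> N) \<and> \<sigma> = convex_cone hull S) \<and>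
     \<sigma> \<inter> uminus ` \<sigma> = {0}"

definition rational_nilpotent_cone ::
  "'v::real_vector set \<Rightarrow> ('v \<Rightarrow> 'v \<Rightarrow> real) \<Rightarrow> 'v endo set \<Rightarrow> bool" where
  "rational_nilpotent_cone B form \<sigma> \<longleftrightarrow>
     nilpotent_cone form \<sigma> \<and>
     (\<exists>S. finite S \<and> S \<subseteq> lie_g_rat B form \<and> \<sigma> = convex_cone hull S)"

text \<open>In the library, the empty set is a face of every convex set; it is not a face of a cone.\<close>

definition cone_face :: "'v::real_vector endo set \<Rightarrow> 'v endo set \<Rightarrow> bool" where
  "cone_face \<tau> \<sigma> \<longleftrightarrow> \<tau> face_of \<sigma> \<and> \<tau> \<noteq> {}"

definition fan ::
  "'v::real_vector set \<Rightarrow> ('v \<Rightarrow> 'v \<Rightarrow> real) \<Rightarrow> 'v endo set set \<Rightarrow> bool" where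
  "fan B form \<Sigma> \<longleftrightarrow>
     \<Sigma> \<noteq> {} \<and> (\<forall>\<sigma>\<in>\<Sigma>. rational_nilpotent_cone B form \<sigma>) \<and>
     (\<forall>\<sigma>\<in>\<Sigma>. \<forall>\<tau>. cone_face \<tau> \<sigma> \<longrightarrow> \<tau> \<in> \<Sigma>) \<and>
     (\<forall>\<sigma>\<in>\<Sigma>. \<forall>\<tau>\<in>\<Sigma>. cone_face (\<sigma> \<inter> \<tau>) \<sigma> \<and> cone_face (\<sigma> \<inter> \<tau>) \<tau>)"

definition finite_subdivision ::
  "'v::real_vector set \<Rightarrow> ('v \<Rightarrow> 'v \<Rightarrow> real) \<Rightarrow> 'v endo set \<Rightarrow> 'v endo set set \<Rightarrow> bool" where
  "finite_subdivision B form \<sigma> T \<longleftrightarrow> finite T \<and> fan B form T \<and> \<Union> T = \<sigma>"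

text \<open>\<open>h\<close> induces an isomorphism of the subquotients \<open>P/P'\<close> and \<open>Q/Q'\<close>.\<close>

definition subquotient_iso ::
  "('w::real_vector \<Rightarrow> 'w) \<Rightarrow> 'w set \<Rightarrow> 'w set \<Rightarrow> 'w set \<Rightarrow> 'w set \<Rightarrow> bool" where
  "subquotient_iso h P P' Q Q' \<longleftrightarrow>
     h ` P \<subseteq> Q \<and> h ` P' \<subseteq> Q' \<and>
     (\<forall>x\<in>P. h x \<in> Q' \<longrightarrow> x \<in> P') \<and> (\<forall>y\<in>Q. \<exists>x\<in>P. y - h x \<in> Q')"

text \<open>
  \<open>M_on_gr_W M j k\<close> is the preimage in \<open>W k\<close> of the \<open>j\<close>-th step of the filtration induced by \<open>M\<close> on
  \<open>W k / W (k - 1)\<close>.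
\<close>

definition M_on_gr_W ::
  "(int \<Rightarrow> ('v::real_vector \<times> real) set) \<Rightarrow> int \<Rightarrow> int \<Rightarrow> ('v \<times> real) set" where
  "M_on_gr_W M j k = {x + y | x y. x \<in> M j \<inter> W k \<and> y \<in> W (k - 1)}"

definition is_relative_filtration ::
  "'v::real_vector endo \<Rightarrow> (int \<Rightarrow> ('v \<times> real) set) \<Rightarrow> bool" where
  "is_relative_filtration N M \<longleftrightarrow>
     (\<forall>k. subspace (M k)) \<and> mono M \<and> (\<exists>a b. M a = {0} \<and> M b = UNIV) \<and>
     (\<forall>k. N ` M k \<subseteq> M (k - 2)) \<and>
     (\<forall>k. \<forall>l::nat. subquotient_iso (N ^^ l)
        (M_on_gr_W M (k + int l) k) (M_on_gr_W M (k + int l - 1) k)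
        (M_on_gr_W M (k - int l) k) (M_on_gr_W M (k - int l - 1) k))"

definition smallest_face :: "'v::real_vector endo set \<Rightarrow> 'v endo \<Rightarrow> 'v endo set" where
  "smallest_face \<sigma> N = \<Inter> {\<tau>. cone_face \<tau> \<sigma> \<and> N \<in> \<tau>}"

definition admissible :: "'v::real_vector endo set \<Rightarrow> bool" where
  "admissible \<sigma> \<longleftrightarrow>
     (\<forall>N\<in>\<sigma>. \<exists>M. is_relative_filtration N M) \<and>
     (\<forall>N1\<in>\<sigma>. \<forall>N2\<in>\<sigma>. \<forall>M1 M2.
        smallest_face \<sigma> N1 = smallest_face \<sigma> N2 \<longrightarrow>
        is_relative_filtration N1 M1 \<longrightarrow> is_relative_filtration N2 M2 \<longrightarrow> M1 = M2)"

definition compatible :: "'v::real_vector endo set \<Rightarrow> 'v endo set set \<Rightarrow> bool" where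
  "compatible G \<Sigma> \<longleftrightarrow> (\<forall>g\<in>G. \<forall>\<sigma>\<in>\<Sigma>. (\<lambda>N. g \<circ> N \<circ> inv_into UNIV g) ` \<sigma> \<in> \<Sigma>)"

definition strongly_compatible :: "'v::real_vector endo set \<Rightarrow> 'v endo set set \<Rightarrow> bool" where
  "strongly_compatible G \<Sigma> \<longleftrightarrow>
     compatible G \<Sigma> \<and>
     (\<forall>\<sigma>\<in>\<Sigma>. \<forall>N\<in>\<sigma>. \<exists>S a. finite S \<and> S \<subseteq> {N' \<in> \<sigma>. nil_exp N' \<in> G} \<and>
        (\<forall>N'\<in>S. a N' \<ge> (0::real)) \<and> N = (\<Sum>N'\<in>S. a N' *\<^sub>R N'))"

text \<open>The restriction of each element of \<open>\<sigma>\<close> to the real form of \<open>H'\<close> lies in \<open>\<real>\<^sub>\<ge>\<^sub>0 N'\<close>.\<close>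

definition restricts_into_ray :: "('v::real_vector \<Rightarrow> 'v) \<Rightarrow> 'v endo set \<Rightarrow> bool" where
  "restricts_into_ray N' \<sigma> \<longleftrightarrow> (\<forall>N\<in>\<sigma>. \<exists>a\<ge>0. \<forall>u. N (u, 0) = (a *\<^sub>R N' u, 0))"

end

theory Submission
  imports Defs
begin

text \<open>
  Let \<open>V\<close> be the real form of \<open>H'\<close>, \<open>L\<close> its lattice and \<open>N\<close> the logarithm of the local monodromy
  \<open>g\<close>. An element of the Lie algebra that restricts to \<open>a N\<close> on \<open>V\<close> is a pair \<open>(a, w)\<close>, acting by
  \<open>(v, t) \<mapsto> (a N v + t w, 0)\<close>. Everything rests on three observations.

  \<^item> The relative filtration of \<open>(a, w)\<close> exists iff \<open>w \<in> a N V\<close>. Necessity: a lift of \<open>1 \<in> gr\<^sub>0\<close> to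
    \<open>M\<^sub>0\<close> is sent into \<open>M\<^sub>-\<^sub>2 \<inter> V\<close>, and this step of the monodromy filtration lies in the image
    of \<open>a N\<close> (lemmas \<open>relative_filtration_unique_shape\<close>, \<open>relative_filtration_extension\<close>).

  \<^item> For \<open>a, a' > 0\<close> the elements \<open>(a, w)\<close> and \<open>(a', w')\<close> with slopes \<open>w/a, w'/a' \<in> N V\<close> commute iff
    the slopes differ by an element of \<open>K = ker N \<inter> im N\<close>. Now \<open>K\<close> lies in \<open>M\<^sub>-\<^sub>2\<close>, so that commuting
    elements have the same relative filtration (lemma \<open>relative_filtration_endo_unique\<close>). Hence the
    cones in question are exactly the rational cones that lie over one coset \<open>c + K \<subseteq> N V\<close> with a
    rational point, embedded in the slice \<open>a = 1\<close>, and meet \<open>a = 0\<close> in \<open>0\<close> only. (Here \<open>N \<noteq> 0\<close>; if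
    \<open>N = 0\<close>, the only such cone is \<open>{0}\<close>.)

  \<^item> An element of the arithmetic group acts on the slice \<open>a = 1\<close> by \<open>w \<mapsto> \<plusminus>(h w - N b)\<close> with \<open>b \<in> L\<close>
    and \<open>h\<close> a power of \<open>g\<close>. As \<open>g\<close> is the identity on \<open>ker N\<close>, this map from a coset of \<open>K\<close> to
    another one is, up to sign, a translation.

  So each coset with a rational point is cut by the hyperplanes on which a lattice coordinate takes a value in
  \<open>(1/d) \<int>\<close>, where \<open>d\<close> is the least positive integer such that \<open>d N L \<subseteq> L\<close> and the coset
  contains a point of \<open>(1/d) L\<close>. This \<open>d\<close> is constant on orbits of cosets, and the translations above
  are by vectors of \<open>(1/d) L\<close>, so the cutting is equivariant (lemma \<open>cell_affine_move\<close>). The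
  cones over the resulting boxes and their faces form the fan. It is relatively complete because a
  polyhedral cone over the coset has bounded slopes and meets finitely many boxes (lemma
  \<open>subdivision_exists\<close>). It is strongly compatible because every rational ray over a coset contains
  an element whose exponential lies in the arithmetic group: for slope \<open>N u\<close> the exponential of
  \<open>(n, n N u)\<close> is \<open>(v, t) \<mapsto> (g\<^sup>n v + t (g\<^sup>n u - u), t)\<close>, and \<open>g\<^sup>n u - u \<in> L\<close> for some \<open>n > 0\<close> by the
  pigeonhole principle (lemmas \<open>nil_exp_endo\<close>, \<open>return_to_lattice\<close>).
\<close>

section \<open>Polyhedral cones and their faces\<close>

lemma convex_cone_sum:
  assumes "convex_cone P" "\<And>i. i \<in> I \<Longrightarrow> 0 \<le> a i" "\<And>i. i \<in> I \<Longrightarrow> x i \<in> P"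
  shows "(\<Sum>i\<in>I. a i *\<^sub>R x i) \<in> P"
proof (cases "finite I")
  case True
  then show ?thesis using assms(2,3)
  proof (induction I)
    case empty
    show ?case using assms(1) by (simp add: convex_cone_contains_0)
  next
    case (insert i I)
    then have "a i *\<^sub>R x i \<in> P" "(\<Sum>i\<in>I. a i *\<^sub>R x i) \<in> P"
      using convex_cone_scaleR[OF assms(1)] by auto
    then show ?case using insert.hyps convex_cone_add[OF assms(1)] by simp
  qed
qed (use assms(1) in \<open>simp add: convex_cone_contains_0\<close>)

lemma convex_cone_hull_finite:
  assumes "finite S"
  shows "convex_cone hull S = {\<Sum>s\<in>S. a s *\<^sub>R s | a. \<forall>s\<in>S. 0 \<le> a s}" (is "_ = ?R")
proof (rule hull_unique)
  show "S \<subseteq> ?R"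
  proof
    fix s assume "s \<in> S"
    then have "(\<Sum>t\<in>S. if t = s then t else 0) = s"
      using assms by simp
    then have "s = (\<Sum>t\<in>S. (if t = s then 1 else 0) *\<^sub>R t)"
      by (simp add: if_distrib[of "\<lambda>a. a *\<^sub>R t" for t] cong: if_cong)
    then show "s \<in> ?R"
      by (intro CollectI exI[of _ "\<lambda>t. if t = s then 1 else 0"]) auto
  qed
  show "convex_cone ?R"
    unfolding convex_cone_iff
  proof (intro conjI ballI allI impI)
    show "0 \<in> ?R" by (rule CollectI, rule exI[of _ "\<lambda>_. 0"]) auto
  next
    fix x y assume "x \<in> ?R" "y \<in> ?R"
    then obtain a b where "x = (\<Sum>s\<in>S. a s *\<^sub>R s)" "y = (\<Sum>s\<in>S. b s *\<^sub>R s)"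
      "\<forall>s\<in>S. 0 \<le> a s" "\<forall>s\<in>S. 0 \<le> b s" by blast
    then show "x + y \<in> ?R"
      by (intro CollectI exI[of _ "\<lambda>s. a s + b s"]) (auto simp: scaleR_add_left sum.distrib)
  next
    fix x c assume "x \<in> ?R" and "0 \<le> (c::real)"
    then obtain a where "x = (\<Sum>s\<in>S. a s *\<^sub>R s)" "\<forall>s\<in>S. 0 \<le> a s" by blast
    with \<open>0 \<le> c\<close> show "c *\<^sub>R x \<in> ?R"
      by (intro CollectI exI[of _ "\<lambda>s. c * a s"]) (auto simp: scaleR_sum_right)
  qed
  show "?R \<subseteq> T'" if "S \<subseteq> T'" "convex_cone T'" for T'
    using that by (auto intro!: convex_cone_sum)
qed

lemma mem_convex_cone_hull_finite:
  "finite S \<Longrightarrow> x \<in> convex_cone hull S \<Longrightarrow> \<exists>a. x = (\<Sum>s\<in>S. a s *\<^sub>R s) \<and> (\<forall>s\<in>S. 0 \<le> a s)"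
  by (simp add: convex_cone_hull_finite)

lemma convex_cone_hull_linear_image:
  assumes "linear f"
  shows "convex_cone hull (f ` S) = f ` (convex_cone hull S)"
proof
  have "f ` S \<subseteq> f ` (convex_cone hull S)"
    by (intro image_mono hull_subset)
  then show "convex_cone hull (f ` S) \<subseteq> f ` (convex_cone hull S)"
    by (rule hull_minimal)
      (use assms in \<open>auto intro: convex_cone_linear_image convex_cone_convex_cone_hull\<close>)
  have "convex_cone {x. f x \<in> convex_cone hull (f ` S)}"
    using convex_cone_convex_cone_hull[of "f ` S"]
    by (simp add: convex_cone_iff linear_0[OF assms] linear_add[OF assms] linear_cmul[OF assms])
  then have "convex_cone hull S \<subseteq> {x. f x \<in> convex_cone hull (f ` S)}"
    by (intro hull_minimal) (auto intro: hull_inc)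
  then show "f ` (convex_cone hull S) \<subseteq> convex_cone hull (f ` S)" by blast
qed

lemma convex_cone_Int:
  "convex_cone P \<Longrightarrow> convex_cone Q \<Longrightarrow> convex_cone (P \<inter> Q)"
  by (auto simp: convex_cone_iff)

text \<open>
  For cones, faces are more conveniently tested with sums than with segments.
\<close>
definition extreme_subcone :: "'b::real_vector set \<Rightarrow> 'b set \<Rightarrow> bool" where
  "extreme_subcone F P \<longleftrightarrow>
     convex_cone F \<and> F \<subseteq> P \<and> (\<forall>x\<in>P. \<forall>y\<in>P. x + y \<in> F \<longrightarrow> x \<in> F \<and> y \<in> F)"

lemma extreme_subcone_iff_face:
  assumes P: "convex_cone P"
  shows "extreme_subcone F P \<longleftrightarrow> F face_of P \<and> F \<noteq> {}"
proof
  assume F: "extreme_subcone F P"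
  have "a \<in> F \<and> b \<in> F" if ab: "a \<in> P" "b \<in> P" and x: "x \<in> F" "x \<in> open_segment a b" for a b x
  proof -
    obtain u where u: "0 < u" "u < 1" "x = (1 - u) *\<^sub>R a + u *\<^sub>R b"
      using x(2) by (auto simp: in_segment)
    have "(1 - u) *\<^sub>R a \<in> F \<and> u *\<^sub>R b \<in> F"
    proof -
      have "(1 - u) *\<^sub>R a \<in> P" "u *\<^sub>R b \<in> P"
        using u convex_cone_scaleR[OF P] ab by auto
      then show ?thesis using F x(1) u(3) unfolding extreme_subcone_def by blast
    qed
    moreover have "convex_cone F" using F by (simp add: extreme_subcone_def)
    ultimately have "(1 / (1 - u)) *\<^sub>R (1 - u) *\<^sub>R a \<in> F \<and> (1 / u) *\<^sub>R u *\<^sub>R b \<in> F"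
      using u convex_cone_scaleR[of F] by (metis diff_ge_0_iff_ge less_imp_le zero_le_divide_1_iff)
    then show ?thesis using u by simp
  qed
  then show "F face_of P \<and> F \<noteq> {}"
    using F unfolding face_of_def extreme_subcone_def convex_cone_def by blast
next
  assume "F face_of P \<and> F \<noteq> {}"
  then have F: "F face_of P" "F \<noteq> {}" by auto
  have sub: "F \<subseteq> P" and cvx: "convex F" using F by (auto simp: face_of_def)
  have pos: "c *\<^sub>R x \<in> F" if x: "x \<in> F" and c: "0 \<le> c" for c x
  proof (cases "x = 0")
    case False
    \<comment> \<open>The factor \<open>c + 2\<close> exceeds both \<open>1\<close> and \<open>c\<close>, so \<open>x\<close> and \<open>c x\<close> lie between \<open>0\<close> and \<open>(c + 2) x\<close>.\<close>
    have P': "(c + 2) *\<^sub>R x \<in> P" "0 \<in> P"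
      using convex_cone_scaleR[OF P] convex_cone_contains_0[OF P] sub x c by auto
    have "x = (1 - 1 / (c + 2)) *\<^sub>R 0 + (1 / (c + 2)) *\<^sub>R (c + 2) *\<^sub>R x"
      using c by simp
    then have "x \<in> open_segment 0 ((c + 2) *\<^sub>R x)"
      using False c unfolding in_segment
      by (intro conjI exI[of _ "1 / (c + 2)"]) auto
    then have *: "0 \<in> F" "(c + 2) *\<^sub>R x \<in> F"
      using face_ofD[OF F(1) _ P'(2) P'(1) x] by auto
    have "(1 - c / (c + 2)) *\<^sub>R 0 + (c / (c + 2)) *\<^sub>R (c + 2) *\<^sub>R x \<in> F"
      using c by (intro convexD[OF cvx *]) auto
    then show ?thesis using c by simp
  qed (use x in auto)
  have half: "(1/2) *\<^sub>R (x + y) \<in> F" if "x \<in> F" "y \<in> F" for x y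
    using convexD[OF cvx that, of "1/2" "1/2"] by (simp add: scaleR_add_right)
  have cc: "convex_cone F"
    unfolding convex_cone_iff
  proof (intro conjI ballI allI impI)
    show "0 \<in> F" using F(2) pos[of _ 0] by auto
    show "x + y \<in> F" if "x \<in> F" "y \<in> F" for x y
      using pos[OF half[OF that], of 2] by simp
  qed (use pos in auto)
  have "x \<in> F \<and> y \<in> F" if xy: "x \<in> P" "y \<in> P" "x + y \<in> F" for x y
  proof -
    have h: "(1/2) *\<^sub>R (x + y) \<in> F" using pos[OF xy(3)] by simp
    show ?thesis
    proof (cases "x = y")
      case True
      then show ?thesis using h by (simp flip: scaleR_2)
    next
      case False
      have "(1/2) *\<^sub>R (x + y) \<in> open_segment x y"
        using False unfolding in_segment by (intro conjI exI[of _ "1/2"]) (auto simp: scaleR_add_right)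
      then show ?thesis using face_ofD[OF F(1) _ xy(1,2) h] by auto
    qed
  qed
  then show "extreme_subcone F P"
    using cc sub by (auto simp: extreme_subcone_def)
qed

lemma cone_face_iff: "convex_cone P \<Longrightarrow> cone_face F P \<longleftrightarrow> extreme_subcone F P"
  by (simp add: cone_face_def extreme_subcone_iff_face)

lemma extreme_subcone_refl: "convex_cone P \<Longrightarrow> extreme_subcone P P"
  by (simp add: extreme_subcone_def)

lemma extreme_subcone_trans: "extreme_subcone F G \<Longrightarrow> extreme_subcone G P \<Longrightarrow> extreme_subcone F P"
  unfolding extreme_subcone_def by blast

lemma extreme_subcone_Int: "extreme_subcone F P \<Longrightarrow> convex_cone Q \<Longrightarrow> extreme_subcone (F \<inter> Q) (P \<inter> Q)"
  unfolding extreme_subcone_def by (auto intro: convex_cone_Int)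

lemma extreme_subcone_subset:
  "extreme_subcone F P \<Longrightarrow> F \<subseteq> G \<Longrightarrow> G \<subseteq> P \<Longrightarrow> extreme_subcone F G"
  unfolding extreme_subcone_def by blast

lemma extreme_subcone_Int_both:
  "extreme_subcone F P \<Longrightarrow> extreme_subcone G P \<Longrightarrow> extreme_subcone (F \<inter> G) P"
  unfolding extreme_subcone_def by (auto intro: convex_cone_Int)

lemma extreme_subcone_linear_image:
  assumes "linear f" "inj f" "extreme_subcone F P"
  shows "extreme_subcone (f ` F) (f ` P)"
  using assms unfolding extreme_subcone_def
  by (auto simp: convex_cone_linear_image linear_add[OF assms(1), symmetric] inj_image_mem_iff[OF assms(2)])

text \<open>
  Restrict \<open>F\<close> and \<open>G\<close> to \<open>P \<inter> Q\<close>: faces of faces and intersections of faces are faces.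
\<close>
lemma extreme_subcone_faces_Int:
  assumes F: "extreme_subcone F P" and G: "extreme_subcone G Q"
    and P: "extreme_subcone (P \<inter> Q) P" and Q: "extreme_subcone (P \<inter> Q) Q"
  shows "extreme_subcone (F \<inter> G) F"
proof -
  have FP: "F \<subseteq> P" and GQ: "G \<subseteq> Q" using F G by (auto simp: extreme_subcone_def)
  have 1: "extreme_subcone (F \<inter> (P \<inter> Q)) P" by (rule extreme_subcone_Int_both[OF F P])
  have "extreme_subcone (G \<inter> (P \<inter> Q)) Q" by (rule extreme_subcone_Int_both[OF G Q])
  then have "extreme_subcone (G \<inter> (P \<inter> Q)) (P \<inter> Q)"
    by (rule extreme_subcone_subset) auto
  then have "extreme_subcone (G \<inter> (P \<inter> Q)) P" by (rule extreme_subcone_trans[OF _ P])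
  moreover have "(F \<inter> (P \<inter> Q)) \<inter> (G \<inter> (P \<inter> Q)) = F \<inter> G" using FP GQ by blast
  ultimately have "extreme_subcone (F \<inter> G) P" using extreme_subcone_Int_both[OF 1] by metis
  then show ?thesis by (rule extreme_subcone_subset) (use FP in auto)
qed

lemma extreme_subcone_hull:
  assumes S: "finite S" and F: "extreme_subcone F (convex_cone hull S)"
  shows "F = convex_cone hull (S \<inter> F)"
proof
  have cF: "convex_cone F" using F by (simp add: extreme_subcone_def)
  show "convex_cone hull (S \<inter> F) \<subseteq> F"
    by (rule hull_minimal) (use F in \<open>auto simp: extreme_subcone_def\<close>)
  show "F \<subseteq> convex_cone hull (S \<inter> F)"
  proof
    fix x assume x: "x \<in> F"
    then have "x \<in> convex_cone hull S" using F by (auto simp: extreme_subcone_def)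
    from mem_convex_cone_hull_finite[OF S this]
    obtain a where ax: "x = (\<Sum>s\<in>S. a s *\<^sub>R s)" and ap: "\<forall>s\<in>S. 0 \<le> a s" by (elim exE conjE)
    have a: "x = (\<Sum>s\<in>S. a s *\<^sub>R s)" "\<And>s. s \<in> S \<Longrightarrow> 0 \<le> a s" using ax ap by blast+
    have "s \<in> F" if s: "s \<in> S" "a s \<noteq> 0" for s
    proof -
      have "a s *\<^sub>R s + (\<Sum>t\<in>S - {s}. a t *\<^sub>R t) \<in> F"
        using x a(1) s(1) S by (simp add: sum.remove)
      moreover have "a s *\<^sub>R s \<in> convex_cone hull S" "(\<Sum>t\<in>S - {s}. a t *\<^sub>R t) \<in> convex_cone hull S"
        using a(2) s(1) by (auto intro!: convex_cone_sum[OF convex_cone_convex_cone_hull] convex_cone_hull_mul intro: hull_inc)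
      ultimately have "a s *\<^sub>R s \<in> F" using F unfolding extreme_subcone_def by blast
      then show ?thesis
        using convex_cone_scaleR[OF cF, of "1 / a s" "a s *\<^sub>R s"] a(2) s by simp
    qed
    then have "x = (\<Sum>s\<in>S \<inter> F. a s *\<^sub>R s)"
      unfolding a(1) by (intro sum.mono_neutral_right) (use S in auto)
    also have "\<dots> \<in> convex_cone hull (S \<inter> F)"
      using a(2) by (intro convex_cone_sum[OF convex_cone_convex_cone_hull] hull_inc) auto
    finally show "x \<in> convex_cone hull (S \<inter> F)" .
  qed
qed

text \<open>
  One step of the double description method: a cone cut by a half-space is generated by the old
  generators in the half-space and by the points where segments between generators on opposite
  sides cross the boundary. The point of \<open>R\<close> is that rationality of the generators is preserved.
\<close>
lemma convex_cone_hull_Int_halfspace: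
  fixes R :: "'b::real_vector set" and f :: "'b \<Rightarrow> real"
  assumes S: "finite S" "S \<subseteq> R" and f: "linear f" "\<And>x. x \<in> R \<Longrightarrow> f x \<in> \<rat>"
    and R: "\<And>x y. x \<in> R \<Longrightarrow> y \<in> R \<Longrightarrow> x + y \<in> R" "\<And>q x. q \<in> \<rat> \<Longrightarrow> x \<in> R \<Longrightarrow> q *\<^sub>R x \<in> R"
  shows "\<exists>S'. finite S' \<and> S' \<subseteq> R \<and> convex_cone hull S' = convex_cone hull S \<inter> {x. 0 \<le> f x}"
proof -
  define A where "A = {s\<in>S. 0 \<le> f s}"
  define B where "B = {s\<in>S. f s < 0}"
  define h where "h = (\<lambda>(s, t). f s *\<^sub>R t + (- f t) *\<^sub>R s)"
  let ?S' = "A \<union> h ` (A \<times> B)"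
  have AB: "S = A \<union> B" "A \<inter> B = {}"
    unfolding A_def B_def by fastforce+
  have inS: "s \<in> S" if "s \<in> A \<or> s \<in> B" for s using that by (auto simp: A_def B_def)
  have fA: "0 \<le> f s" if "s \<in> A" for s using that by (simp add: A_def)
  have fB: "f s < 0" if "s \<in> B" for s using that by (simp add: B_def)
  from AB have fins: "finite A" "finite B" using S(1) by auto
  have hull: "A \<subseteq> convex_cone hull S" "B \<subseteq> convex_cone hull S"
    using hull_subset[of S convex_cone] AB(1) by blast+
  have fh: "convex_cone {x. 0 \<le> f x}"
    by (auto simp: convex_cone_iff linear_0[OF f(1)] linear_add[OF f(1)] linear_cmul[OF f(1)])
  have fin: "finite ?S'" using fins by simp
  have "h (s,t) \<in> R" if "s \<in> A" "t \<in> B" for s t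
    unfolding h_def prod.case using that S(2) f(2)
    by (intro R Rats_minus_iff[THEN iffD2]) (auto simp: A_def B_def)
  then have "?S' \<subseteq> R"
    using S(2) by (auto simp: A_def)
  moreover have "convex_cone hull ?S' \<subseteq> convex_cone hull S \<inter> {x. 0 \<le> f x}"
  proof (rule hull_minimal)
    show "?S' \<subseteq> convex_cone hull S \<inter> {x. 0 \<le> f x}"
    proof -
      have "h (s,t) \<in> convex_cone hull S \<inter> {x. 0 \<le> f x}" if st: "s \<in> A" "t \<in> B" for s t
      proof -
        have "f s *\<^sub>R t \<in> convex_cone hull S" "(- f t) *\<^sub>R s \<in> convex_cone hull S"
          using st hull by (intro convex_cone_hull_mul; force simp: A_def B_def)+
        then have "h (s,t) \<in> convex_cone hull S"
          unfolding h_def prod.case by (rule convex_cone_hull_add)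
        moreover have "f (h (s,t)) = 0"
          unfolding h_def prod.case by (simp add: linear_diff[OF f(1)] linear_cmul[OF f(1)])
        ultimately show ?thesis by simp
      qed
      then show ?thesis using hull by (auto simp: A_def)
    qed
  qed (intro convex_cone_Int convex_cone_convex_cone_hull fh)
  moreover have "convex_cone hull S \<inter> {x. 0 \<le> f x} \<subseteq> convex_cone hull ?S'"
  proof
    fix x assume "x \<in> convex_cone hull S \<inter> {x. 0 \<le> f x}"
    then have fx: "0 \<le> f x" and "x \<in> convex_cone hull S" by auto
    from mem_convex_cone_hull_finite[OF S(1) this(2)]
    obtain a where ax: "x = (\<Sum>s\<in>S. a s *\<^sub>R s)" and ap: "\<forall>s\<in>S. 0 \<le> a s" by (elim exE conjE)
    have a: "x = (\<Sum>s\<in>S. a s *\<^sub>R s)" "\<And>s. s \<in> S \<Longrightarrow> 0 \<le> a s" using ax ap by blast+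
    define p where "p = (\<Sum>s\<in>A. a s * f s)"
    define q where "q = (\<Sum>t\<in>B. a t * (- f t))"
    have xs: "x = (\<Sum>s\<in>A. a s *\<^sub>R s) + (\<Sum>t\<in>B. a t *\<^sub>R t)"
      unfolding a(1) AB(1) using AB(2) fins by (simp add: sum.union_disjoint)
    have pq: "0 \<le> q" "q \<le> p"
    proof -
      show "0 \<le> q" unfolding q_def
        by (intro sum_nonneg mult_nonneg_nonneg) (use a(2) inS fB in \<open>auto intro: less_imp_le\<close>)
      have "f x = p - q"
        unfolding xs p_def q_def 
        by (simp add: linear_add[OF f(1)] linear_sum[OF f(1)] linear_cmul[OF f(1)] sum_negf)
      then show "q \<le> p" using fx by simp
    qed
    have inA: "s \<in> convex_cone hull ?S'" if "s \<in> A" for s using that by (auto intro: hull_inc)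
    have cc: "convex_cone (convex_cone hull ?S')" by (rule convex_cone_convex_cone_hull)
    show "x \<in> convex_cone hull ?S'"
    proof (cases "p = 0")
      case True
      then have "q = 0" using pq by simp
      moreover have "0 \<le> a t * (- f t)" if "t \<in> B" for t
        using that a(2)[of t] inS[of t] fB[of t] by (intro mult_nonneg_nonneg) auto
      ultimately have "\<forall>t\<in>B. a t * (- f t) = 0"
        unfolding q_def using sum_nonneg_eq_0_iff[OF fins(2), of "\<lambda>t. a t * (- f t)"] by blast
      then have "\<forall>t\<in>B. a t = 0" using fB by fastforce
      then have "x = (\<Sum>s\<in>A. a s *\<^sub>R s)" unfolding xs by simp
      also have "\<dots> \<in> convex_cone hull ?S'"
        using a(2) inS by (intro convex_cone_sum[OF cc] inA) auto
      finally show ?thesis .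
    next
      case False
      then have p: "0 < p" using pq by simp
      \<comment> \<open>With weights \<open>a s * a t / p\<close>, the boundary points reproduce the negative part of \<open>x\<close>
        and use up the fraction \<open>q / p \<le> 1\<close> of its positive part.\<close>
      have "(\<Sum>s\<in>A. \<Sum>t\<in>B. (a s * a t / p) *\<^sub>R h (s, t)) =
            (\<Sum>s\<in>A. \<Sum>t\<in>B. (a s * f s * a t / p) *\<^sub>R t) + (\<Sum>s\<in>A. \<Sum>t\<in>B. (a s * (a t * (- f t)) / p) *\<^sub>R s)"
        by (simp add: h_def scaleR_add_right scaleR_diff_right sum.distrib sum_subtractf sum_negf mult_ac)
      also have "(\<Sum>s\<in>A. \<Sum>t\<in>B. (a s * f s * a t / p) *\<^sub>R t) = (\<Sum>t\<in>B. \<Sum>s\<in>A. (a s * f s * a t / p) *\<^sub>R t)"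
        by (rule sum.swap)
      also have "\<dots> = (\<Sum>t\<in>B. a t *\<^sub>R t)"
      proof (intro sum.cong refl)
        fix t
        have "(\<Sum>s\<in>A. (a s * f s * a t / p) *\<^sub>R t) = ((\<Sum>s\<in>A. a s * f s) * a t / p) *\<^sub>R t"
          by (simp add: scaleR_sum_left sum_distrib_right sum_divide_distrib)
        then show "(\<Sum>s\<in>A. (a s * f s * a t / p) *\<^sub>R t) = a t *\<^sub>R t"
          using False by (simp add: p_def)
      qed
      also have "(\<Sum>s\<in>A. \<Sum>t\<in>B. (a s * (a t * (- f t)) / p) *\<^sub>R s) = (\<Sum>s\<in>A. (a s * q / p) *\<^sub>R s)"
        by (intro sum.cong refl)
          (simp add: q_def sum_distrib_left sum_divide_distrib scaleR_sum_left sum_negf)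
      finally have "x = (\<Sum>s\<in>A. (a s * (1 - q / p)) *\<^sub>R s) + (\<Sum>s\<in>A. \<Sum>t\<in>B. (a s * a t / p) *\<^sub>R h (s, t))"
        unfolding xs by (simp add: algebra_simps scaleR_diff_left sum_subtractf)
      also have "\<dots> \<in> convex_cone hull ?S'"
      proof (rule convex_cone_add[OF cc])
        show "(\<Sum>s\<in>A. (a s * (1 - q / p)) *\<^sub>R s) \<in> convex_cone hull ?S'"
          using a(2) inS pq p by (intro convex_cone_sum[OF cc] inA) auto
        have "(\<Sum>t\<in>B. (a s * a t / p) *\<^sub>R h (s, t)) \<in> convex_cone hull ?S'" if "s \<in> A" for s
          using a(2) inS p that by (intro convex_cone_sum[OF cc] hull_inc) auto
        then show "(\<Sum>s\<in>A. \<Sum>t\<in>B. (a s * a t / p) *\<^sub>R h (s, t)) \<in> convex_cone hull ?S'"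
          using convex_cone_sum[OF cc, of A "\<lambda>_. 1" "\<lambda>s. \<Sum>t\<in>B. (a s * a t / p) *\<^sub>R h (s, t)"] by simp
      qed
      finally show ?thesis .
    qed
  qed
  ultimately show ?thesis using fin by blast
qed

lemma convex_cone_hull_Int_halfspaces:
  fixes R :: "'b::real_vector set" and f :: "'i \<Rightarrow> 'b \<Rightarrow> real"
  assumes S: "finite S" "S \<subseteq> R" and I: "finite I"
    and f: "\<And>i. i \<in> I \<Longrightarrow> linear (f i)" "\<And>i x. i \<in> I \<Longrightarrow> x \<in> R \<Longrightarrow> f i x \<in> \<rat>"
    and R: "\<And>x y. x \<in> R \<Longrightarrow> y \<in> R \<Longrightarrow> x + y \<in> R" "\<And>q x. q \<in> \<rat> \<Longrightarrow> x \<in> R \<Longrightarrow> q *\<^sub>R x \<in> R"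
  shows "\<exists>S'. finite S' \<and> S' \<subseteq> R \<and> convex_cone hull S' = convex_cone hull S \<inter> {x. \<forall>i\<in>I. 0 \<le> f i x}"
  using I f
proof (induction I)
  case empty
  then show ?case using S by auto
next
  case (insert i I)
  then obtain S' where S': "finite S'" "S' \<subseteq> R"
    "convex_cone hull S' = convex_cone hull S \<inter> {x. \<forall>i\<in>I. 0 \<le> f i x}" by auto
  obtain S'' where "finite S''" "S'' \<subseteq> R" "convex_cone hull S'' = convex_cone hull S' \<inter> {x. 0 \<le> f i x}"
    using convex_cone_hull_Int_halfspace[OF S'(1,2), of "f i"] insert.prems R by auto
  then show ?case using S'(3) by (intro exI[of _ S'']) auto
qed

lemma convex_cone_rational_nilpotent_cone:
  "rational_nilpotent_cone B form \<sigma> \<Longrightarrow> convex_cone \<sigma>"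
  unfolding rational_nilpotent_cone_def using convex_cone_convex_cone_hull by auto

lemma rational_nilpotent_cone_face:
  assumes \<sigma>: "rational_nilpotent_cone B form \<sigma>" and \<tau>: "cone_face \<tau> \<sigma>"
  shows "rational_nilpotent_cone B form \<tau>"
proof -
  have \<tau>: "extreme_subcone \<tau> \<sigma>"
    using \<tau> cone_face_iff[OF convex_cone_rational_nilpotent_cone[OF \<sigma>]] by simp
  obtain S where S: "finite S" "S \<subseteq> lie_g form" "\<forall>N\<in>S. nilpotent_map N"
      "\<forall>N\<in>S. \<forall>N'\<in>S. N \<circ> N' = N' \<circ> N" "\<sigma> = convex_cone hull S" and sharp: "\<sigma> \<inter> uminus ` \<sigma> = {0}"
    using \<sigma> unfolding rational_nilpotent_cone_def nilpotent_cone_def by metis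
  obtain T where T: "finite T" "T \<subseteq> lie_g_rat B form" "\<sigma> = convex_cone hull T"
    using \<sigma> unfolding rational_nilpotent_cone_def by metis
  have hulls: "\<tau> = convex_cone hull (S \<inter> \<tau>)" "\<tau> = convex_cone hull (T \<inter> \<tau>)"
    by (rule extreme_subcone_hull[OF S(1) \<tau>[unfolded S(5)]],
        rule extreme_subcone_hull[OF T(1) \<tau>[unfolded T(3)]])
  have "\<tau> \<inter> uminus ` \<tau> = {0}"
  proof -
    have "0 \<in> \<tau>" "\<tau> \<subseteq> \<sigma>" using \<tau> by (auto simp: extreme_subcone_def convex_cone_contains_0)
    then have "0 \<in> \<tau> \<inter> uminus ` \<tau>" by (auto simp: image_iff intro!: bexI[of _ 0])
    then show ?thesis using sharp \<open>\<tau> \<subseteq> \<sigma>\<close> by blast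
  qed
  moreover have "\<exists>S. finite S \<and> S \<subseteq> lie_g form \<and> (\<forall>N\<in>S. nilpotent_map N) \<and>
      (\<forall>N\<in>S. \<forall>N'\<in>S. N \<circ> N' = N' \<circ> N) \<and> \<tau> = convex_cone hull S"
    using S(1-4) hulls(1) by (intro exI[of _ "S \<inter> \<tau>"]) blast
  moreover have "\<exists>T. finite T \<and> T \<subseteq> lie_g_rat B form \<and> \<tau> = convex_cone hull T"
    using T(1,2) hulls(2) by (intro exI[of _ "T \<inter> \<tau>"]) blast
  ultimately show ?thesis
    unfolding rational_nilpotent_cone_def nilpotent_cone_def by blast
qed

text \<open>
  A fan can be given by a set of cones, not closed under taking faces, that pairwise meet in common
  faces. Both the fan of the theorem and the subdivisions are obtained in this way.
\<close>
lemma fan_of_faces: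
  assumes ne: "PP \<noteq> {}"
    and rat: "\<And>P. P \<in> PP \<Longrightarrow> rational_nilpotent_cone B form P"
    and meet: "\<And>P Q. P \<in> PP \<Longrightarrow> Q \<in> PP \<Longrightarrow> extreme_subcone (P \<inter> Q) P"
  shows "fan B form {F. \<exists>P\<in>PP. extreme_subcone F P}"
proof -
  have cc: "convex_cone P" if "P \<in> PP" for P using rat[OF that] by (rule convex_cone_rational_nilpotent_cone)
  have meet2: "extreme_subcone (F \<inter> G) F \<and> extreme_subcone (F \<inter> G) G"
    if "P \<in> PP" "Q \<in> PP" "extreme_subcone F P" "extreme_subcone G Q" for P Q F G
  proof -
    have PQ: "extreme_subcone (P \<inter> Q) P" "extreme_subcone (P \<inter> Q) Q"
      using meet[OF that(1,2)] meet[OF that(2,1)] unfolding Int_commute[of Q P] by blast+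
    then have QP: "extreme_subcone (Q \<inter> P) Q" "extreme_subcone (Q \<inter> P) P"
      unfolding Int_commute[of Q P] by blast+
    show ?thesis
      using extreme_subcone_faces_Int[OF that(3,4) PQ] extreme_subcone_faces_Int[OF that(4,3) QP]
      unfolding Int_commute[of G F] by blast
  qed
  have ccF: "convex_cone F" if "extreme_subcone F P" for F P :: "'a endo set"
    using that by (simp add: extreme_subcone_def)
  show ?thesis
    unfolding fan_def
  proof (intro conjI ballI allI impI)
    show "{F. \<exists>P\<in>PP. extreme_subcone F P} \<noteq> {}"
      using ne cc extreme_subcone_refl by blast
    show "rational_nilpotent_cone B form \<sigma>" if s: "\<sigma> \<in> {F. \<exists>P\<in>PP. extreme_subcone F P}" for \<sigma>
    proof -
      obtain P where P: "P \<in> PP" "extreme_subcone \<sigma> P" using s by blast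
      then show ?thesis
        using rational_nilpotent_cone_face[OF rat[OF P(1)]] cone_face_iff[OF cc[OF P(1)]] by blast
    qed
    show "\<tau> \<in> {F. \<exists>P\<in>PP. extreme_subcone F P}"
      if s: "\<sigma> \<in> {F. \<exists>P\<in>PP. extreme_subcone F P}" "cone_face \<tau> \<sigma>" for \<sigma> \<tau>
    proof -
      obtain P where P: "P \<in> PP" "extreme_subcone \<sigma> P" using s(1) by blast
      then have "extreme_subcone \<tau> P"
        using s(2) cone_face_iff[OF ccF[OF P(2)]] extreme_subcone_trans by blast
      then show ?thesis using P(1) by blast
    qed
    show "cone_face (\<sigma> \<inter> \<tau>) \<sigma>" "cone_face (\<sigma> \<inter> \<tau>) \<tau>"
      if s: "\<sigma> \<in> {F. \<exists>P\<in>PP. extreme_subcone F P}" "\<tau> \<in> {F. \<exists>P\<in>PP. extreme_subcone F P}" for \<sigma> \<tau>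
    proof -
      obtain P Q where P: "P \<in> PP" "extreme_subcone \<sigma> P" and Q: "Q \<in> PP" "extreme_subcone \<tau> Q"
        using s by blast
      show "cone_face (\<sigma> \<inter> \<tau>) \<sigma>" "cone_face (\<sigma> \<inter> \<tau>) \<tau>"
        using meet2[OF P(1) Q(1) P(2) Q(2)] cone_face_iff[OF ccF[OF P(2)]] cone_face_iff[OF ccF[OF Q(2)]]
        by blast+
    qed
  qed
qed

section \<open>Exponential and logarithm of nilpotent maps\<close>

text \<open>
  A formal power series evaluated at a nilpotent map. Products and compositions of power series turn
  into compositions of maps, so identities between exponential and logarithm are inherited from
  formal power series.
\<close>
definition fps_at :: "real fps \<Rightarrow> ('w::real_vector \<Rightarrow> 'w) \<Rightarrow> 'w \<Rightarrow> 'w" where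
  "fps_at F N x = (\<Sum>k<nil_index N. fps_nth F k *\<^sub>R (N ^^ k) x)"

lemma linear_funpow: "linear (f :: 'w::real_vector \<Rightarrow> 'w) \<Longrightarrow> linear (f ^^ k)"
proof (induction k)
  case (Suc k)
  then show ?case using linear_compose[of "f ^^ k" f] by (simp add: o_def)
qed (simp add: linear_id id_def[symmetric])

lemma funpow_eq_0_mono:
  assumes "linear (N :: 'w::real_vector \<Rightarrow> 'w)" "\<And>x. (N ^^ m) x = 0" "m \<le> k"
  shows "(N ^^ k) x = 0"
proof -
  have "(N ^^ k) x = (N ^^ (k - m)) ((N ^^ m) x)"
    using assms(3) by (metis comp_apply funpow_add le_add_diff_inverse2)
  then show ?thesis
    using assms(2) linear_0[OF linear_funpow[OF assms(1)]] by simp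
qed

lemma nil_index_zero:
  assumes "linear N" "nilpotent_map N" "nil_index N \<le> k"
  shows "(N ^^ k) x = 0"
proof (rule funpow_eq_0_mono[OF assms(1) _ assms(3)])
  show "(N ^^ nil_index N) x = 0" for x
    using LeastI_ex[of "\<lambda>m. \<forall>x. (N ^^ m) x = 0"] assms(2)
    unfolding nilpotent_map_def nil_index_def by blast
qed

lemma fps_at_eq:
  assumes N: "linear N" "\<And>x. (N ^^ m) x = 0"
  shows "fps_at F N x = (\<Sum>k<m. fps_nth F k *\<^sub>R (N ^^ k) x)"
proof -
  have nil: "nilpotent_map N" using N(2) unfolding nilpotent_map_def by blast
  have "nil_index N \<le> m"
    unfolding nil_index_def by (rule Least_le) (use N(2) in simp)
  then show ?thesis
    unfolding fps_at_def
    by (intro sum.mono_neutral_left)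
      (use nil_index_zero[OF N(1) nil] in auto)
qed

lemma linear_fps_at: "linear N \<Longrightarrow> linear (fps_at F N)"
  unfolding fps_at_def[abs_def]
  by (rule linear_compose_sum, rule ballI, rule linear_compose_scale_right, rule linear_funpow)

lemma fps_at_mult:
  assumes N: "linear N" "nilpotent_map N"
  shows "fps_at (F * G) N x = fps_at F N (fps_at G N x)"
proof -
  define m where "m = nil_index N"
  have zero: "(N ^^ k) x = 0" if "\<not> k < m" for k x
    using nil_index_zero[OF N] that m_def by simp
  have "fps_at (F * G) N x = (\<Sum>k<m. \<Sum>i\<le>k. (fps_nth F i * fps_nth G (k - i)) *\<^sub>R (N ^^ k) x)"
    unfolding fps_at_def m_def[symmetric]
    by (simp add: fps_mult_nth atLeast0AtMost scaleR_sum_left)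
  also have "\<dots> = (\<Sum>k<m. \<Sum>i\<le>k. (fps_nth F i * fps_nth G (k - i)) *\<^sub>R (N ^^ (i + (k - i))) x)"
    by (intro sum.cong refl) auto
  also have "\<dots> = (\<Sum>(i, j) | i + j < m. (fps_nth F i * fps_nth G j) *\<^sub>R (N ^^ (i + j)) x)"
    by (rule sum.triangle_reindex[symmetric])
  also have "\<dots> = (\<Sum>(i, j) \<in> {..<m} \<times> {..<m}. (fps_nth F i * fps_nth G j) *\<^sub>R (N ^^ (i + j)) x)"
    by (intro sum.mono_neutral_left) (auto, metis zero)
  also have "\<dots> = (\<Sum>i<m. \<Sum>j<m. (fps_nth F i * fps_nth G j) *\<^sub>R (N ^^ (i + j)) x)"
    by (rule sum.cartesian_product[symmetric])
  also have "\<dots> = (\<Sum>i<m. fps_nth F i *\<^sub>R (N ^^ i) (\<Sum>j<m. fps_nth G j *\<^sub>R (N ^^ j) x))"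
  proof (intro sum.cong refl)
    fix i
    show "(\<Sum>j<m. (fps_nth F i * fps_nth G j) *\<^sub>R (N ^^ (i + j)) x) =
          fps_nth F i *\<^sub>R (N ^^ i) (\<Sum>j<m. fps_nth G j *\<^sub>R (N ^^ j) x)"
      by (simp add: linear_sum[OF linear_funpow[OF N(1)]] linear_cmul[OF linear_funpow[OF N(1)]]
          scaleR_sum_right funpow_add)
  qed
  finally show ?thesis unfolding fps_at_def m_def .
qed

lemma fps_at_1: assumes N: "linear N" "nilpotent_map N" shows "fps_at 1 N x = x"
proof -
  have "fps_at 1 N x = (\<Sum>k<Suc (nil_index N). fps_nth 1 k *\<^sub>R (N ^^ k) x)"
    by (rule fps_at_eq[OF N(1)]) (rule nil_index_zero[OF N], simp)
  also have "\<dots> = x"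
    by (subst sum.lessThan_Suc_shift) simp
  finally show ?thesis .
qed

lemma fps_at_power:
  assumes N: "linear N" "nilpotent_map N"
  shows "fps_at (F ^ i) N x = (fps_at F N ^^ i) x"
  by (induction i arbitrary: x) (simp_all add: fps_at_1[OF N] fps_at_mult[OF N])

lemma fps_at_power_nil:
  assumes N: "linear N" "nilpotent_map N" and "fps_nth F 0 = 0"
  shows "(fps_at F N ^^ nil_index N) x = 0"
  unfolding fps_at_power[OF N, symmetric] fps_at_def
  by (intro sum.neutral) (use startsby_zero_power_prefix[OF assms(3)] in auto)

lemma fps_at_compose:
  assumes N: "linear N" "nilpotent_map N" and G: "fps_nth G 0 = 0"
  shows "fps_at (F oo G) N x = fps_at F (fps_at G N) x"
proof -
  let ?m = "nil_index N"
  have "fps_at F (fps_at G N) x = (\<Sum>i<?m. fps_nth F i *\<^sub>R (fps_at G N ^^ i) x)"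
    by (rule fps_at_eq[OF linear_fps_at[OF N(1)] fps_at_power_nil[OF N G]])
  also have "\<dots> = (\<Sum>i<?m. \<Sum>k<?m. (fps_nth F i * fps_nth (G ^ i) k) *\<^sub>R (N ^^ k) x)"
    by (simp add: fps_at_power[OF N, symmetric] fps_at_def scaleR_sum_right)
  also have "\<dots> = (\<Sum>k<?m. \<Sum>i<?m. (fps_nth F i * fps_nth (G ^ i) k) *\<^sub>R (N ^^ k) x)"
    by (rule sum.swap)
  also have "\<dots> = (\<Sum>k<?m. fps_nth (F oo G) k *\<^sub>R (N ^^ k) x)"
  proof (intro sum.cong refl)
    fix k assume "k \<in> {..<?m}"
    then have "fps_nth (F oo G) k = (\<Sum>i<?m. fps_nth F i * fps_nth (G ^ i) k)"
      unfolding fps_compose_nth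
      by (intro sum.mono_neutral_left) (use startsby_zero_power_prefix[OF G] in auto)
    then show "(\<Sum>i<?m. (fps_nth F i * fps_nth (G ^ i) k) *\<^sub>R (N ^^ k) x) = fps_nth (F oo G) k *\<^sub>R (N ^^ k) x"
      by (simp add: scaleR_sum_left)
  qed
  finally show ?thesis by (simp add: fps_at_def)
qed

lemma fps_exp_compose_ln: "fps_exp (1::real) oo fps_ln 1 = 1 + fps_X"
proof -
  have "(fps_exp (1::real) - 1) oo fps_ln 1 = fps_X"
    unfolding fps_ln_fps_exp_inv[of "1::real", simplified]
    by (rule fps_inv_right) auto
  then show ?thesis
    by (simp add: fps_compose_sub_distrib algebra_simps)
qed

lemma nil_exp_eq_fps_at: "nil_exp N = fps_at (fps_exp 1) N"
  by (simp add: nil_exp_def fps_at_def fun_eq_iff)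

lemma unip_log_eq_fps_at: "unip_log g = fps_at (fps_ln 1) (\<lambda>x. g x - x)"
proof
  fix x
  let ?n = "nil_index (\<lambda>x. g x - x)"
  have "fps_at (fps_ln 1) (\<lambda>x. g x - x) x =
      (\<Sum>k\<in>{1..<?n}. fps_nth (fps_ln 1) k *\<^sub>R ((\<lambda>x. g x - x) ^^ k) x)"
    unfolding fps_at_def by (intro sum.mono_neutral_right) (auto simp: fps_ln_nth)
  also have "\<dots> = unip_log g x"
    unfolding unip_log_def
  proof (intro sum.cong refl)
    fix k assume "k \<in> {1..<?n}"
    then obtain j where "k = Suc j" by (cases k) auto
    then show "fps_nth (fps_ln 1) k *\<^sub>R ((\<lambda>x. g x - x) ^^ k) x =
        ((- 1) ^ (k + 1) / real k) *\<^sub>R ((\<lambda>x. g x - x) ^^ k) x"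
      by (simp add: fps_ln_nth del: funpow.simps)
  qed
  finally show "unip_log g x = fps_at (fps_ln 1) (\<lambda>x. g x - x) x" ..
qed

lemma funpow_scale:
  assumes "linear (N :: 'w::real_vector \<Rightarrow> 'w)" shows "((\<lambda>x. c *\<^sub>R N x) ^^ k) x = c ^ k *\<^sub>R (N ^^ k) x"
  by (induction k) (simp_all add: linear_cmul[OF assms])

lemma nilpotent_scale:
  assumes "linear N" "nilpotent_map N" shows "nilpotent_map (\<lambda>x. c *\<^sub>R N x)"
  using assms(2) unfolding nilpotent_map_def funpow_scale[OF assms(1)] by auto

context
  fixes g :: "'w::real_vector \<Rightarrow> 'w"
  assumes g: "linear g" "unipotent_map g"
begin

lemma linear_minus_id: "linear (\<lambda>x. g x - x)"
  by (rule linear_compose_sub[OF g(1) linear_ident])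

lemma linear_unip_log: "linear (unip_log g)"
  unfolding unip_log_eq_fps_at by (rule linear_fps_at[OF linear_minus_id])

lemma nilpotent_unip_log: "nilpotent_map (unip_log g)"
  using fps_at_power_nil[OF linear_minus_id g(2)[unfolded unipotent_map_def], of "fps_ln 1"]
  unfolding nilpotent_map_def unip_log_eq_fps_at by (metis fps_ln_0)

lemma nil_exp_unip_log: "nil_exp (unip_log g) x = g x"
proof -
  note n = linear_minus_id g(2)[unfolded unipotent_map_def]
  let ?n = "\<lambda>x. g x - x"
  have "nil_exp (unip_log g) x = fps_at (1 + fps_X) ?n x"
    unfolding nil_exp_eq_fps_at unip_log_eq_fps_at fps_exp_compose_ln[symmetric]
    by (rule fps_at_compose[OF n, symmetric]) simp
  also have "\<dots> = (\<Sum>k<Suc (Suc (nil_index ?n)). fps_nth (1 + fps_X) k *\<^sub>R (?n ^^ k) x)"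
    by (rule fps_at_eq[OF n(1)]) (rule nil_index_zero[OF n], simp)
  also have "\<dots> = x + ?n x"
    by (subst sum.lessThan_Suc_shift, subst sum.lessThan_Suc_shift) (simp add: fps_X_def)
  finally show ?thesis by simp
qed

lemma nil_exp_scaled_unip_log: "nil_exp (\<lambda>x. real j *\<^sub>R unip_log g x) x = (g ^^ j) x"
proof -
  let ?N = "unip_log g" let ?m = "nil_index (unip_log g)"
  note N = linear_unip_log nilpotent_unip_log
  have sc: "((\<lambda>x. real j *\<^sub>R ?N x) ^^ k) x = (real j) ^ k *\<^sub>R (?N ^^ k) x" for k x
    by (rule funpow_scale[OF N(1)])
  have "nil_exp (\<lambda>x. real j *\<^sub>R ?N x) x = (\<Sum>k<?m. fps_nth (fps_exp 1) k *\<^sub>R ((\<lambda>x. real j *\<^sub>R ?N x) ^^ k) x)"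
    unfolding nil_exp_eq_fps_at
    by (rule fps_at_eq[OF linear_compose_scale_right[OF N(1)]]) (simp add: sc nil_index_zero[OF N])
  also have "\<dots> = fps_at (fps_exp (real j)) ?N x"
    by (simp add: fps_at_def sc)
  also have "fps_exp (real j) = fps_exp 1 ^ j"
    using fps_exp_power_mult[of "1::real" j] by simp
  also have "fps_at (fps_exp 1 ^ j) ?N x = (g ^^ j) x"
  proof -
    have "nil_exp ?N = g" using nil_exp_unip_log by blast
    then show ?thesis unfolding fps_at_power[OF N] nil_exp_eq_fps_at[symmetric] by simp
  qed
  finally show ?thesis .
qed

lemma unip_log_commute:
  assumes h: "linear h" "\<And>x. h (g x) = g (h x)"
  shows "h (unip_log g x) = unip_log g (h x)"
proof -
  have *: "h (((\<lambda>x. g x - x) ^^ k) x) = ((\<lambda>x. g x - x) ^^ k) (h x)" for k x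
    by (induction k) (simp_all add: linear_diff[OF h(1)] h(2))
  show ?thesis
    unfolding unip_log_def linear_sum[OF h(1)] linear_cmul[OF h(1)] * ..
qed

text \<open>
  Expressing \<open>g - 1\<close> through the logarithm with \<open>N\<close> applied first shows that it kills \<open>ker N\<close>, and that
  \<open>g x - x\<close> is rational as soon as \<open>N x\<close> is.
\<close>
lemma unip_minus_id:
  "g x - x = (\<Sum>k<nil_index (unip_log g). (1 / fact (Suc k)) *\<^sub>R (unip_log g ^^ k) (unip_log g x))"
proof -
  let ?N = "unip_log g" let ?m = "nil_index (unip_log g)"
  note N = linear_unip_log nilpotent_unip_log
  have "g x = fps_at (fps_exp 1) ?N x"
    using nil_exp_unip_log[of x] by (simp add: nil_exp_eq_fps_at)
  also have "\<dots> = (\<Sum>k<Suc ?m. fps_nth (fps_exp 1) k *\<^sub>R (?N ^^ k) x)"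
    by (rule fps_at_eq[OF N(1)]) (rule nil_index_zero[OF N], simp)
  also have "\<dots> = x + (\<Sum>k<?m. (1 / fact (Suc k)) *\<^sub>R (?N ^^ k) (?N x))"
    by (subst sum.lessThan_Suc_shift) (simp add: funpow_Suc_right del: funpow.simps fact_Suc)
  finally show ?thesis by simp
qed

lemma unip_fixes_kernel: "unip_log g x = 0 \<Longrightarrow> g x = x"
  using unip_minus_id[of x] linear_0[OF linear_funpow[OF linear_unip_log]] by simp

text \<open>
  The function \<open>n \<mapsto> \<langle>g\<^sup>n x, g\<^sup>n y\<rangle> = \<langle>exp(n N) x, exp(n N) y\<rangle>\<close> is a polynomial in \<open>n\<close>. If \<open>g\<close> is an
  isometry, this polynomial is constant; its linear coefficient is the assertion.
\<close>
lemma unip_log_skew: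
  assumes form: "\<And>x. linear (form x)" "\<And>y. linear (\<lambda>x. form x y)"
    and iso: "\<And>x y. form (g x) (g y) = (form x y :: real)"
  shows "form (unip_log g x) y + form x (unip_log g y) = 0"
proof -
  let ?N = "unip_log g"
  define m where "m = Suc (Suc (nil_index ?N))"
  note N = linear_unip_log nilpotent_unip_log
  define b where "b i j = form ((?N ^^ j) x) ((?N ^^ i) y) / (fact i * fact j)" for i j
  define p where "p = (\<Sum>i<m. \<Sum>j<m. Polynomial.monom (b i j) (i + j))"
  have iso_pow: "form ((g ^^ n) x) ((g ^^ n) y) = form x y" for n
    by (induction n) (simp_all add: iso)
  have gpow: "(g ^^ n) z = (\<Sum>k<m. (real n ^ k / fact k) *\<^sub>R (?N ^^ k) z)" for n z
  proof -
    have sc: "((\<lambda>x. real n *\<^sub>R ?N x) ^^ k) x = (real n) ^ k *\<^sub>R (?N ^^ k) x" for k x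
      by (rule funpow_scale[OF N(1)])
    have z: "(?N ^^ m) x = 0" for x
      by (rule nil_index_zero[OF N]) (simp add: m_def)
    have "(g ^^ n) z = (\<Sum>k<m. fps_nth (fps_exp 1) k *\<^sub>R ((\<lambda>x. real n *\<^sub>R ?N x) ^^ k) z)"
      unfolding nil_exp_scaled_unip_log[of n z, symmetric] nil_exp_eq_fps_at
      by (rule fps_at_eq[OF linear_compose_scale_right[OF N(1)]]) (simp add: sc z)
    then show ?thesis by (simp add: sc)
  qed
  have "poly p (real n) = form x y" for n
  proof -
    have "form x y = form ((g ^^ n) x) ((g ^^ n) y)" by (simp add: iso_pow)
    also have "\<dots> = (\<Sum>i<m. (real n ^ i / fact i) * (\<Sum>j<m. (real n ^ j / fact j) * form ((?N ^^ j) x) ((?N ^^ i) y)))"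
      unfolding gpow
      by (simp only: linear_sum[OF form(2)] linear_cmul[OF form(2)] linear_sum[OF form(1)] linear_cmul[OF form(1)] real_scaleR_def)
    also have "\<dots> = poly p (real n)"
      unfolding p_def b_def by (simp add: poly_sum poly_monom power_add sum_distrib_left field_simps)
    finally show ?thesis ..
  qed
  then have "range real \<subseteq> {t. poly (p - [:form x y:]) t = 0}"
    by (simp add: image_subset_iff)
  moreover have "infinite (range real)"
    using finite_imageD[of real UNIV] inj_of_nat infinite_UNIV_nat by blast
  ultimately have "p - [:form x y:] = 0"
    using poly_roots_finite[of "p - [:form x y:]"] finite_subset by blast
  then have "Polynomial.coeff p 1 = 0"
    by simp
  moreover have "Polynomial.coeff p 1 = (\<Sum>i<m. \<Sum>j<m. if i + j = 1 then b i j else 0)"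
    unfolding p_def by (simp add: coeff_sum)
  moreover have "\<dots> = b 0 1 + b 1 0"
  proof -
    have "(\<Sum>j<m. if i + j = 1 then b i j else 0) = (if i = 0 then b 0 1 else if i = 1 then b 1 0 else 0)" for i
    proof -
      have "(\<Sum>j<m. if i + j = 1 then b i j else 0) = (\<Sum>j\<in>{0,1}. if i + j = 1 then b i j else 0)"
        by (intro sum.mono_neutral_right) (auto simp: m_def)
      then show ?thesis by auto
    qed
    then have "(\<Sum>i<m. \<Sum>j<m. if i + j = 1 then b i j else 0) =
        (\<Sum>i<m. if i = 0 then b 0 1 else if i = 1 then b 1 0 else 0)" by simp
    also have "\<dots> = (\<Sum>i\<in>{0,1::nat}. if i = 0 then b 0 1 else if i = 1 then b 1 0 else 0)"
      by (intro sum.mono_neutral_right) (auto simp: m_def)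
    finally show ?thesis by simp
  qed
  ultimately show ?thesis by (simp add: b_def)
qed

end

section \<open>The monodromy weight filtration\<close>

text \<open>
  The weight filtration of a nilpotent map, centred at \<open>0\<close>.
\<close>
definition monodromy_filtration :: "('v::real_vector \<Rightarrow> 'v) \<Rightarrow> (int \<Rightarrow> 'v set) \<Rightarrow> bool" where
  "monodromy_filtration n G \<longleftrightarrow>
     (\<forall>k. subspace (G k)) \<and> mono G \<and> (\<exists>a b. G a = {0} \<and> G b = UNIV) \<and>
     (\<forall>k. n ` G k \<subseteq> G (k - 2)) \<and>
     (\<forall>l::nat. \<forall>x\<in>G (int l). (n ^^ l) x \<in> G (- int l - 1) \<longrightarrow> x \<in> G (int l - 1)) \<and>
     (\<forall>l::nat. \<forall>y\<in>G (- int l). \<exists>x\<in>G (int l). y - (n ^^ l) x \<in> G (- int l - 1))"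

lemma funpow_apply_add: "(f ^^ (i + j)) x = (f ^^ i) ((f ^^ j) x)"
  by (simp add: funpow_add)

context
  fixes n :: "'v::real_vector \<Rightarrow> 'v" and G :: "int \<Rightarrow> 'v set"
  assumes n: "linear n" and G: "monodromy_filtration n G"
begin

lemma monodromy_filtration_subspace: "subspace (G k)"
  using G by (simp add: monodromy_filtration_def)

lemma monodromy_filtration_mono: "i \<le> j \<Longrightarrow> G i \<subseteq> G j"
  using G by (simp add: monodromy_filtration_def mono_def)

lemma monodromy_filtration_lower: "x \<in> G k \<Longrightarrow> n x \<in> G (k - 2)"
  using G by (auto simp: monodromy_filtration_def image_subset_iff)

lemma monodromy_filtration_inj:
  "x \<in> G (int l) \<Longrightarrow> (n ^^ l) x \<in> G (- int l - 1) \<Longrightarrow> x \<in> G (int l - 1)"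
  using G by (simp add: monodromy_filtration_def)

lemma monodromy_filtration_surj:
  "y \<in> G (- int l) \<Longrightarrow> \<exists>x\<in>G (int l). y - (n ^^ l) x \<in> G (- int l - 1)"
  using G by (simp add: monodromy_filtration_def)

lemma monodromy_filtration_lower_funpow: "x \<in> G k \<Longrightarrow> (n ^^ j) x \<in> G (k - 2 * int j)"
proof (induction j)
  case (Suc j)
  then show ?case using monodromy_filtration_lower[of "(n ^^ j) x" "k - 2 * int j"] by (simp add: algebra_simps)
qed simp

lemma monodromy_filtration_top: "\<exists>m::nat. \<forall>k\<ge>int m. G k = UNIV"
proof -
  obtain b where b: "G b = UNIV"
    using G unfolding monodromy_filtration_def by auto
  have "G k = UNIV" if "k \<ge> int (nat b)" for k
  proof -
    have "b \<le> k" using that by linarith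
    then show ?thesis using monodromy_filtration_mono[of b k] b by blast
  qed
  then show ?thesis by blast
qed

lemma monodromy_filtration_bot: "\<exists>m::nat. \<forall>k\<le>- int m. G k = {0}"
proof -
  obtain a where a: "G a = {0}"
    using G unfolding monodromy_filtration_def by auto
  have "G k = {0}" if "k \<le> - int (nat (- a))" for k
  proof -
    have "k \<le> a" using that by linarith
    then show ?thesis
      using monodromy_filtration_mono[of k a] a subspace_0[OF monodromy_filtration_subspace, of k] by blast
  qed
  then show ?thesis by blast
qed

text \<open>
  Surjectivity on graded pieces lifts to the filtration itself, by descending induction on \<open>l\<close>.
\<close>
lemma monodromy_filtration_image: "G (- int l) \<subseteq> (n ^^ l) ` G (int l)"
proof -
  obtain m where m: "\<forall>k\<le>- int m. G k = {0}"
    using monodromy_filtration_bot by blast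
  show ?thesis
  proof (induction l rule: nat_descend_induct[of m])
    case (base l)
    have "(n ^^ l) 0 = 0" by (rule linear_0[OF linear_funpow[OF n]])
    moreover have "G (- int l) = {0}" using m base by simp
    ultimately show ?case
      using subspace_0[OF monodromy_filtration_subspace, of "int l"] by (metis image_eqI singletonD subsetI)
  next
    case (descend l)
    show ?case
    proof
      fix y assume "y \<in> G (- int l)"
      then obtain x where x: "x \<in> G (int l)" "y - (n ^^ l) x \<in> G (- int l - 1)"
        using monodromy_filtration_surj by blast
      have "G (- int (Suc l)) \<subseteq> (n ^^ Suc l) ` G (int (Suc l))" by (rule descend) simp
      moreover have "- int (Suc l) = - int l - 1" by simp
      ultimately obtain x' where x': "x' \<in> G (int (Suc l))" "y - (n ^^ l) x = (n ^^ Suc l) x'"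
        using x(2) by (metis imageE subsetD)
      have "n x' \<in> G (int l)"
        using monodromy_filtration_lower[OF x'(1)] monodromy_filtration_mono[of "int (Suc l) - 2" "int l"] by auto
      then have "x + n x' \<in> G (int l)"
        using x(1) subspace_add[OF monodromy_filtration_subspace] by blast
      moreover have "y = (n ^^ l) (x + n x')"
        using x'(2) by (simp add: linear_add[OF linear_funpow[OF n]] funpow_swap1 algebra_simps)
      ultimately show "y \<in> (n ^^ l) ` G (int l)" by blast
    qed
  qed
qed

text \<open>
  Injectivity on graded pieces, applied to \<open>l, l + 1, \<dots>\<close>: if \<open>x\<close> lies in some higher step, it can
  be pushed down one step at a time.
\<close>
lemma monodromy_filtration_preimage:
  assumes "(n ^^ l) x \<in> G (- int l - 1)" shows "x \<in> G (int l - 1)"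
proof -
  have "x \<in> G (int l - 1)" if "x \<in> G (int (l + d))" for d
    using that
  proof (induction d)
    case 0
    then show ?case using monodromy_filtration_inj[OF _ assms] by simp
  next
    case (Suc d)
    have "(n ^^ (Suc d + l)) x \<in> G (- int l - 1 - 2 * int (Suc d))"
      using monodromy_filtration_lower_funpow[OF assms, of "Suc d"] by (simp only: funpow_apply_add)
    then have "(n ^^ (l + Suc d)) x \<in> G (- int (l + Suc d) - 1)"
      using monodromy_filtration_mono[of "- int l - 1 - 2 * int (Suc d)" "- int (l + Suc d) - 1"]
      unfolding add.commute[of l "Suc d"] by (simp add: subset_iff)
    then have "x \<in> G (int (l + Suc d) - 1)"
      using monodromy_filtration_inj[OF Suc.prems] by blast
    then show ?case using Suc.IH by simp
  qed
  moreover obtain m where m: "\<forall>k\<ge>int m. G k = UNIV"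
    using monodromy_filtration_top by blast
  have "x \<in> G (int (l + m))" using m by simp
  ultimately show ?thesis by blast
qed

lemma monodromy_filtration_ker: "n x = 0 \<Longrightarrow> x \<in> G 0"
  using monodromy_filtration_preimage[of 1 x] subspace_0[OF monodromy_filtration_subspace, of "-2"] by simp

lemma monodromy_filtration_ker_im: "n x = 0 \<Longrightarrow> x \<in> range n \<Longrightarrow> x \<in> G (-1)"
proof -
  assume "n x = 0" "x \<in> range n"
  then obtain y where y: "x = n y" "n (n y) = 0" by auto
  then have "(n ^^ 2) y \<in> G (- int 2 - 1)"
    using subspace_0[OF monodromy_filtration_subspace] by (simp add: numeral_2_eq_2)
  then have "y \<in> G 1" using monodromy_filtration_preimage[of 2 y] by simp
  then show "x \<in> G (-1)" using monodromy_filtration_lower[of y 1] y by simp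
qed

lemma monodromy_filtration_neg1: "G (-1) \<subseteq> n ` G 1"
  using monodromy_filtration_image[of 1] by simp

lemma monodromy_filtration_vimage_neg1: "n x \<in> G (-1) \<Longrightarrow> x \<in> G 1"
proof -
  assume "n x \<in> G (-1)"
  then obtain z where z: "z \<in> G 1" "n x = n z" using monodromy_filtration_neg1 by auto
  then have "x - z \<in> G 0" using monodromy_filtration_ker[of "x - z"] linear_diff[OF n] by simp
  then have "x - z \<in> G 1" using monodromy_filtration_mono[of 0 1] by auto
  then show "x \<in> G 1" using subspace_add[OF monodromy_filtration_subspace _ z(1)] by fastforce
qed

end

text \<open>
  The lemmas \<open>monodromy_filtration_image\<close> and \<open>monodromy_filtration_preimage\<close> compute \<open>G (- l)\<close> from
  \<open>G l\<close>, and \<open>G (l - 1)\<close> from \<open>G (- l - 1)\<close>. Starting with a large \<open>l\<close>, this determines all steps.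
\<close>
lemma monodromy_filtration_le:
  assumes n: "linear n" and G: "monodromy_filtration n G" and H: "monodromy_filtration n H"
  shows "G k \<subseteq> H k"
proof -
  obtain m1 where m1: "\<forall>k\<le>- int m1. G k = {0}"
    using monodromy_filtration_bot[OF n G] by blast
  obtain m2 where m2: "\<forall>k\<ge>int m2. H k = UNIV"
    using monodromy_filtration_top[OF n H] by blast
  have "G (int l - 1) \<subseteq> H (int l - 1) \<and> G (- int l) \<subseteq> H (- int l)" for l
  proof (induction l rule: nat_descend_induct[of "m1 + m2"])
    case (base l)
    then have "G (- int l) = {0}" "H (int l - 1) = UNIV" using m1 m2 by simp_all
    then show ?case
      using subspace_0[OF monodromy_filtration_subspace[OF n H], of "- int l"] by simp
  next
    case (descend l)
    have "G (int (Suc l) - 1) \<subseteq> H (int (Suc l) - 1) \<and> G (- int (Suc l)) \<subseteq> H (- int (Suc l))"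
      by (rule descend) simp
    moreover have "int (Suc l) - 1 = int l" "- int (Suc l) = - int l - 1" by simp_all
    ultimately have IH: "G (int l) \<subseteq> H (int l)" "G (- int l - 1) \<subseteq> H (- int l - 1)" by metis+
    have "x \<in> H (int l - 1)" if "x \<in> G (int l - 1)" for x
    proof (rule monodromy_filtration_preimage[OF n H])
      have "int l - 1 - 2 * int l = - int l - 1" by simp
      then have "(n ^^ l) x \<in> G (- int l - 1)"
        using monodromy_filtration_lower_funpow[OF n G that, of l] by metis
      then show "(n ^^ l) x \<in> H (- int l - 1)" using IH(2) by blast
    qed
    moreover have "y \<in> H (- int l)" if "y \<in> G (- int l)" for y
    proof -
      obtain x where x: "x \<in> G (int l)" "y = (n ^^ l) x"
        using monodromy_filtration_image[OF n G, of l] \<open>y \<in> G (- int l)\<close> by auto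
      have "int l - 2 * int l = - int l" by simp
      then show ?thesis
        using monodromy_filtration_lower_funpow[OF n H, of x "int l" l] x IH(1) by (metis subsetD)
    qed
    ultimately show ?case by blast
  qed
  note * = this
  show ?thesis
  proof (cases "k \<ge> 0")
    case True
    then show ?thesis using *[of "nat (k + 1)"] by simp
  next
    case False
    then show ?thesis using *[of "nat (- k)"] by simp
  qed
qed

lemma monodromy_filtration_unique:
  assumes "linear n" "monodromy_filtration n G" "monodromy_filtration n H"
  shows "G = H"
  using monodromy_filtration_le[OF assms(1,2,3)] monodromy_filtration_le[OF assms(1,3,2)] by blast

lemma monodromy_filtration_scale:
  assumes n: "linear n" and c: "c \<noteq> 0" and G: "monodromy_filtration (\<lambda>x. c *\<^sub>R n x) G"
  shows "monodromy_filtration n G"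
proof -
  have cn: "linear (\<lambda>x. c *\<^sub>R n x)" by (rule linear_compose_scale_right[OF n])
  have sub: "subspace (G k)" for k using G by (simp add: monodromy_filtration_def)
  have iff: "c' *\<^sub>R x \<in> G k \<longleftrightarrow> x \<in> G k" if "c' \<noteq> 0" for c' x k
    using subspace_scale[OF sub, of x k c'] subspace_scale[OF sub, of "c' *\<^sub>R x" k "1 / c'"] that by auto
  have "n ` G k \<subseteq> G (k - 2)" for k
  proof
    fix y assume "y \<in> n ` G k"
    then obtain x where "x \<in> G k" "y = n x" by auto
    then have "c *\<^sub>R y \<in> G (k - 2)"
      using monodromy_filtration_lower[OF cn G] by blast
    then show "y \<in> G (k - 2)" using iff[OF c] by blast
  qed
  moreover have "x \<in> G (int l - 1)" if "x \<in> G (int l)" "(n ^^ l) x \<in> G (- int l - 1)" for x l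
  proof -
    have "((\<lambda>x. c *\<^sub>R n x) ^^ l) x \<in> G (- int l - 1)"
      using that(2) subspace_scale[OF sub] by (simp add: funpow_scale[OF n])
    then show ?thesis using monodromy_filtration_inj[OF cn G that(1)] by blast
  qed
  moreover have "\<exists>x\<in>G (int l). y - (n ^^ l) x \<in> G (- int l - 1)" if "y \<in> G (- int l)" for y l
  proof -
    obtain x where x: "x \<in> G (int l)" "y - ((\<lambda>x. c *\<^sub>R n x) ^^ l) x \<in> G (- int l - 1)"
      using monodromy_filtration_surj[OF cn G \<open>y \<in> G (- int l)\<close>] by blast
    then have "y - (n ^^ l) (c ^ l *\<^sub>R x) \<in> G (- int l - 1)"
      by (simp add: funpow_scale[OF n] linear_cmul[OF linear_funpow[OF n]])
    then show ?thesis using subspace_scale[OF sub x(1)] by blast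
  qed
  ultimately show ?thesis
    using G by (simp add: monodromy_filtration_def)
qed

text \<open>
  The spanning set in the formula \<open>G k = \<Sum>\<^sub>j ker n\<^sup>j\<^sup>+\<^sup>1 \<inter> im n\<^sup>j\<^sup>-\<^sup>k\<close> for the weight filtration; the
  truncation of negative exponents makes the second factor the whole space.
\<close>
definition ker_im :: "('v::real_vector \<Rightarrow> 'v) \<Rightarrow> int \<Rightarrow> 'v set" where
  "ker_im n k = {x. \<exists>j::nat. (n ^^ Suc j) x = 0 \<and> x \<in> range (n ^^ nat (int j - k))}"

lemma range_funpow_mono: "i \<le> j \<Longrightarrow> range ((f :: 'v \<Rightarrow> 'v) ^^ j) \<subseteq> range (f ^^ i)"
proof
  fix x assume "i \<le> j" "x \<in> range (f ^^ j)"
  then obtain y where "x = (f ^^ (i + (j - i))) y" by auto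
  then show "x \<in> range (f ^^ i)" unfolding funpow_apply_add by blast
qed

lemma ker_imI: "(n ^^ Suc j) x = 0 \<Longrightarrow> x \<in> range (n ^^ nat (int j - k)) \<Longrightarrow> x \<in> ker_im n k"
  unfolding ker_im_def by (intro CollectI exI[of _ j] conjI)

lemma ker_imE:
  assumes "x \<in> ker_im n k"
  obtains j where "(n ^^ Suc j) x = 0" "x \<in> range (n ^^ nat (int j - k))"
  using assms unfolding ker_im_def mem_Collect_eq by (elim exE conjE)

text \<open>
  With the explicit formula, \<open>n\<^sup>l\<close> maps \<open>G l\<close> onto \<open>G (- l)\<close> generator by generator. For
  injectivity, \<open>n\<^sup>l x \<in> G (- l - 1)\<close> equals \<open>n\<^sup>l\<^sup>+\<^sup>1 x'\<close> with \<open>x' \<in> G (l + 1)\<close>; then \<open>x - n x'\<close> lies in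
  \<open>ker n\<^sup>l \<subseteq> G (l - 1)\<close>, and so does \<open>n x'\<close>.
\<close>
lemma monodromy_filtration_exists:
  assumes n: "linear n" and nil: "nilpotent_map n"
  shows "\<exists>G. monodromy_filtration n G"
proof -
  let ?G = "\<lambda>k. span (ker_im n k)"
  obtain m where m: "\<And>x. (n ^^ m) x = 0" using nil unfolding nilpotent_map_def by blast
  have np: "linear (n ^^ k)" for k by (rule linear_funpow[OF n])
  have mem: "x \<in> ?G k" if "(n ^^ Suc j) x = 0" "x \<in> range (n ^^ nat (int j - k))" for x k j
    by (rule span_base) (rule ker_imI[OF that])
  have "mono ?G"
  proof (intro monoI span_mono subsetI)
    fix i j :: int and x assume ij: "i \<le> j" and "x \<in> ker_im n i"
    from this(2) obtain p where p: "(n ^^ Suc p) x = 0" "x \<in> range (n ^^ nat (int p - i))"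
      by (rule ker_imE)
    have "nat (int p - j) \<le> nat (int p - i)" using ij by simp
    then show "x \<in> ker_im n j"
      by (intro ker_imI[OF p(1)] subsetD[OF range_funpow_mono p(2)])
  qed
  moreover have "?G (- int m) = {0}"
  proof -
    have "x = 0" if "x \<in> ker_im n (- int m)" for x
    proof -
      obtain p where "x \<in> range (n ^^ nat (int p - - int m))"
        using \<open>x \<in> ker_im n (- int m)\<close> by (rule ker_imE)
      then obtain z where z: "x = (n ^^ nat (int p - - int m)) z" by blast
      show ?thesis unfolding z by (rule funpow_eq_0_mono[OF n m]) simp
    qed
    then have "ker_im n (- int m) \<subseteq> {0}" by blast
    then have "?G (- int m) \<subseteq> {0}" by (intro span_minimal) auto
    then show ?thesis using span_0 by blast
  qed
  moreover have "?G (int m) = UNIV"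
  proof -
    have "x \<in> ?G (int m)" for x
      by (rule mem[of m]) (simp_all add: m linear_0[OF n])
    then show ?thesis by blast
  qed
  moreover have lower: "n ` ?G k \<subseteq> ?G (k - 2)" for k
  proof -
    have "n x \<in> ?G (k - 2)" if x: "x \<in> ker_im n k" for x
    proof -
      obtain j where j: "(n ^^ Suc j) x = 0" "x \<in> range (n ^^ nat (int j - k))"
        using x by (rule ker_imE)
      show ?thesis
      proof (cases j)
        case 0
        then have "n x = 0" using j(1) by simp
        then show ?thesis by (simp add: span_0)
      next
        case (Suc i)
        obtain z where z: "x = (n ^^ nat (int j - k)) z" using j(2) by blast
        show ?thesis
        proof (rule mem[of i])
          show "(n ^^ Suc i) (n x) = 0" using j(1) Suc by (simp add: funpow_swap1)
          have "n x \<in> range (n ^^ Suc (nat (int j - k)))" unfolding z by auto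
          moreover have "nat (int i - (k - 2)) \<le> Suc (nat (int j - k))" using Suc by simp
          ultimately show "n x \<in> range (n ^^ nat (int i - (k - 2)))"
            using range_funpow_mono[of _ _ n] by (metis subsetD)
        qed
      qed
    qed
    then have "span (n ` ker_im n k) \<subseteq> ?G (k - 2)" by (intro span_minimal) auto
    then show ?thesis by (simp add: linear_span_image[OF n])
  qed
  moreover have image: "?G (- int l) \<subseteq> (n ^^ l) ` ?G (int l)" for l
  proof -
    have "y \<in> (n ^^ l) ` ker_im n (int l)" if y: "y \<in> ker_im n (- int l)" for y
    proof -
      obtain j where j: "(n ^^ Suc j) y = 0" "y \<in> range (n ^^ nat (int j - - int l))"
        using y by (rule ker_imE)
      have "nat (int j - - int l) = l + j" by simp
      then obtain z where z: "y = (n ^^ (l + j)) z" using j(2) by auto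
      have "(n ^^ Suc (j + l)) ((n ^^ j) z) = 0"
      proof -
        have "(n ^^ Suc (j + l)) ((n ^^ j) z) = (n ^^ (Suc j + (l + j))) z"
          unfolding funpow_apply_add[symmetric] by (rule arg_cong[where f = "\<lambda>i. (n ^^ i) z"]) simp
        then show ?thesis using j(1) unfolding z funpow_apply_add by simp
      qed
      moreover have "nat (int (j + l) - int l) = j" by simp
      ultimately have "(n ^^ j) z \<in> ker_im n (int l)" by (intro ker_imI[of "j + l"]) simp_all
      then show ?thesis unfolding z funpow_apply_add by blast
    qed
    then have "?G (- int l) \<subseteq> span ((n ^^ l) ` ker_im n (int l))" by (intro span_mono) auto
    then show ?thesis by (simp add: linear_span_image[OF np])
  qed
  moreover have "x \<in> ?G (int l - 1)" if x: "x \<in> ?G (int l)" and y: "(n ^^ l) x \<in> ?G (- int l - 1)" for x l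
  proof (cases l)
    case 0
    then show ?thesis using y by simp
  next
    case (Suc i)
    have "- int l - 1 = - int (Suc l)" by simp
    then obtain x' where x': "x' \<in> ?G (int (Suc l))" "(n ^^ l) x = (n ^^ Suc l) x'"
      using subsetD[OF image[of "Suc l"]] y by (metis imageE)
    have "n x' \<in> ?G (int (Suc l) - 2)" using lower x'(1) by blast
    then have "n x' \<in> ?G (int l - 1)" by simp
    moreover have "x - n x' \<in> ?G (int l - 1)"
    proof (rule mem[of i])
      show "(n ^^ Suc i) (x - n x') = 0"
        using x'(2) unfolding Suc[symmetric] by (simp add: linear_diff[OF np] funpow_swap1)
      show "x - n x' \<in> range (n ^^ nat (int i - (int l - 1)))" using Suc by simp
    qed
    ultimately show ?thesis using span_add by fastforce
  qed
  moreover have "\<exists>x\<in>?G (int l). y - (n ^^ l) x \<in> ?G (- int l - 1)" if y: "y \<in> ?G (- int l)" for y l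
  proof -
    obtain x where "x \<in> ?G (int l)" "y = (n ^^ l) x" using image[of l] y by blast
    then show ?thesis by (intro bexI[of _ x]) (simp_all add: span_0)
  qed
  ultimately have "monodromy_filtration n ?G"
    unfolding monodromy_filtration_def by (simp add: subspace_span) blast
  then show ?thesis by blast
qed

section \<open>Relative filtrations of extensions by a one-dimensional space\<close>

definition extension_map :: "('v::real_vector \<Rightarrow> 'v) \<Rightarrow> 'v \<Rightarrow> 'v endo" where
  "extension_map n w = (\<lambda>(v, t). (n v + t *\<^sub>R w, 0))"

lemma extension_map_apply [simp]: "extension_map n w (v, t) = (n v + t *\<^sub>R w, 0)"
  by (simp add: extension_map_def)

lemma extension_map_funpow_0: "linear n \<Longrightarrow> (extension_map n w ^^ l) (v, 0) = ((n ^^ l) v, 0)"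
  by (induction l) simp_all

lemma snd_extension_map: "snd (extension_map n w x) = 0"
  by (cases x) simp

lemma snd_extension_map_funpow: "0 < l \<Longrightarrow> snd ((extension_map n w ^^ l) x) = 0"
  by (cases l) (simp_all add: snd_extension_map)

lemma M_on_gr_W_iff: "x \<in> M_on_gr_W M j k \<longleftrightarrow> (\<exists>z\<in>M j. z \<in> W k \<and> x - z \<in> W (k - 1))"
proof
  assume "x \<in> M_on_gr_W M j k"
  then obtain z y where "x = z + y" "z \<in> M j \<inter> W k" "y \<in> W (k - 1)"
    unfolding M_on_gr_W_def mem_Collect_eq by (elim exE conjE)
  then show "\<exists>z\<in>M j. z \<in> W k \<and> x - z \<in> W (k - 1)" by (intro bexI[of _ z]) simp_all
next
  assume "\<exists>z\<in>M j. z \<in> W k \<and> x - z \<in> W (k - 1)"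
  then obtain z where "z \<in> M j" "z \<in> W k" "x - z \<in> W (k - 1)" by (elim bexE conjE)
  then show "x \<in> M_on_gr_W M j k"
    unfolding M_on_gr_W_def mem_Collect_eq by (intro exI[of _ z] exI[of _ "x - z"]) simp
qed

lemma mem_W_iff: "x \<in> W k \<longleftrightarrow> 0 \<le> k \<or> (k = -1 \<and> snd x = 0) \<or> x = 0"
  by (cases x) (auto simp: W_def zero_prod_def)

lemma M_on_gr_W_neg1: "M_on_gr_W M j (-1) = {x \<in> M j. snd x = 0}"
proof (rule subset_antisym; rule subsetI)
  fix x assume "x \<in> M_on_gr_W M j (-1)"
  then show "x \<in> {x \<in> M j. snd x = 0}" by (simp add: M_on_gr_W_iff mem_W_iff) (elim bexE conjE disjE; simp)
next
  fix x assume "x \<in> {x \<in> M j. snd x = 0}"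
  then show "x \<in> M_on_gr_W M j (-1)" by (simp add: M_on_gr_W_iff mem_W_iff bexI[of _ x])
qed

lemma M_on_gr_W_0:
  fixes M :: "int \<Rightarrow> ('v::real_vector \<times> real) set"
  shows "M_on_gr_W M j 0 = {x. \<exists>z\<in>M j. snd z = snd x}"
proof (rule subset_antisym; rule subsetI)
  fix x assume "x \<in> M_on_gr_W M j 0"
  then obtain z where "z \<in> M j" "x - z \<in> W (0 - 1)" unfolding M_on_gr_W_iff by (elim bexE conjE)
  then show "x \<in> {x. \<exists>z\<in>M j. snd z = snd x}" by (intro CollectI bexI[of _ z]) (auto simp: mem_W_iff)
next
  fix x :: "'v \<times> real" assume "x \<in> {x. \<exists>z\<in>M j. snd z = snd x}"
  then obtain z where "z \<in> M j" "snd z = snd x" unfolding mem_Collect_eq by (elim bexE)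
  then show "x \<in> M_on_gr_W M j 0" unfolding M_on_gr_W_iff by (intro bexI[of _ z]) (simp_all add: mem_W_iff)
qed

lemma M_on_gr_W_trivial:
  fixes M :: "int \<Rightarrow> ('v::real_vector \<times> real) set"
  assumes "0 \<in> M j"
  shows "1 \<le> k \<Longrightarrow> M_on_gr_W M j k = UNIV" "k \<le> -2 \<Longrightarrow> M_on_gr_W M j k = {0}"
proof -
  assume "1 \<le> k"
  then have "x \<in> M_on_gr_W M j k" for x
    unfolding M_on_gr_W_iff using assms by (intro bexI[of _ 0]) (simp_all add: mem_W_iff)
  then show "M_on_gr_W M j k = UNIV" by (rule UNIV_eq_I[symmetric])
next
  assume k: "k \<le> -2"
  have "x \<in> M_on_gr_W M j k \<longleftrightarrow> x = 0" for x
  proof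
    assume "x \<in> M_on_gr_W M j k"
    then obtain z where "z \<in> W k" "x - z \<in> W (k - 1)" unfolding M_on_gr_W_iff by (elim bexE conjE)
    then show "x = 0" using k by (simp add: mem_W_iff)
  next
    assume "x = 0"
    then show "x \<in> M_on_gr_W M j k"
      unfolding M_on_gr_W_iff using assms by (intro bexI[of _ 0]) (simp_all add: mem_W_iff)
  qed
  then show "M_on_gr_W M j k = {0}" by blast
qed

lemma subquotient_iso_inj: "subquotient_iso h P P' Q Q' \<Longrightarrow> x \<in> P \<Longrightarrow> h x \<in> Q' \<Longrightarrow> x \<in> P'"
  by (simp add: subquotient_iso_def)

lemma subquotient_iso_surj: "subquotient_iso h P P' Q Q' \<Longrightarrow> y \<in> Q \<Longrightarrow> \<exists>x\<in>P. y - h x \<in> Q'"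
  by (simp add: subquotient_iso_def)

text \<open>
  The filtration that is \<open>G\<close>, recentred at \<open>- 1\<close>, on \<open>V\<close>, with the vector \<open>(- u, 1)\<close> added in
  degree \<open>0\<close>.
\<close>
definition extension_filtration :: "(int \<Rightarrow> 'v::real_vector set) \<Rightarrow> 'v \<Rightarrow> int \<Rightarrow> ('v \<times> real) set" where
  "extension_filtration G u k = {(v, t). (0 \<le> k \<or> t = 0) \<and> v + t *\<^sub>R u \<in> G (k + 1)}"

lemma mem_extension_filtration:
  "(v, t) \<in> extension_filtration G u k \<longleftrightarrow> (0 \<le> k \<or> t = 0) \<and> v + t *\<^sub>R u \<in> G (k + 1)"
  by (simp add: extension_filtration_def)

lemma subspace_vimage_shear:
  assumes "subspace S"
  shows "subspace {(v, t). (P \<or> t = (0::real)) \<and> v + t *\<^sub>R u \<in> S}"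
proof -
  let ?f = "\<lambda>x. fst x + snd x *\<^sub>R u"
  have f: "?f (x + y) = ?f x + ?f y" "?f (c *\<^sub>R x) = c *\<^sub>R ?f x" "?f 0 = 0" for x y c
    by (simp_all add: algebra_simps)
  have "subspace {x. (P \<or> snd x = 0) \<and> ?f x \<in> S}"
  proof (rule subspaceI)
    show "0 \<in> {x. (P \<or> snd x = 0) \<and> ?f x \<in> S}"
      using subspace_0[OF assms] by simp
    show "x + y \<in> {x. (P \<or> snd x = 0) \<and> ?f x \<in> S}"
      if "x \<in> {x. (P \<or> snd x = 0) \<and> ?f x \<in> S}" "y \<in> {x. (P \<or> snd x = 0) \<and> ?f x \<in> S}" for x y
      using that subspace_add[OF assms, of "?f x" "?f y"] unfolding mem_Collect_eq f(1) by auto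
    show "c *\<^sub>R x \<in> {x. (P \<or> snd x = 0) \<and> ?f x \<in> S}"
      if "x \<in> {x. (P \<or> snd x = 0) \<and> ?f x \<in> S}" for c x
      using that subspace_scale[OF assms, of "?f x" c] unfolding mem_Collect_eq f(2) by auto
  qed
  then show ?thesis by (simp add: case_prod_unfold)
qed

text \<open>
  The shear by \<open>u\<close> conjugates the extension with \<open>w = n u\<close> to the split one, for which the direct sum
  of filtrations works.
\<close>
lemma relative_filtration_extension:
  fixes n :: "'v::real_vector \<Rightarrow> 'v"
  assumes n: "linear n" and G: "monodromy_filtration n G"
  shows "is_relative_filtration (extension_map n (n u)) (extension_filtration G u)"
proof -
  let ?N = "extension_map n (n u)" let ?M = "extension_filtration G u"
  note Gs = monodromy_filtration_subspace[OF n G] and Gm = monodromy_filtration_mono[OF n G]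
    and Gl = monodromy_filtration_lower[OF n G]
  have sub: "subspace (?M k)" for k
    unfolding extension_filtration_def by (rule subspace_vimage_shear[OF Gs])
  have zero: "0 \<in> ?M k" for k using subspace_0[OF sub] .
  have mono: "mono ?M"
  proof (rule monoI, rule subsetI)
    fix i j :: int and x assume "i \<le> j" "x \<in> ?M i"
    then show "x \<in> ?M j"
      using Gm[of "i + 1" "j + 1"] by (cases x) (auto simp: mem_extension_filtration)
  qed
  obtain a where a: "\<forall>k\<le>- int a. G k = {0}" using monodromy_filtration_bot[OF n G] by blast
  obtain b where b: "\<forall>k\<ge>int b. G k = UNIV" using monodromy_filtration_top[OF n G] by blast
  have "?M (- int a - 1) = {0}" using a by (auto simp: extension_filtration_def zero_prod_def)
  moreover have "?M (int b) = UNIV" using b by (auto simp: extension_filtration_def)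
  moreover have "?N ` ?M k \<subseteq> ?M (k - 2)" for k
  proof -
    have "?N (v, t) \<in> ?M (k - 2)" if "v + t *\<^sub>R u \<in> G (k + 1)" for v t
    proof -
      have "n v + t *\<^sub>R n u = n (v + t *\<^sub>R u)" by (simp add: linear_add[OF n] linear_cmul[OF n])
      then show ?thesis using Gl[OF that] by (simp add: extension_filtration_def algebra_simps)
    qed
    then show ?thesis
      by (intro image_subsetI) (metis mem_extension_filtration surj_pair)
  qed
  moreover have iso: "subquotient_iso (?N ^^ l)
        (M_on_gr_W ?M (k + int l) k) (M_on_gr_W ?M (k + int l - 1) k)
        (M_on_gr_W ?M (k - int l) k) (M_on_gr_W ?M (k - int l - 1) k)" for k :: int and l :: nat
  proof -
    have N0: "(?N ^^ l) 0 = 0"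
      unfolding zero_prod_def using extension_map_funpow_0[OF n, where w = "n u" and l = l and v = 0] linear_0[OF linear_funpow[OF n]] by simp
    consider "1 \<le> k" | "k \<le> -2" | "k = 0" | "k = -1" by linarith
    then show ?thesis
    proof cases
      case 1
      then show ?thesis by (simp add: M_on_gr_W_trivial(1)[OF zero] subquotient_iso_def)
    next
      case 2
      then show ?thesis by (simp add: M_on_gr_W_trivial(2)[OF zero] subquotient_iso_def N0)
    next
      case 3
      have gr: "M_on_gr_W ?M j 0 = (if 0 \<le> j then UNIV else {x. snd x = 0})" for j
      proof (cases "0 \<le> j")
        case True
        have "(- t *\<^sub>R u, t) \<in> ?M j" for t
          using True subspace_0[OF Gs] by (simp add: extension_filtration_def)
        then show ?thesis using True unfolding M_on_gr_W_0 by (metis (mono_tags, lifting) UNIV_eq_I mem_Collect_eq snd_conv)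
      next
        case False
        then show ?thesis using zero[of j] unfolding M_on_gr_W_0
          by (force simp: extension_filtration_def)
      qed
      show ?thesis
      proof (cases "l = 0")
        case True
        then show ?thesis by (auto simp: 3 gr subquotient_iso_def intro: exI[of _ 0])
      next
        case False
        then show ?thesis
          using snd_extension_map_funpow[of l n "n u"] N0
          by (auto simp: 3 gr subquotient_iso_def)
      qed
    next
      case 4
      have gr: "M_on_gr_W ?M j (-1) = G (j + 1) \<times> {0}" for j
        unfolding M_on_gr_W_neg1 extension_filtration_def by auto
      have low: "(n ^^ l) x \<in> G (i - 2 * int l)" if "x \<in> G i" for x i
        by (rule monodromy_filtration_lower_funpow[OF n G that])
      have "int l - 2 * int l = - int l" "int l - 1 - 2 * int l = - int l - 1" by simp_all
      then have low2: "(n ^^ l) x \<in> G (- int l)" if "x \<in> G (int l)" for x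
        using low[OF that] by simp
      have low3: "(n ^^ l) x \<in> G (- int l - 1)" if "x \<in> G (int l - 1)" for x
        using low[OF that] \<open>int l - 1 - 2 * int l = - int l - 1\<close> by simp
      have surj: "\<exists>x\<in>G (int l) \<times> {0}. y - (?N ^^ l) x \<in> G (- int l - 1) \<times> {0}" if "y \<in> G (- int l) \<times> {0}" for y
      proof -
        have "fst y \<in> G (- int l)" "y = (fst y, 0)" using that by auto
        then obtain x where x: "x \<in> G (int l)" "fst y - (n ^^ l) x \<in> G (- int l - 1)"
          using monodromy_filtration_surj[OF n G] by blast
        then have "y - (?N ^^ l) (x, 0) \<in> G (- int l - 1) \<times> {0}"
          using \<open>y = (fst y, 0)\<close> by (metis SigmaI diff_Pair diff_zero extension_map_funpow_0 insertI1 n)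
        then show ?thesis using x(1) by (intro bexI[of _ "(x, 0)"]) simp_all
      qed
      have inj: "x \<in> G (int l - 1) \<times> {0}" if "x \<in> G (int l) \<times> {0}" "(?N ^^ l) x \<in> G (- int l - 1) \<times> {0}" for x
        using that monodromy_filtration_inj[OF n G] by (auto simp: extension_map_funpow_0[OF n])
      have im: "(?N ^^ l) ` (G (int l) \<times> {0}) \<subseteq> G (- int l) \<times> {0}"
        "(?N ^^ l) ` (G (int l - 1) \<times> {0}) \<subseteq> G (- int l - 1) \<times> {0}"
        using low2 low3 by (auto simp: extension_map_funpow_0[OF n])
      have iso: "subquotient_iso (?N ^^ l) (G (int l) \<times> {0}) (G (int l - 1) \<times> {0})
          (G (- int l) \<times> {0}) (G (- int l - 1) \<times> {0})"
        unfolding subquotient_iso_def by (intro conjI ballI impI im) (rule inj surj; assumption)+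
      have "-1 + int l + 1 = int l" "-1 + int l - 1 + 1 = int l - 1" "-1 - int l + 1 = - int l"
        "-1 - int l - 1 + 1 = - int l - 1" by simp_all
      then show ?thesis unfolding 4 gr using iso by metis
    qed
  qed
  ultimately show ?thesis
    unfolding is_relative_filtration_def by (intro conjI allI sub mono iso) blast+
qed

text \<open>
  The weight \<open>0\<close> conditions force \<open>M\<^sub>-\<^sub>1 \<subseteq> V\<close> and provide a vector \<open>(v, 1) \<in> M\<^sub>0\<close>. Its image \<open>n v + w\<close>
  lies in \<open>M\<^sub>-\<^sub>2 \<inter> V\<close>, which is contained in the image of \<open>n\<close>. If \<open>w = n u\<close>, then \<open>v + u \<in> M\<^sub>0\<close>, so
  that \<open>(v, 1)\<close> may be replaced by \<open>(- u, 1)\<close>.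
\<close>
lemma relative_filtration_unique_shape:
  fixes n :: "'v::real_vector \<Rightarrow> 'v"
  assumes n: "linear n" and M: "is_relative_filtration (extension_map n w) M"
  defines "G \<equiv> \<lambda>k. {v. (v, 0) \<in> M (k - 1)}"
  shows "monodromy_filtration n G" "w \<in> range n"
    "w = n u \<Longrightarrow> M = extension_filtration G u"
proof -
  let ?N = "extension_map n w"
  have sub: "subspace (M k)" and mono: "mono M" and low: "?N ` M k \<subseteq> M (k - 2)"
    and iso: "subquotient_iso (?N ^^ l)
        (M_on_gr_W M (k + int l) k) (M_on_gr_W M (k + int l - 1) k)
        (M_on_gr_W M (k - int l) k) (M_on_gr_W M (k - int l - 1) k)" for k l
    using M unfolding is_relative_filtration_def by simp_all
  obtain a b where ab: "M a = {0}" "M b = UNIV"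
    using M unfolding is_relative_filtration_def by auto
  have gr: "M_on_gr_W M j (-1) = G (j + 1) \<times> {0}" for j
    unfolding M_on_gr_W_neg1 G_def by auto
  have subG: "subspace (G k)" for k
    unfolding subspace_def G_def using subspace_0[OF sub, of "k - 1"] subspace_add[OF sub, of _ "k - 1"]
      subspace_scale[OF sub, of _ "k - 1"] by (fastforce simp: zero_prod_def)
  have isoG: "subquotient_iso (?N ^^ l) (G (int l) \<times> {0}) (G (int l - 1) \<times> {0}) (G (- int l) \<times> {0}) (G (- int l - 1) \<times> {0})" for l
  proof -
    have "-1 + int l + 1 = int l" "-1 + int l - 1 + 1 = int l - 1" "-1 - int l + 1 = - int l"
        "-1 - int l - 1 + 1 = - int l - 1" by simp_all
    then show ?thesis using iso[of l "-1"] unfolding gr by metis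
  qed
  show mf: "monodromy_filtration n G"
    unfolding monodromy_filtration_def
  proof (intro conjI allI ballI impI)
    show "subspace (G k)" for k by (rule subG)
    show "mono G" 
    proof (rule monoI, rule subsetI)
      fix i j :: int and x assume "i \<le> j" "x \<in> G i"
      then show "x \<in> G j" using monoD[OF mono, of "i - 1" "j - 1"] by (auto simp: G_def)
    qed
    have "G (a + 1) = {0}" "G (b + 1) = UNIV" unfolding G_def using ab by (auto simp: zero_prod_def)
    then show "\<exists>a b. G a = {0} \<and> G b = UNIV" by blast
    show "n ` G k \<subseteq> G (k - 2)" for k
    proof -
      have "(n v, 0) \<in> M (k - 1 - 2)" if "(v, 0) \<in> M (k - 1)" for v
        using low[of "k - 1"] that by force
      then show ?thesis by (auto simp: G_def algebra_simps)
    qed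
    show "x \<in> G (int l - 1)" if "x \<in> G (int l)" "(n ^^ l) x \<in> G (- int l - 1)" for l x
      using subquotient_iso_inj[OF isoG[of l], of "(x, 0)"] that by (simp add: extension_map_funpow_0[OF n])
    show "\<exists>x\<in>G (int l). y - (n ^^ l) x \<in> G (- int l - 1)" if y: "y \<in> G (- int l)" for l y
    proof -
      have "(y, 0) \<in> G (- int l) \<times> {0::real}" using y by simp
      from subquotient_iso_surj[OF isoG[of l] this]
      obtain x where "x \<in> G (int l) \<times> {0}" "(y, 0) - (?N ^^ l) x \<in> G (- int l - 1) \<times> {0}" ..
      then show ?thesis
        by (cases x) (auto simp: extension_map_funpow_0[OF n])
    qed
  qed
  have neg: "snd x = 0" if "x \<in> M (- int (Suc l))" for l x
    using that
  proof (induction l arbitrary: x rule: nat_descend_induct[of "nat (- a)"])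
    case (base l)
    then have "- int (Suc l) \<le> a" by linarith
    then have "x = 0" using base.prems monoD[OF mono, of "- int (Suc l)" a] ab(1) by blast
    then show ?case by simp
  next
    case (descend l)
    have "x \<in> M_on_gr_W M (0 - int (Suc l)) 0" using descend(3) by (auto simp: M_on_gr_W_0)
    from subquotient_iso_surj[OF iso[of "Suc l" 0] this]
    obtain z where "x - (?N ^^ Suc l) z \<in> M_on_gr_W M (0 - int (Suc l) - 1) 0" ..
    then obtain y where y: "y \<in> M (0 - int (Suc l) - 1)" "snd y = snd (x - (?N ^^ Suc l) z)"
      unfolding M_on_gr_W_0 mem_Collect_eq ..
    have "0 - int (Suc l) - 1 = - int (Suc (Suc l))" by simp
    then have "snd y = 0" using descend(2)[of "Suc l" y] y(1) by simp
    then show ?case using y(2) snd_extension_map_funpow[of "Suc l" n w z] by simp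
  qed
  have "\<exists>e\<in>M (int 0). snd e = 1"
  proof (rule dec_induct[of 0 "nat b" "\<lambda>l. (\<exists>e\<in>M (int l). snd e = 1) \<longrightarrow> (\<exists>e\<in>M (int 0). snd e = 1)", THEN mp])
    show "(\<exists>e\<in>M (int (Suc l)). snd e = 1) \<longrightarrow> (\<exists>e\<in>M (int 0). snd e = 1)"
      if IH: "(\<exists>e\<in>M (int l). snd e = 1) \<longrightarrow> (\<exists>e\<in>M (int 0). snd e = 1)" for l
    proof
      assume "\<exists>e\<in>M (int (Suc l)). snd e = 1"
      then obtain e where e: "e \<in> M (int (Suc l))" "snd e = 1" by blast
      then have "e \<in> M_on_gr_W M (0 + int (Suc l)) 0" unfolding M_on_gr_W_0 by auto
      moreover have "(?N ^^ Suc l) e \<in> M_on_gr_W M (0 - int (Suc l) - 1) 0"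
        using subspace_0[OF sub] snd_extension_map_funpow[of "Suc l" n w e]
        unfolding M_on_gr_W_0 by (intro CollectI bexI[of _ 0]) simp_all
      ultimately have "e \<in> M_on_gr_W M (0 + int (Suc l) - 1) 0"
        by (rule subquotient_iso_inj[OF iso[of "Suc l" 0]])
      then have "\<exists>e\<in>M (int l). snd e = 1" unfolding M_on_gr_W_0 using e(2) by auto
      then show "\<exists>e\<in>M (int 0). snd e = 1" using IH by blast
    qed
    have "M (int (nat b)) = UNIV" 
    proof -
      have "b \<le> int (nat b)" by simp
      from monoD[OF mono this] show ?thesis unfolding ab(2) by blast
    qed
    then show "\<exists>e\<in>M (int (nat b)). snd e = 1" by (metis UNIV_I snd_conv)
  qed auto
  then obtain v where v: "(v, 1) \<in> M 0" by (metis of_nat_0 prod.collapse)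
  have "(n v + w, 0) \<in> M (0 - 2)" using low[of 0] v by force
  then have vw: "n v + w \<in> G (-1)" by (simp add: G_def)
  then obtain z where "n v + w = n z" using monodromy_filtration_neg1[OF n mf] by blast
  then have "w = n (z - v)" by (simp add: linear_diff[OF n] algebra_simps)
  then show "w \<in> range n" by blast
  show "M = extension_filtration G u" if u: "w = n u"
  proof -
    have "v + u \<in> G 1"
      using vw unfolding u by (intro monodromy_filtration_vimage_neg1[OF n mf]) (simp add: linear_add[OF n])
    then have "(v + u, 0) \<in> M 0" by (simp add: G_def)
    then have u0: "(- u, 1) \<in> M 0" using subspace_diff[OF sub v, of "(v + u, 0)"] by simp
    have uk: "(- t *\<^sub>R u, t) \<in> M k" if "0 \<le> k" for k t
      using subspace_scale[OF sub, of "(- u, 1)" k t] u0 monoD[OF mono that] by auto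
    have negk: "t = 0" if "(v, t) \<in> M k" "k < 0" for v t k
    proof -
      have "k = - int (Suc (nat (- k - 1)))" using that(2) by simp
      then show ?thesis using neg[of "(v, t)" "nat (- k - 1)"] that(1) by simp
    qed
    have key: "(v, t) \<in> M k \<longleftrightarrow> (v + t *\<^sub>R u, 0) \<in> M k" if "0 \<le> k \<or> t = 0" for v t k
    proof (cases "t = 0")
      case False
      then have m: "(- t *\<^sub>R u, t) \<in> M k" using uk that by blast
      have e: "(v, t) = (v + t *\<^sub>R u, 0) + (- t *\<^sub>R u, t)" "(v + t *\<^sub>R u, 0) = (v, t) - (- t *\<^sub>R u, t)" by simp_all
      show ?thesis using subspace_add[OF sub _ m] subspace_diff[OF sub _ m] e by metis
    qed simp
    have "x \<in> M k \<longleftrightarrow> x \<in> extension_filtration G u k" for k and x :: "'v \<times> real"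
    proof -
      obtain v t where x: "x = (v, t)" by fastforce
      show "x \<in> M k \<longleftrightarrow> x \<in> extension_filtration G u k"
        unfolding x extension_filtration_def G_def using key[of k t v] negk[of v t k]
        by (cases "0 \<le> k"; cases "t = 0") auto
    qed
    then show ?thesis by (intro ext) blast
  qed
qed

lemma extension_filtration_cong:
  assumes G: "\<And>k. subspace (G k)" "mono G" and u: "u - u' \<in> G 1"
  shows "extension_filtration G u = extension_filtration G u'"
proof -
  have "x \<in> extension_filtration G u k \<longleftrightarrow> x \<in> extension_filtration G u' k" for k and x :: "'a \<times> real"
  proof -
  obtain v t where x: "x = (v, t)" by fastforce
  have "v + t *\<^sub>R u \<in> G (k + 1) \<longleftrightarrow> v + t *\<^sub>R u' \<in> G (k + 1)" if "0 \<le> k"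
  proof -
    have "u - u' \<in> G (k + 1)" using u monoD[OF G(2), of 1 "k + 1"] that by auto
    then have d: "t *\<^sub>R (u - u') \<in> G (k + 1)" by (rule subspace_scale[OF G(1)])
    have "v + t *\<^sub>R u = (v + t *\<^sub>R u') + t *\<^sub>R (u - u')" "v + t *\<^sub>R u' = (v + t *\<^sub>R u) - t *\<^sub>R (u - u')"
      by (simp_all add: algebra_simps)
    then show ?thesis using subspace_add[OF G(1) _ d] subspace_diff[OF G(1) _ d] by metis
  qed
  then show ?thesis
    unfolding x extension_filtration_def by auto
  qed
  then show ?thesis by (intro ext) blast
qed

section \<open>Lattice coordinates\<close>

lemma common_denominator:
  assumes "finite I" "\<And>i. i \<in> I \<Longrightarrow> f i \<in> \<rat>"
  shows "\<exists>d::nat. 0 < d \<and> (\<forall>i\<in>I. real d * f i \<in> \<int>)"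
  using assms
proof (induction I)
  case empty
  show ?case by (intro exI[of _ 1]) simp
next
  case (insert i I)
  then obtain d :: nat where d: "0 < d" "\<forall>j\<in>I. real d * f j \<in> \<int>" by auto
  obtain p q where pq: "f i = real_of_int p / real_of_int q" "q > 0"
    using insert.prems[of i] by (metis Rats_cases' insertI1)
  have i: "real (d * nat q) * f i \<in> \<int>"
  proof -
    have "real (d * nat q) * f i = of_int (int d * p)"
      using pq by (simp add: field_simps)
    then show ?thesis by (metis Ints_of_int)
  qed
  have "real (d * nat q) * f j \<in> \<int>" if "j \<in> I" for j
  proof -
    have "real (d * nat q) * f j = of_nat (nat q) * (real d * f j)" by simp
    then show ?thesis using d(2) that by (metis Ints_mult Ints_of_nat)
  qed
  then show ?case using i d(1) pq(2) by (intro exI[of _ "d * nat q"]) auto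
qed

abbreviation coord :: "'v::real_vector set \<Rightarrow> 'v \<Rightarrow> 'v \<Rightarrow> real" where
  "coord B b v \<equiv> representation B v b"

context
  fixes B :: "'v::real_vector set"
  assumes B: "lattice_basis B"
begin

lemma lattice_basis_props: "finite B" "independent B" "\<And>v. v \<in> span B"
  using B by (auto simp: lattice_basis_def)

lemma coord_sum: "(\<Sum>b\<in>B. coord B b v *\<^sub>R b) = v"
  using sum_representation_eq[OF lattice_basis_props(2) lattice_basis_props(3) lattice_basis_props(1) order_refl] by simp

lemma linear_coord: "linear (coord B b)"
  by (rule linearI) (simp_all add: representation_add representation_scale lattice_basis_props)

lemma coord_sum_basis:
  assumes "b \<in> B" shows "coord B b (\<Sum>c\<in>B. a c *\<^sub>R c) = a b"
proof -
  have "coord B b (\<Sum>c\<in>B. a c *\<^sub>R c) = (\<Sum>c\<in>B. a c * coord B b c)"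
    by (simp add: linear_sum[OF linear_coord] linear_cmul[OF linear_coord])
  also have "\<dots> = (\<Sum>c\<in>B. if c = b then a c else 0)"
    by (intro sum.cong refl) (simp add: representation_basis[OF lattice_basis_props(2)])
  also have "\<dots> = a b" using assms lattice_basis_props(1) by simp
  finally show ?thesis .
qed

lemma zlattice_iff: "v \<in> zlattice B \<longleftrightarrow> (\<forall>b\<in>B. coord B b v \<in> \<int>)"
proof
  assume "v \<in> zlattice B"
  then obtain a where "v = (\<Sum>b\<in>B. a b *\<^sub>R b)" "\<forall>b\<in>B. a b \<in> \<int>"
    unfolding zlattice_def mem_Collect_eq by (elim exE conjE)
  then show "\<forall>b\<in>B. coord B b v \<in> \<int>" by (simp add: coord_sum_basis)
next
  assume "\<forall>b\<in>B. coord B b v \<in> \<int>"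
  then show "v \<in> zlattice B"
    unfolding zlattice_def mem_Collect_eq by (intro exI[of _ "\<lambda>b. coord B b v"]) (simp add: coord_sum)
qed

lemma qspace_iff: "v \<in> qspace B \<longleftrightarrow> (\<forall>b\<in>B. coord B b v \<in> \<rat>)"
proof
  assume "v \<in> qspace B"
  then obtain a where "v = (\<Sum>b\<in>B. a b *\<^sub>R b)" "\<forall>b\<in>B. a b \<in> \<rat>"
    unfolding qspace_def mem_Collect_eq by (elim exE conjE)
  then show "\<forall>b\<in>B. coord B b v \<in> \<rat>" by (simp add: coord_sum_basis)
next
  assume "\<forall>b\<in>B. coord B b v \<in> \<rat>"
  then show "v \<in> qspace B"
    unfolding qspace_def mem_Collect_eq by (intro exI[of _ "\<lambda>b. coord B b v"]) (simp add: coord_sum)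
qed

lemmas coord_simps = linear_0[OF linear_coord] linear_add[OF linear_coord] linear_diff[OF linear_coord]
  linear_neg[OF linear_coord] linear_cmul[OF linear_coord]

lemma zlattice_closed:
  "0 \<in> zlattice B" "u \<in> zlattice B \<Longrightarrow> v \<in> zlattice B \<Longrightarrow> u + v \<in> zlattice B"
  "u \<in> zlattice B \<Longrightarrow> v \<in> zlattice B \<Longrightarrow> u - v \<in> zlattice B"
  "u \<in> zlattice B \<Longrightarrow> - u \<in> zlattice B"
  "c \<in> \<int> \<Longrightarrow> u \<in> zlattice B \<Longrightarrow> c *\<^sub>R u \<in> zlattice B"
  by (simp_all add: zlattice_iff coord_simps)

lemma qspace_closed:
  "0 \<in> qspace B" "u \<in> qspace B \<Longrightarrow> v \<in> qspace B \<Longrightarrow> u + v \<in> qspace B"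
  "u \<in> qspace B \<Longrightarrow> v \<in> qspace B \<Longrightarrow> u - v \<in> qspace B"
  "c \<in> \<rat> \<Longrightarrow> u \<in> qspace B \<Longrightarrow> c *\<^sub>R u \<in> qspace B"
  by (simp_all add: qspace_iff coord_simps)

lemma qspace_sum: "(\<And>i. i \<in> I \<Longrightarrow> f i \<in> qspace B) \<Longrightarrow> (\<Sum>i\<in>I. f i) \<in> qspace B"
  by (induction I rule: infinite_finite_induct) (simp_all add: qspace_closed)

lemma zlattice_subset_qspace: "v \<in> zlattice B \<Longrightarrow> v \<in> qspace B"
  using Ints_subset_Rats by (auto simp: zlattice_iff qspace_iff)

lemma basis_in_zlattice: "b \<in> B \<Longrightarrow> b \<in> zlattice B"
  by (simp add: zlattice_iff representation_basis[OF lattice_basis_props(2)])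

lemma qspace_common_denominator:
  assumes "finite S" "S \<subseteq> qspace B"
  shows "\<exists>d::nat. 0 < d \<and> (\<forall>v\<in>S. real d *\<^sub>R v \<in> zlattice B)"
proof -
  have "\<exists>d::nat. 0 < d \<and> (\<forall>i\<in>S \<times> B. real d * coord B (snd i) (fst i) \<in> \<int>)"
    using assms lattice_basis_props(1) by (intro common_denominator) (auto simp: qspace_iff subset_iff)
  then show ?thesis by (simp add: zlattice_iff coord_simps)
qed

end

section \<open>The relevant elements of the Lie algebra\<close>

text \<open>
  The linear algebra data \<open>(H', \<langle>,\<rangle>', \<gamma>')\<close>, with \<open>g\<close> for the local monodromy.
\<close>
locale unipotent_lattice =
  fixes B :: "'v::real_vector set" and form :: "'v \<Rightarrow> 'v \<Rightarrow> real" and g :: "'v \<Rightarrow> 'v"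
  assumes lattice_basis: "lattice_basis B"
    and lattice_pairing: "lattice_pairing B form"
    and isometry: "unipotent_lattice_isometry B form g"
begin

abbreviation "N \<equiv> unip_log g"
abbreviation "L \<equiv> zlattice B"

lemma g_linear: "linear g" and g_bij: "bij g" and g_lattice: "g ` L = L"
  and g_form: "form (g x) (g y) = form x y" and g_unipotent: "unipotent_map g"
  using isometry by (simp_all add: unipotent_lattice_isometry_def)

lemma form_linear: "linear (form x)" "linear (\<lambda>x. form x y)"
  using lattice_pairing unfolding lattice_pairing_def by blast+

lemmas N_linear = linear_unip_log[OF g_linear g_unipotent]
lemmas N_nilpotent = nilpotent_unip_log[OF g_linear g_unipotent]
lemmas N_simps = linear_0[OF N_linear] linear_add[OF N_linear] linear_diff[OF N_linear]
  linear_neg[OF N_linear] linear_cmul[OF N_linear]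
lemmas L_closed = zlattice_closed[OF lattice_basis]
lemmas Q_closed = qspace_closed[OF lattice_basis]

lemma scaled_N_linear: "linear (\<lambda>v. a *\<^sub>R N v)"
  by (rule linear_compose_scale_right[OF N_linear])

lemma lattice_map_qspace:
  assumes h: "linear h" "h ` L \<subseteq> L" and v: "v \<in> qspace B"
  shows "h v \<in> qspace B"
proof -
  have "h v = (\<Sum>b\<in>B. coord B b v *\<^sub>R h b)"
    using arg_cong[OF coord_sum[OF lattice_basis, of v], of h]
    by (simp add: linear_sum[OF h(1)] linear_cmul[OF h(1)])
  also have "\<dots> \<in> qspace B"
    using v basis_in_zlattice[OF lattice_basis] h(2)
    by (intro qspace_sum[OF lattice_basis] Q_closed(4) zlattice_subset_qspace[OF lattice_basis])
      (auto simp: qspace_iff[OF lattice_basis])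
  finally show ?thesis .
qed

lemma g_qspace: "v \<in> qspace B \<Longrightarrow> g v \<in> qspace B"
  by (rule lattice_map_qspace[OF g_linear]) (simp_all add: g_lattice)

lemma N_qspace: "v \<in> qspace B \<Longrightarrow> N v \<in> qspace B"
proof -
  assume v: "v \<in> qspace B"
  have "((\<lambda>x. g x - x) ^^ k) v \<in> qspace B" for k
    by (induction k) (simp_all add: v g_qspace Q_closed)
  then show ?thesis
    unfolding unip_log_def by (intro qspace_sum[OF lattice_basis] Q_closed(4)) simp_all
qed

lemma N_denominator: "\<exists>d::nat. 0 < d \<and> (\<forall>u\<in>L. real d *\<^sub>R N u \<in> L)"
proof -
  have fin: "finite B" using lattice_basis_props(1)[OF lattice_basis] .
  have "\<exists>d::nat. 0 < d \<and> (\<forall>v\<in>N ` B. real d *\<^sub>R v \<in> L)"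
    using fin by (intro qspace_common_denominator[OF lattice_basis] image_subsetI finite_imageI
        N_qspace zlattice_subset_qspace[OF lattice_basis] basis_in_zlattice[OF lattice_basis])
  then obtain d :: nat where d: "0 < d" "\<And>b. b \<in> B \<Longrightarrow> real d *\<^sub>R N b \<in> L" by blast
  have "real d *\<^sub>R N u \<in> L" if u: "u \<in> L" for u
  proof -
    have "real d *\<^sub>R N u = (\<Sum>b\<in>B. coord B b u *\<^sub>R (real d *\<^sub>R N b))"
      using arg_cong[OF coord_sum[OF lattice_basis, of u], of "\<lambda>u. real d *\<^sub>R N u"]
      by (simp add: linear_sum[OF N_linear] linear_cmul[OF N_linear] scaleR_sum_right mult.commute)
    also have "\<dots> \<in> L"
    proof -
      have "(\<Sum>b\<in>S. coord B b u *\<^sub>R (real d *\<^sub>R N b)) \<in> L" if "finite S" "S \<subseteq> B" for S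
        using that
      proof (induction S)
        case (insert b S)
        then have "coord B b u \<in> \<int>" using u by (simp add: zlattice_iff[OF lattice_basis])
        then have "coord B b u *\<^sub>R (real d *\<^sub>R N b) \<in> L" using insert.prems d(2)[of b] L_closed(5) by blast
        then show ?case using insert L_closed(2) by simp
      qed (simp add: L_closed(1))
      then show ?thesis using fin by blast
    qed
    finally show ?thesis .
  qed
  then show ?thesis using d(1) by blast
qed

text \<open>
  The commuting directions: the slopes of commuting elements over \<open>N\<close> differ by elements of \<open>K\<close>.
\<close>
definition K :: "'v set" where
  "K = {x. N x = 0 \<and> x \<in> range N}"

lemma subspace_K: "subspace K"
proof -
  have "K = {x. N x = 0} \<inter> range N" by (auto simp: K_def)
  then show ?thesis
    using subspace_inter[OF linear_subspace_kernel[OF N_linear] linear_subspace_image[OF N_linear subspace_UNIV]] by simp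
qed

text \<open>
  The element of the Lie algebra with restriction \<open>a N\<close> to \<open>H'\<close> and with value \<open>(w, 0)\<close> on \<open>(0, 1)\<close>.
\<close>
definition endo :: "real \<times> 'v \<Rightarrow> 'v endo" where
  "endo p = extension_map (\<lambda>v. fst p *\<^sub>R N v) (snd p)"

lemma endo_apply: "endo (a, w) (v, t) = (a *\<^sub>R N v + t *\<^sub>R w, 0)"
  by (simp add: endo_def)

lemma linear_endo: "linear endo"
  by (rule linearI) (auto simp: endo_def extension_map_def scaleR_fun_def fun_eq_iff algebra_simps)

lemma endo_inj:
  assumes "\<exists>v. N v \<noteq> 0" shows "inj endo"
proof (rule injI)
  fix p q assume eq: "endo p = endo q"
  obtain a w a' w' where p: "p = (a, w)" and q: "q = (a', w')" by fastforce
  obtain v where v: "N v \<noteq> 0" using assms ..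
  have "a *\<^sub>R N v = a' *\<^sub>R N v"
    using fun_cong[OF eq, of "(v, 0)"] by (simp add: p q endo_apply)
  moreover have "w = w'"
    using fun_cong[OF eq, of "(0, 1)"] by (simp add: p q endo_apply N_simps)
  ultimately show "p = q" using v p q by simp
qed

lemma endo_linear: "linear (endo p)"
  unfolding endo_def extension_map_def
  by (rule linearI) (auto simp: N_simps algebra_simps)

lemma endo_lie_g: "endo p \<in> lie_g form"
proof -
  obtain a w where p: "p = (a, w)" by fastforce
  have "endo p x \<in> W k" if "x \<in> W k" for x k
  proof -
    have "snd (endo p x) = 0" "endo p 0 = 0"
      by (simp_all add: endo_def snd_extension_map linear_0[OF endo_linear[unfolded endo_def]])
    then show ?thesis using that unfolding mem_W_iff by metis
  qed
  then have "(endo p) ` W k \<subseteq> W k" for k by blast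
  moreover have "gr_0 (endo p) t = 0" for t by (simp add: gr_0_def p endo_apply)
  moreover have "form (gr_minus1 (endo p) x) y + form x (gr_minus1 (endo p) y) = 0" for x y
  proof -
    have "form (a *\<^sub>R N x) y + form x (a *\<^sub>R N y) = a * (form (N x) y + form x (N y))"
      by (simp add: linear_cmul[OF form_linear(1)] linear_cmul[OF form_linear(2)] algebra_simps)
    also have "\<dots> = 0" using unip_log_skew[OF g_linear g_unipotent form_linear g_form] by simp
    finally show ?thesis by (simp add: gr_minus1_def p endo_apply)
  qed
  ultimately show ?thesis
    unfolding lie_g_def using endo_linear by simp
qed

lemma endo_lie_g_rat: "p \<in> \<rat> \<times> qspace B \<Longrightarrow> endo p \<in> lie_g_rat B form"
  unfolding lie_g_rat_def H_rat_def
  by (auto simp: endo_lie_g endo_apply intro!: Q_closed N_qspace)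

text \<open>
  The rational structure sees the factor \<open>a\<close> only through \<open>a N\<close>; it is recovered from a nonzero
  rational matrix entry of \<open>N\<close>.
\<close>
lemma endo_lie_g_rat_D:
  assumes nz: "\<exists>v. N v \<noteq> 0" and h: "endo p \<in> lie_g_rat B form"
  shows "p \<in> \<rat> \<times> qspace B"
proof -
  obtain a w where p: "p = (a, w)" by fastforce
  have H: "x \<in> H_rat B \<Longrightarrow> endo p x \<in> H_rat B" for x using h unfolding lie_g_rat_def by blast
  have "w \<in> qspace B"
    using H[of "(0, 1)"] by (simp add: p endo_apply H_rat_def N_simps Q_closed)
  moreover have "a \<in> \<rat>"
  proof -
    obtain b where b: "b \<in> B" "N b \<noteq> 0"
    proof (rule ccontr)
      assume "\<not> thesis"
      then have "\<forall>b\<in>B. N b = 0" using that by blast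
      then have "N v = 0" for v
        using linear_eq_0_on_span[OF N_linear, of B v] lattice_basis_props(3)[OF lattice_basis] by blast
      then show False using nz by blast
    qed
    have "b \<in> qspace B"
      using b(1) zlattice_subset_qspace[OF lattice_basis] basis_in_zlattice[OF lattice_basis] by blast
    then have q: "N b \<in> qspace B" "a *\<^sub>R N b \<in> qspace B"
      using N_qspace H[of "(b, 0)"] by (simp_all add: p endo_apply H_rat_def)
    obtain c where c: "c \<in> B" "coord B c (N b) \<noteq> 0"
      using coord_sum[OF lattice_basis, of "N b"] b(2) by (metis (no_types, lifting) scaleR_eq_0_iff sum.neutral)
    have "coord B c (N b) \<in> \<rat>" "a * coord B c (N b) \<in> \<rat>"
      using q c(1) by (auto simp: qspace_iff[OF lattice_basis] coord_simps[OF lattice_basis])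
    then have "(a * coord B c (N b)) / coord B c (N b) \<in> \<rat>" by (rule Rats_divide[rotated])
    then show ?thesis using c(2) by simp
  qed
  ultimately show ?thesis by (simp add: p)
qed

lemma endo_nilpotent: "nilpotent_map (endo (a, w))"
proof -
  obtain m where m: "\<And>v. ((\<lambda>v. a *\<^sub>R N v) ^^ m) v = 0"
    using nilpotent_scale[OF N_linear N_nilpotent, of a] unfolding nilpotent_map_def by blast
  have "(endo (a, w) ^^ Suc m) x = 0" for x
  proof -
    obtain v t where x: "x = (v, t)" by fastforce
    have "(endo (a, w) ^^ Suc m) x = (endo (a, w) ^^ m) (a *\<^sub>R N v + t *\<^sub>R w, 0)"
      unfolding x funpow_Suc_right by (simp add: endo_apply)
    then show ?thesis
      unfolding endo_def using m by (simp add: extension_map_funpow_0[OF scaled_N_linear] zero_prod_def)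
  qed
  then show ?thesis unfolding nilpotent_map_def by blast
qed

lemma endo_commute:
  assumes "N (a *\<^sub>R w' - a' *\<^sub>R w) = 0"
  shows "endo (a, w) \<circ> endo (a', w') = endo (a', w') \<circ> endo (a, w)"
proof
  fix x :: "'v \<times> real"
  obtain v t where x: "x = (v, t)" by fastforce
  have "a *\<^sub>R N w' = a' *\<^sub>R N w" using assms by (simp add: N_simps)
  then have "t *\<^sub>R (a *\<^sub>R N w') = t *\<^sub>R (a' *\<^sub>R N w)" by simp
  then show "(endo (a, w) \<circ> endo (a', w')) x = (endo (a', w') \<circ> endo (a, w)) x"
    by (simp add: x endo_apply N_simps algebra_simps)
qed

lemma endo_commute_D:
  assumes "endo (a, w) \<circ> endo (a', w') = endo (a', w') \<circ> endo (a, w)"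
  shows "N (a *\<^sub>R w' - a' *\<^sub>R w) = 0"
  using fun_cong[OF assms, of "(0, 1)"] by (simp add: endo_apply N_simps)

lemma endo_of_restriction:
  assumes h: "h \<in> lie_g form" and ray: "\<And>u. h (u, 0) = (a *\<^sub>R N u, 0)"
  shows "h = endo (a, fst (h (0, 1)))"
proof
  fix x :: "'v \<times> real"
  obtain v t where x: "x = (v, t)" by fastforce
  have lin: "linear h" and gr: "\<And>a b. gr_0 h a * b + a * gr_0 h b = 0" using h by (auto simp: lie_g_def)
  have "snd (h (0, 1)) = 0" using gr[of 1 1] by (simp add: gr_0_def)
  then have h1: "h (0, 1) = (fst (h (0, 1)), 0)" by (metis prod.collapse)
  have "h x = h (v, 0) + t *\<^sub>R h (0, 1)"
    unfolding x by (simp add: linear_add[OF lin, symmetric] linear_cmul[OF lin, symmetric])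
  also have "\<dots> = endo (a, fst (h (0, 1))) x"
    by (subst h1) (simp add: ray x endo_apply)
  finally show "h x = endo (a, fst (h (0, 1))) x" .
qed

text \<open>
  The cone over the coset \<open>c + K\<close> in the slice \<open>a = 1\<close>, with the apex added. It is closed only if
  \<open>K\<close> vanishes, but contains every admissible cone over this coset.
\<close>
definition ray_cone :: "'v \<Rightarrow> (real \<times> 'v) set" where
  "ray_cone c = {(a, w). 0 \<le> a \<and> w - a *\<^sub>R c \<in> K \<and> (a = 0 \<longrightarrow> w = 0)}"

lemma ray_cone_range:
  assumes c: "c \<in> range N" and p: "(a, w) \<in> ray_cone c"
  shows "\<exists>u. w = a *\<^sub>R N u"
proof (cases "a = 0")
  case False
  obtain x y where "c = N x" "w - a *\<^sub>R c = N y" using c p by (auto simp: ray_cone_def K_def)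
  then have "w = a *\<^sub>R N (x + (1 / a) *\<^sub>R y)" using False by (simp add: N_simps algebra_simps)
  then show ?thesis by blast
qed (use p in \<open>auto simp: ray_cone_def\<close>)

lemma relative_filtration_endo:
  "is_relative_filtration (endo (a, w)) M \<Longrightarrow> \<exists>u. w = a *\<^sub>R N u"
  using relative_filtration_unique_shape(2)[OF scaled_N_linear] unfolding endo_def fst_conv snd_conv by blast

lemma relative_filtration_endo_exists: "\<exists>M. is_relative_filtration (endo (a, a *\<^sub>R N u)) M"
  using relative_filtration_extension[OF scaled_N_linear]
    monodromy_filtration_exists[OF scaled_N_linear nilpotent_scale[OF N_linear N_nilpotent]]
  unfolding endo_def fst_conv snd_conv by blast

text \<open>
  Since \<open>N (u1 - u2) \<in> K \<subseteq> G (-1)\<close>, the vectors \<open>(- u1, 1)\<close> and \<open>(- u2, 1)\<close> differ by an element of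
  degree \<open>0\<close> and generate the same filtration.
\<close>
lemma relative_filtration_endo_unique:
  assumes M1: "is_relative_filtration (endo (a1, a1 *\<^sub>R N u1)) M1"
    and M2: "is_relative_filtration (endo (a2, a2 *\<^sub>R N u2)) M2"
    and a: "a1 \<noteq> 0" "a2 \<noteq> 0" and u: "N u1 - N u2 \<in> K"
  shows "M1 = M2"
proof -
  define G1 where "G1 = (\<lambda>k. {v. (v, 0) \<in> M1 (k - 1)})"
  define G2 where "G2 = (\<lambda>k. {v. (v, 0) \<in> M2 (k - 1)})"
  have 1: "monodromy_filtration (\<lambda>v. a1 *\<^sub>R N v) G1" "M1 = extension_filtration G1 u1"
    using relative_filtration_unique_shape[OF scaled_N_linear M1[unfolded endo_def fst_conv snd_conv]]
    unfolding G1_def by auto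
  have 2: "monodromy_filtration (\<lambda>v. a2 *\<^sub>R N v) G2" "M2 = extension_filtration G2 u2"
    using relative_filtration_unique_shape[OF scaled_N_linear M2[unfolded endo_def fst_conv snd_conv]]
    unfolding G2_def by auto
  have G: "monodromy_filtration N G1" "monodromy_filtration N G2"
    using monodromy_filtration_scale[OF N_linear a(1) 1(1)] monodromy_filtration_scale[OF N_linear a(2) 2(1)] .
  then have eq: "G1 = G2" by (rule monodromy_filtration_unique[OF N_linear])
  have "N (u1 - u2) \<in> G1 (-1)"
    using u by (intro monodromy_filtration_ker_im[OF N_linear G(1)]) (auto simp: K_def N_simps)
  then have "u1 - u2 \<in> G1 1" by (rule monodromy_filtration_vimage_neg1[OF N_linear G(1)])
  then have "extension_filtration G1 u1 = extension_filtration G1 u2"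
    using G(1) by (intro extension_filtration_cong) (auto simp: monodromy_filtration_def)
  then show ?thesis using 1 2 eq by simp
qed

lemma relative_filtration_0_unique:
  assumes "is_relative_filtration (endo (0, 0)) M1" "is_relative_filtration (endo (0, 0)) M2"
  shows "M1 = M2"
proof -
  let ?G = "\<lambda>M k. {v. (v, 0::real) \<in> M (k - 1)}"
  have "monodromy_filtration (\<lambda>v. 0 *\<^sub>R N v) (?G M1)" "M1 = extension_filtration (?G M1) 0"
    using relative_filtration_unique_shape[OF scaled_N_linear assms(1)[unfolded endo_def fst_conv snd_conv]] by auto
  moreover have "monodromy_filtration (\<lambda>v. 0 *\<^sub>R N v) (?G M2)" "M2 = extension_filtration (?G M2) 0"
    using relative_filtration_unique_shape[OF scaled_N_linear assms(2)[unfolded endo_def fst_conv snd_conv]] by auto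
  ultimately show ?thesis using monodromy_filtration_unique[OF scaled_N_linear] by metis
qed

end

section \<open>Cutting admissible cosets into boxes\<close>

context unipotent_lattice
begin

lemma ray_cone_commute:
  assumes "(a, w) \<in> ray_cone c" "(a', w') \<in> ray_cone c"
  shows "endo (a, w) \<circ> endo (a', w') = endo (a', w') \<circ> endo (a, w)"
proof (rule endo_commute)
  have "w - a *\<^sub>R c \<in> K" "w' - a' *\<^sub>R c \<in> K" using assms by (auto simp: ray_cone_def)
  then have "a *\<^sub>R (w' - a' *\<^sub>R c) - a' *\<^sub>R (w - a *\<^sub>R c) \<in> K"
    by (rule subspace_diff[OF subspace_K subspace_scale[OF subspace_K] subspace_scale[OF subspace_K], rotated])
  moreover have "a *\<^sub>R (w' - a' *\<^sub>R c) - a' *\<^sub>R (w - a *\<^sub>R c) = a *\<^sub>R w' - a' *\<^sub>R w"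
    by (simp add: algebra_simps)
  ultimately show "N (a *\<^sub>R w' - a' *\<^sub>R w) = 0" by (simp add: K_def)
qed

lemma ray_cone_sharp:
  assumes "x \<in> ray_cone c" "y \<in> ray_cone c" "x + y = 0"
  shows "x = 0" "y = 0"
  using assms by (auto simp: ray_cone_def zero_prod_def)

lemma convex_cone_ray_cone: "convex_cone (ray_cone c)"
  unfolding convex_cone_iff
proof (intro conjI ballI allI impI)
  show "0 \<in> ray_cone c" using subspace_0[OF subspace_K] by (simp add: ray_cone_def zero_prod_def)
next
  fix x y assume "x \<in> ray_cone c" "y \<in> ray_cone c"
  moreover obtain a w a' w' where xy: "x = (a, w)" "y = (a', w')" by fastforce
  ultimately have *: "0 \<le> a" "0 \<le> a'" "w - a *\<^sub>R c \<in> K" "w' - a' *\<^sub>R c \<in> K" "a = 0 \<longrightarrow> w = 0" "a' = 0 \<longrightarrow> w' = 0"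
    by (auto simp: ray_cone_def)
  have "(w + w') - (a + a') *\<^sub>R c = (w - a *\<^sub>R c) + (w' - a' *\<^sub>R c)" by (simp add: algebra_simps)
  then have "(w + w') - (a + a') *\<^sub>R c \<in> K" using subspace_add[OF subspace_K *(3,4)] by metis
  then show "x + y \<in> ray_cone c" using * by (auto simp: ray_cone_def xy)
next
  fix x and r :: real assume "x \<in> ray_cone c" "0 \<le> r"
  moreover obtain a w where x: "x = (a, w)" by fastforce
  ultimately have *: "0 \<le> a" "w - a *\<^sub>R c \<in> K" "a = 0 \<longrightarrow> w = 0" "0 \<le> r" by (auto simp: ray_cone_def)
  have "r *\<^sub>R w - (r * a) *\<^sub>R c = r *\<^sub>R (w - a *\<^sub>R c)" by (simp add: algebra_simps)
  then have "r *\<^sub>R w - (r * a) *\<^sub>R c \<in> K" using subspace_scale[OF subspace_K *(2)] by metis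
  then show "r *\<^sub>R x \<in> ray_cone c" using * by (auto simp: ray_cone_def x)
qed

definition rational_points :: "(real \<times> 'v) set" where
  "rational_points = \<rat> \<times> qspace B"

lemma rational_points_closed:
  "x \<in> rational_points \<Longrightarrow> y \<in> rational_points \<Longrightarrow> x + y \<in> rational_points"
  "q \<in> \<rat> \<Longrightarrow> x \<in> rational_points \<Longrightarrow> q *\<^sub>R x \<in> rational_points"
  by (auto simp: rational_points_def intro: Q_closed)

lemma rational_nilpotent_cone_endo:
  assumes nz: "\<exists>v. N v \<noteq> 0" and S: "finite S" "S \<subseteq> rational_points" "S \<subseteq> ray_cone c"
  shows "rational_nilpotent_cone B form (endo ` (convex_cone hull S))"
proof -
  have hull: "endo ` (convex_cone hull S) = convex_cone hull (endo ` S)"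
    by (rule convex_cone_hull_linear_image[OF linear_endo, symmetric])
  have sub: "convex_cone hull S \<subseteq> ray_cone c"
    by (rule hull_minimal) (rule S(3), rule convex_cone_ray_cone)
  have "M \<circ> M' = M' \<circ> M" if "M \<in> endo ` S" "M' \<in> endo ` S" for M M'
  proof -
    obtain x y where xy: "x \<in> S" "M = endo x" "y \<in> S" "M' = endo y"
      using \<open>M \<in> endo ` S\<close> \<open>M' \<in> endo ` S\<close> by (elim imageE)
    then have "x \<in> ray_cone c" "y \<in> ray_cone c" using S(3) by auto
    then show ?thesis unfolding xy by (cases x; cases y) (simp only: ray_cone_commute)
  qed
  moreover have "nilpotent_map M" if "M \<in> endo ` S" for M
  proof -
    obtain x where "M = endo x" using \<open>M \<in> endo ` S\<close> by (rule imageE)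
    then show ?thesis by (cases x) (simp add: endo_nilpotent)
  qed
  moreover have "endo ` (convex_cone hull S) \<inter> uminus ` (endo ` (convex_cone hull S)) = {0}"
  proof -
    have "M = 0" if M: "M \<in> endo ` (convex_cone hull S)" "M \<in> uminus ` (endo ` (convex_cone hull S))" for M
    proof -
      obtain x where x: "M = endo x" "x \<in> convex_cone hull S" using M(1) by (rule imageE)
      obtain M' where M': "M = - M'" "M' \<in> endo ` (convex_cone hull S)" using M(2) by (rule imageE)
      obtain y where y: "M' = endo y" "y \<in> convex_cone hull S" using M'(2) by (rule imageE)
      have "endo (x + y) = endo 0"
        by (simp add: linear_add[OF linear_endo] linear_0[OF linear_endo] x(1)[symmetric] y(1)[symmetric] M'(1))
      then have "x + y = 0" using endo_inj[OF nz] by (simp add: inj_eq)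
      then have "x = 0" using ray_cone_sharp(1)[of x c y] x y sub by blast
      then show ?thesis using x(1) linear_0[OF linear_endo] by simp
    qed
    moreover have 0: "0 \<in> endo ` (convex_cone hull S)"
      using linear_0[OF linear_endo] convex_cone_hull_contains_0 by (metis image_eqI)
    moreover have "0 \<in> uminus ` (endo ` (convex_cone hull S))"
      by (rule image_eqI[OF _ 0]) simp
    ultimately show ?thesis by blast
  qed
  moreover have "endo ` S \<subseteq> lie_g form" using endo_lie_g by (intro image_subsetI)
  moreover have "endo ` S \<subseteq> lie_g_rat B form"
    using S(2) endo_lie_g_rat by (intro image_subsetI) (auto simp: rational_points_def)
  moreover have "finite (endo ` S)" using S(1) by simp
  ultimately show ?thesis
    unfolding rational_nilpotent_cone_def nilpotent_cone_def
    by (intro conjI exI[of _ "endo ` S"]) (use hull in \<open>blast+\<close>)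
qed

text \<open>
  The element \<open>0\<close> is separated from the others by the face \<open>{0}\<close>; all other elements of a cone over
  one coset have the same relative filtration, whichever face they lie in.
\<close>
lemma admissible_ray:
  assumes nz: "\<exists>v. N v \<noteq> 0" and c: "c \<in> range N" and \<sigma>: "convex_cone \<sigma>" "\<sigma> \<subseteq> endo ` ray_cone c"
  shows "admissible \<sigma>" "restricts_into_ray N \<sigma>"
proof -
  have elem: "\<exists>a u. M = endo (a, a *\<^sub>R N u) \<and> (a, a *\<^sub>R N u) \<in> ray_cone c" if "M \<in> \<sigma>" for M
  proof -
    obtain x where x: "M = endo x" "x \<in> ray_cone c" using \<sigma>(2) \<open>M \<in> \<sigma>\<close> by (metis imageE subsetD)
    obtain a w where aw: "x = (a, w)" by fastforce
    then obtain u where "w = a *\<^sub>R N u" using ray_cone_range[OF c] x(2) by blast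
    then show ?thesis using x aw by blast
  qed
  have face0: "cone_face {0} \<sigma>"
    unfolding cone_face_iff[OF \<sigma>(1)] extreme_subcone_def
  proof (intro conjI ballI impI)
    show "{0} \<subseteq> \<sigma>" using convex_cone_contains_0[OF \<sigma>(1)] by blast
    fix M1 M2 assume M: "M1 \<in> \<sigma>" "M2 \<in> \<sigma>" "M1 + M2 \<in> {0}"
    obtain x where x: "M1 = endo x" "x \<in> ray_cone c" using \<sigma>(2) M(1) by (metis imageE subsetD)
    obtain y where y: "M2 = endo y" "y \<in> ray_cone c" using \<sigma>(2) M(2) by (metis imageE subsetD)
    have "endo (x + y) = endo 0"
      using x(1) y(1) M(3) by (simp add: linear_add[OF linear_endo] linear_0[OF linear_endo])
    then have "x + y = 0" using endo_inj[OF nz] by (simp add: inj_eq)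
    then have "x = 0" "y = 0" using ray_cone_sharp[OF x(2) y(2)] by auto
    then show "M1 \<in> {0}" "M2 \<in> {0}" using x(1) y(1) linear_0[OF linear_endo] by auto
  qed simp
  show "restricts_into_ray N \<sigma>"
    unfolding restricts_into_ray_def
  proof
    fix M assume "M \<in> \<sigma>"
    then obtain a u where M: "M = endo (a, a *\<^sub>R N u)" "(a, a *\<^sub>R N u) \<in> ray_cone c" using elem by blast
    have "0 \<le> a" using M(2) by (simp add: ray_cone_def)
    then show "\<exists>a\<ge>0. \<forall>u. M (u, 0) = (a *\<^sub>R N u, 0)"
      unfolding M(1) by (intro exI[of _ a]) (simp add: endo_apply)
  qed
  show "admissible \<sigma>"
    unfolding admissible_def
  proof (intro conjI ballI allI impI)
    fix M assume "M \<in> \<sigma>"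
    then show "\<exists>F. is_relative_filtration M F"
      using elem relative_filtration_endo_exists by metis
  next
    fix M1 M2 F1 F2
    assume M: "M1 \<in> \<sigma>" "M2 \<in> \<sigma>" and face: "smallest_face \<sigma> M1 = smallest_face \<sigma> M2"
      and F: "is_relative_filtration M1 F1" "is_relative_filtration M2 F2"
    have self: "M \<in> smallest_face \<sigma> M" for M by (simp add: smallest_face_def)
    have face_0: "smallest_face \<sigma> 0 \<subseteq> {0}" using face0 unfolding smallest_face_def by blast
    have zero_iff: "M1 = 0 \<longleftrightarrow> M2 = 0"
      using self[of M1] self[of M2] face face_0 by auto
    obtain a1 u1 where 1: "M1 = endo (a1, a1 *\<^sub>R N u1)" "(a1, a1 *\<^sub>R N u1) \<in> ray_cone c" using elem M(1) by blast
    obtain a2 u2 where 2: "M2 = endo (a2, a2 *\<^sub>R N u2)" "(a2, a2 *\<^sub>R N u2) \<in> ray_cone c" using elem M(2) by blast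
    have e0: "endo (0, 0) = 0" using linear_0[OF linear_endo] by (simp add: zero_prod_def)
    show "F1 = F2"
    proof (cases "M1 = 0")
      case True
      then show ?thesis using relative_filtration_0_unique F zero_iff e0 by simp
    next
      case False
      then have a: "a1 \<noteq> 0" "a2 \<noteq> 0" using zero_iff 1(1) 2(1) e0 by auto
      have k: "N u - c \<in> K" if "(a, a *\<^sub>R N u) \<in> ray_cone c" "a \<noteq> 0" for a u
      proof -
        have "a *\<^sub>R (N u - c) \<in> K" using that(1) by (simp add: ray_cone_def algebra_simps)
        then have "(1 / a) *\<^sub>R a *\<^sub>R (N u - c) \<in> K" by (rule subspace_scale[OF subspace_K])
        then show ?thesis using that(2) by simp
      qed
      have "N u1 - N u2 \<in> K"
        using subspace_diff[OF subspace_K k[OF 1(2) a(1)] k[OF 2(2) a(2)]] by simp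
      then show ?thesis using relative_filtration_endo_unique F 1(1) 2(1) a by blast
    qed
  qed
qed

definition half_space_cone :: "'v \<Rightarrow> (real \<times> 'v) set" where
  "half_space_cone c = {(a, w). 0 \<le> a \<and> w - a *\<^sub>R c \<in> K}"

definition box_cone :: "nat \<Rightarrow> ('v \<Rightarrow> int) \<Rightarrow> (real \<times> 'v) set" where
  "box_cone d p = {(a, w). \<forall>b\<in>B. of_int (p b) * a \<le> real d * coord B b w \<and>
     real d * coord B b w \<le> (of_int (p b) + 1) * a}"

definition cell :: "'v \<Rightarrow> nat \<Rightarrow> ('v \<Rightarrow> int) \<Rightarrow> (real \<times> 'v) set" where
  "cell c d p = half_space_cone c \<inter> box_cone d p"

text \<open>
  The image of \<open>N\<close> has the rational generators \<open>N b\<close>, while \<open>ker N\<close> is cut out by rational functionals,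
  the coordinates of \<open>N w\<close>. So one starts with the cone over \<open>c + im N\<close> and cuts it by half-spaces.
\<close>
lemma half_space_cone_rational:
  assumes c: "c \<in> range N" "c \<in> qspace B"
  shows "\<exists>S. finite S \<and> S \<subseteq> rational_points \<and> convex_cone hull S = half_space_cone c"
proof -
  have fin: "finite B" using lattice_basis_props(1)[OF lattice_basis] .
  define S where "S = insert (1 :: real, c) ((\<lambda>b. (0, N b)) ` B \<union> (\<lambda>b. (0, - N b)) ` B)"
  define H where "H = convex_cone hull S"
  define f where "f = (\<lambda>(b, s) x. s * coord B b (N (snd x - fst x *\<^sub>R c)))"
  have NB: "N b \<in> qspace B" if "b \<in> B" for b
    using that N_qspace zlattice_subset_qspace[OF lattice_basis] basis_in_zlattice[OF lattice_basis] by blast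
  have neg: "- v \<in> qspace B" if "v \<in> qspace B" for v
    using Q_closed(3)[OF Q_closed(1) that] by simp
  have S: "finite S" "S \<subseteq> rational_points"
    using fin c(2) NB neg by (auto simp: rational_points_def S_def)
  have Nu: "(0, N u) \<in> H" for u
  proof -
    let ?V = "{u. (0, N u) \<in> H \<and> (0, - N u) \<in> H}"
    have add: "x + y \<in> H" if "x \<in> H" "y \<in> H" for x y unfolding H_def by (rule convex_cone_hull_add[OF that[unfolded H_def]])
    have scale: "(0, r *\<^sub>R v) \<in> H" if "(0, v) \<in> H" "0 \<le> r" for r v
      using convex_cone_hull_mul[OF that[unfolded H_def]] by (simp add: H_def)
    have "subspace ?V"
    proof (rule subspaceI)
      show "0 \<in> ?V" using convex_cone_hull_contains_0[of S] by (simp add: H_def N_simps zero_prod_def)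
      show "x + y \<in> ?V" if "x \<in> ?V" "y \<in> ?V" for x y
        using that add[of "(0, N x)" "(0, N y)"] add[of "(0, - N x)" "(0, - N y)"] by (simp add: N_simps)
      show "r *\<^sub>R x \<in> ?V" if x: "x \<in> ?V" for r x
      proof (cases "0 \<le> r")
        case True
        then show ?thesis using x scale[of "N x" r] scale[of "- N x" r] by (simp add: N_simps)
      next
        case False
        then show ?thesis using x scale[of "N x" "- r"] scale[of "- N x" "- r"] by (simp add: N_simps)
      qed
    qed
    moreover have "B \<subseteq> ?V" by (auto simp: H_def S_def intro!: hull_inc)
    ultimately have "span B \<subseteq> ?V" by (intro span_minimal)
    then show ?thesis using lattice_basis_props(3)[OF lattice_basis, of u] by blast
  qed
  have Heq: "H = {(a, w). 0 \<le> a \<and> w - a *\<^sub>R c \<in> range N}"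
  proof
    have "convex_cone {(a, w). 0 \<le> a \<and> w - a *\<^sub>R c \<in> range N}"
      unfolding convex_cone_iff
    proof (intro conjI ballI allI impI)
      have R: "subspace (range N)" by (rule linear_subspace_image[OF N_linear subspace_UNIV])
      show "0 \<in> {(a, w). 0 \<le> a \<and> w - a *\<^sub>R c \<in> range N}"
        using subspace_0[OF R] by (simp add: zero_prod_def)
      show "x + y \<in> {(a, w). 0 \<le> a \<and> w - a *\<^sub>R c \<in> range N}"
        if "x \<in> {(a, w). 0 \<le> a \<and> w - a *\<^sub>R c \<in> range N}" "y \<in> {(a, w). 0 \<le> a \<and> w - a *\<^sub>R c \<in> range N}" for x y
        using that subspace_add[OF R, of "snd x - fst x *\<^sub>R c" "snd y - fst y *\<^sub>R c"]
        by (cases x; cases y) (simp add: algebra_simps)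
      show "r *\<^sub>R x \<in> {(a, w). 0 \<le> a \<and> w - a *\<^sub>R c \<in> range N}"
        if "x \<in> {(a, w). 0 \<le> a \<and> w - a *\<^sub>R c \<in> range N}" "0 \<le> r" for x r
        using that subspace_scale[OF R, of "snd x - fst x *\<^sub>R c" r]
        by (cases x) (simp add: algebra_simps)
    qed
    moreover have "S \<subseteq> {(a, w). 0 \<le> a \<and> w - a *\<^sub>R c \<in> range N}"
      using linear_0[OF N_linear] by (auto simp: S_def N_simps(4)[symmetric])
    ultimately show "H \<subseteq> {(a, w). 0 \<le> a \<and> w - a *\<^sub>R c \<in> range N}"
      unfolding H_def by (rule hull_minimal[rotated])
  next
    show "{(a, w). 0 \<le> a \<and> w - a *\<^sub>R c \<in> range N} \<subseteq> H"
    proof (rule subsetI)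
      fix x assume "x \<in> {(a, w). 0 \<le> a \<and> w - a *\<^sub>R c \<in> range N}"
      then obtain a w u where x: "x = (a, w)" "0 \<le> a" "w - a *\<^sub>R c = N u" by auto
      have "a *\<^sub>R (1, c) \<in> H" unfolding H_def using x(2) by (intro convex_cone_hull_mul hull_inc) (auto simp: S_def)
      from convex_cone_hull_add[OF this[unfolded H_def] Nu[of u, unfolded H_def]] show "x \<in> H"
        by (simp add: H_def x(1) x(3)[symmetric])
    qed
  qed
  have lin: "linear (f i)" for i
    unfolding f_def by (cases i) (auto intro!: linearI simp: N_simps coord_simps[OF lattice_basis] algebra_simps)
  have "f i x \<in> \<rat>" if "i \<in> B \<times> {1, -1}" "x \<in> rational_points" for i x
  proof -
    obtain b s a w where ix: "i = (b, s)" "x = (a, w)" by fastforce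
    have "N (w - a *\<^sub>R c) \<in> qspace B"
      using that(2) c(2) by (intro N_qspace Q_closed) (auto simp: rational_points_def ix)
    then have "coord B b (N (w - a *\<^sub>R c)) \<in> \<rat>" using that(1) by (auto simp: qspace_iff[OF lattice_basis] ix)
    then show ?thesis using that(1) by (auto simp: f_def ix)
  qed
  then obtain S' where S': "finite S'" "S' \<subseteq> rational_points"
      "convex_cone hull S' = H \<inter> {x. \<forall>i\<in>B \<times> {1, -1}. 0 \<le> f i x}"
    using convex_cone_hull_Int_halfspaces[OF S, of "B \<times> {1, -1}" f] lin fin rational_points_closed
    unfolding H_def by auto
  have "(\<forall>i\<in>B \<times> {1, -1}. 0 \<le> f i (a, w)) \<longleftrightarrow> N (w - a *\<^sub>R c) = 0" for a w
  proof
    assume *: "\<forall>i\<in>B \<times> {1, -1}. 0 \<le> f i (a, w)"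
    have "coord B b (N (w - a *\<^sub>R c)) = 0" if "b \<in> B" for b
      using bspec[OF *, of "(b, 1)"] bspec[OF *, of "(b, -1)"] that by (simp add: f_def)
    then have "(\<Sum>b\<in>B. coord B b (N (w - a *\<^sub>R c)) *\<^sub>R b) = 0" by simp
    then show "N (w - a *\<^sub>R c) = 0" by (simp add: coord_sum[OF lattice_basis])
  next
    assume "N (w - a *\<^sub>R c) = 0"
    then show "\<forall>i\<in>B \<times> {1, -1}. 0 \<le> f i (a, w)" by (auto simp: f_def linear_0[OF linear_coord[OF lattice_basis]])
  qed
  then have "x \<in> H \<inter> {x. \<forall>i\<in>B \<times> {1, -1}. 0 \<le> f i x} \<longleftrightarrow> x \<in> half_space_cone c" for x
    unfolding Heq by (cases x) (auto simp: half_space_cone_def K_def)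
  then have "H \<inter> {x. \<forall>i\<in>B \<times> {1, -1}. 0 \<le> f i x} = half_space_cone c" by blast
  then show ?thesis using S' by metis
qed

lemma box_cone_Int_rational:
  assumes S: "finite S" "S \<subseteq> rational_points"
  shows "\<exists>S'. finite S' \<and> S' \<subseteq> rational_points \<and> convex_cone hull S' = convex_cone hull S \<inter> box_cone d p"
proof -
  have fin: "finite B" using lattice_basis_props(1)[OF lattice_basis] .
  define f where "f = (\<lambda>(b, s) x. if s then real d * coord B b (snd x) - of_int (p b) * fst x
    else (of_int (p b) + 1) * fst x - real d * coord B b (snd x))"
  have lin: "linear (f i)" for i
    unfolding f_def by (cases i) (auto intro!: linearI simp: coord_simps[OF lattice_basis] algebra_simps)
  have "f i x \<in> \<rat>" if "i \<in> B \<times> UNIV" "x \<in> rational_points" for i x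
    using that by (cases i; cases x) (auto simp: f_def rational_points_def qspace_iff[OF lattice_basis])
  then obtain S' where "finite S'" "S' \<subseteq> rational_points"
      "convex_cone hull S' = convex_cone hull S \<inter> {x. \<forall>i\<in>B \<times> UNIV. 0 \<le> f i x}"
    using convex_cone_hull_Int_halfspaces[OF S, of "B \<times> UNIV" f] lin fin rational_points_closed by auto
  moreover have "(\<forall>i\<in>B \<times> UNIV. 0 \<le> f i x) \<longleftrightarrow> x \<in> box_cone d p" for x
  proof -
    obtain a w where x: "x = (a, w)" by fastforce
    show ?thesis
    proof
      assume *: "\<forall>i\<in>B \<times> UNIV. 0 \<le> f i x"
      have "of_int (p b) * a \<le> real d * coord B b w \<and> real d * coord B b w \<le> (of_int (p b) + 1) * a" if "b \<in> B" for b
        using bspec[OF *, of "(b, True)"] bspec[OF *, of "(b, False)"] that by (simp add: f_def x)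
      then show "x \<in> box_cone d p" by (simp add: x box_cone_def)
    next
      assume "x \<in> box_cone d p"
      then have *: "of_int (p b) * a \<le> real d * coord B b w \<and> real d * coord B b w \<le> (of_int (p b) + 1) * a" if "b \<in> B" for b
        using that by (simp add: x box_cone_def)
      have "0 \<le> f (b, s) x" if "b \<in> B" for b s using *[OF that] by (simp add: f_def x)
      then show "\<forall>i\<in>B \<times> UNIV. 0 \<le> f i x" by blast
    qed
  qed
  then have "{x. \<forall>i\<in>B \<times> UNIV. 0 \<le> f i x} = box_cone d p" by blast
  ultimately show ?thesis by metis
qed

lemma cell_rational:
  assumes c: "c \<in> range N" "c \<in> qspace B"
  shows "\<exists>S. finite S \<and> S \<subseteq> rational_points \<and> convex_cone hull S = cell c d p"
  using half_space_cone_rational[OF c] box_cone_Int_rational unfolding cell_def by metis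

lemma box_cone_zero: "0 < d \<Longrightarrow> (0, w) \<in> box_cone d p \<Longrightarrow> w = 0"
proof -
  assume "0 < d" "(0, w) \<in> box_cone d p"
  then have "\<forall>b\<in>B. coord B b w = 0" by (auto simp: box_cone_def intro!: antisym)
  then have "(\<Sum>b\<in>B. coord B b w *\<^sub>R b) = 0" by simp
  then show "w = 0" by (simp add: coord_sum[OF lattice_basis])
qed

lemma cell_subset_ray_cone: "0 < d \<Longrightarrow> cell c d p \<subseteq> ray_cone c"
  using box_cone_zero by (auto simp: cell_def half_space_cone_def ray_cone_def)

lemma convex_cone_cell: "convex_cone (cell c d p)"
proof -
  have "convex_cone (half_space_cone c)"
    unfolding convex_cone_iff
  proof (intro conjI ballI allI impI)
    show "0 \<in> half_space_cone c" using subspace_0[OF subspace_K] by (simp add: half_space_cone_def zero_prod_def)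
    show "x + y \<in> half_space_cone c" if "x \<in> half_space_cone c" "y \<in> half_space_cone c" for x y
      using that subspace_add[OF subspace_K, of "snd x - fst x *\<^sub>R c" "snd y - fst y *\<^sub>R c"]
      by (cases x; cases y) (simp add: half_space_cone_def algebra_simps)
    show "r *\<^sub>R x \<in> half_space_cone c" if "x \<in> half_space_cone c" "0 \<le> r" for x r
      using that subspace_scale[OF subspace_K, of "snd x - fst x *\<^sub>R c" r]
      by (cases x) (simp add: half_space_cone_def algebra_simps)
  qed
  moreover have "convex_cone (box_cone d p)"
    unfolding convex_cone_iff
  proof (intro conjI ballI allI impI)
    show "0 \<in> box_cone d p" by (simp add: box_cone_def zero_prod_def linear_0[OF linear_coord[OF lattice_basis]])
    show "x + y \<in> box_cone d p" if "x \<in> box_cone d p" "y \<in> box_cone d p" for x y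
      using that by (cases x; cases y) (fastforce simp: box_cone_def coord_simps[OF lattice_basis] algebra_simps)
    show "r *\<^sub>R x \<in> box_cone d p" if "x \<in> box_cone d p" "0 \<le> r" for x r
    proof -
      obtain a w where x: "x = (a, w)" by fastforce
      have "r * (of_int (p b) * a) \<le> r * (real d * coord B b w) \<and>
          r * (real d * coord B b w) \<le> r * ((of_int (p b) + 1) * a)" if "b \<in> B" for b
        using \<open>x \<in> box_cone d p\<close> \<open>0 \<le> r\<close> that by (intro conjI mult_left_mono) (auto simp: box_cone_def x)
      then show ?thesis by (auto simp: x box_cone_def coord_simps[OF lattice_basis] algebra_simps)
    qed
  qed
  ultimately show ?thesis unfolding cell_def by (rule convex_cone_Int)
qed

text \<open>
  If \<open>p\<close> and \<open>p'\<close> differ, both slopes lie on the same side of a separating integer, and their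
  combined slope on the other side. Then both are equal to this integer.
\<close>
lemma box_interval_extreme:
  fixes p p' :: int and x y a a' :: real
  assumes "0 \<le> a" "0 \<le> a'"
    and "of_int p * a \<le> x" "x \<le> (of_int p + 1) * a"
    and "of_int p * a' \<le> y" "y \<le> (of_int p + 1) * a'"
    and "of_int p' * (a + a') \<le> x + y" "x + y \<le> (of_int p' + 1) * (a + a')"
  shows "of_int p' * a \<le> x \<and> x \<le> (of_int p' + 1) * a"
proof
  show "of_int p' * a \<le> x"
  proof (cases "p' \<le> p")
    case True
    then have "of_int p' * a \<le> of_int p * a" using assms(1) by (intro mult_right_mono) auto
    then show ?thesis using assms by linarith
  next
    case False
    then have "of_int p + 1 \<le> (of_int p' :: real)" by linarith
    then have "(of_int p + 1) * a' \<le> of_int p' * a'" using assms(2) by (intro mult_right_mono)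
    then show ?thesis using assms by (simp add: distrib_left)
  qed
  show "x \<le> (of_int p' + 1) * a"
  proof (cases "p \<le> p'")
    case True
    then have "(of_int p + 1) * a \<le> (of_int p' + 1) * a" using assms(1) by (intro mult_right_mono) auto
    then show ?thesis using assms by linarith
  next
    case False
    then have "of_int p' + 1 \<le> (of_int p :: real)" by linarith
    then have "(of_int p' + 1) * a' \<le> of_int p * a'" using assms(2) by (intro mult_right_mono)
    then show ?thesis using assms by (simp add: distrib_left)
  qed
qed

lemma half_space_cone_cong:
  assumes "c - c' \<in> K" shows "half_space_cone c = half_space_cone c'"
proof -
  have "w - a *\<^sub>R c \<in> K \<longleftrightarrow> w - a *\<^sub>R c' \<in> K" for a w
  proof -
    have k: "a *\<^sub>R (c - c') \<in> K" by (rule subspace_scale[OF subspace_K assms])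
    have "w - a *\<^sub>R c' = (w - a *\<^sub>R c) + a *\<^sub>R (c - c')" "w - a *\<^sub>R c = (w - a *\<^sub>R c') - a *\<^sub>R (c - c')"
      by (simp_all add: algebra_simps)
    then show ?thesis using subspace_add[OF subspace_K _ k] subspace_diff[OF subspace_K _ k] by metis
  qed
  then show ?thesis by (simp add: half_space_cone_def)
qed

lemma cell_Int_extreme_same:
  assumes "c - c' \<in> K"
  shows "extreme_subcone (cell c d p \<inter> cell c' d p') (cell c d p)"
  unfolding extreme_subcone_def
proof (intro conjI ballI impI)
  show "convex_cone (cell c d p \<inter> cell c' d p')" by (intro convex_cone_Int convex_cone_cell)
  show "cell c d p \<inter> cell c' d p' \<subseteq> cell c d p" by blast
  have main: "x \<in> cell c' d p'" if xy: "x \<in> cell c d p" "y \<in> cell c d p" "x + y \<in> cell c' d p'" for x y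
  proof -
    obtain a w a' w' where e: "x = (a, w)" "y = (a', w')" by fastforce
    have a: "0 \<le> a" "0 \<le> a'" using xy by (auto simp: e cell_def half_space_cone_def)
    have "of_int (p' b) * a \<le> real d * coord B b w \<and> real d * coord B b w \<le> (of_int (p' b) + 1) * a" if "b \<in> B" for b
    proof (rule box_interval_extreme[OF a, of "p b" _ "real d * coord B b w'"])
      have "x \<in> box_cone d p" "y \<in> box_cone d p" "x + y \<in> box_cone d p'" using xy by (simp_all add: cell_def)
      note box = this[unfolded e box_cone_def add_Pair mem_Collect_eq prod.case, THEN bspec, OF that]
      show "of_int (p b) * a \<le> real d * coord B b w" "real d * coord B b w \<le> (of_int (p b) + 1) * a"
        using box(1) by blast+
      show "of_int (p b) * a' \<le> real d * coord B b w'" "real d * coord B b w' \<le> (of_int (p b) + 1) * a'"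
        using box(2) by blast+
      have s: "real d * coord B b (w + w') = real d * coord B b w + real d * coord B b w'"
        by (simp add: coord_simps[OF lattice_basis] distrib_left)
      show "of_int (p' b) * (a + a') \<le> real d * coord B b w + real d * coord B b w'"
        "real d * coord B b w + real d * coord B b w' \<le> (of_int (p' b) + 1) * (a + a')"
        using box(3) unfolding s by blast+
    qed
    then have "x \<in> box_cone d p'" by (simp add: e box_cone_def)
    moreover have "x \<in> half_space_cone c'" using xy(1) half_space_cone_cong[OF assms] by (simp add: cell_def)
    ultimately show ?thesis by (simp add: cell_def)
  qed
  fix x y assume xy: "x \<in> cell c d p" "y \<in> cell c d p" "x + y \<in> cell c d p \<inter> cell c' d p'"
  then show "x \<in> cell c d p \<inter> cell c' d p'" using main by blast
  show "y \<in> cell c d p \<inter> cell c' d p'" using main[of y x] xy by (simp add: add.commute)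
qed

lemma cell_Int_extreme_other:
  assumes "c - c' \<notin> K" "0 < d" "0 < d'"
  shows "extreme_subcone (cell c d p \<inter> cell c' d' p') (cell c d p)"
proof -
  have sub: "cell c d p \<subseteq> ray_cone c" "cell c' d' p' \<subseteq> ray_cone c'"
    using cell_subset_ray_cone assms by auto
  have "x = 0" if x: "x \<in> ray_cone c" "x \<in> ray_cone c'" for x
  proof -
    obtain a w where e: "x = (a, w)" by fastforce
    have k: "w - a *\<^sub>R c \<in> K" "w - a *\<^sub>R c' \<in> K" and w: "a = 0 \<longrightarrow> w = 0" using x by (auto simp: ray_cone_def e)
    have "a *\<^sub>R (c - c') = (w - a *\<^sub>R c') - (w - a *\<^sub>R c)" by (simp add: algebra_simps)
    then have "a *\<^sub>R (c - c') \<in> K" using subspace_diff[OF subspace_K k(2,1)] by simp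
    then have "(1 / a) *\<^sub>R a *\<^sub>R (c - c') \<in> K" by (rule subspace_scale[OF subspace_K])
    then have "a = 0" using assms(1) by (cases "a = 0") simp_all
    then show ?thesis using w by (simp add: e zero_prod_def)
  qed
  then have "cell c d p \<inter> cell c' d' p' = {0}"
    using sub convex_cone_contains_0[OF convex_cone_cell] by blast
  moreover have "x = 0 \<and> y = 0" if "x \<in> cell c d p" "y \<in> cell c d p" "x + y = 0" for x y
    using ray_cone_sharp[of x c y] that sub(1) by blast
  ultimately show ?thesis
    unfolding extreme_subcone_def using convex_cone_contains_0[OF convex_cone_cell] by simp
qed

text \<open>
  The condition on \<open>N\<close> makes the translations by \<open>N b\<close>, \<open>b \<in> L\<close>, preserve the grid \<open>(1/d) L\<close>; the
  condition on \<open>c\<close> puts a point of the grid on the coset \<open>c + K\<close>.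
\<close>
definition good_denominator :: "'v \<Rightarrow> nat \<Rightarrow> bool" where
  "good_denominator c d \<longleftrightarrow> 0 < d \<and> (\<forall>u\<in>L. real d *\<^sub>R N u \<in> L) \<and> (\<exists>k\<in>K. real d *\<^sub>R (c + k) \<in> L)"

definition den :: "'v \<Rightarrow> nat" where
  "den c = (LEAST d. good_denominator c d)"

lemma good_denominator_den:
  assumes "c \<in> qspace B" shows "good_denominator c (den c)"
proof -
  obtain d1 where d1: "0 < d1" "\<forall>u\<in>L. real d1 *\<^sub>R N u \<in> L" using N_denominator by blast
  obtain d2 where d2: "0 < d2" "real d2 *\<^sub>R c \<in> L"
    using qspace_common_denominator[OF lattice_basis, of "{c}"] assms by auto
  have int: "real d *\<^sub>R v \<in> L" if "v \<in> L" for d v using that by (intro L_closed(5)) auto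
  have "real (d1 * d2) *\<^sub>R N u \<in> L" if "u \<in> L" for u
    using int[of "real d1 *\<^sub>R N u" d2] d1(2) that by (simp add: mult.commute)
  moreover have "real (d1 * d2) *\<^sub>R (c + 0) \<in> L"
    using int[OF d2(2), of d1] by simp
  ultimately have "good_denominator c (d1 * d2)"
    unfolding good_denominator_def using d1(1) d2(1) subspace_0[OF subspace_K] by (intro conjI ballI bexI[of _ 0]) auto
  then show ?thesis unfolding den_def by (rule LeastI)
qed

lemma good_denominator_cong:
  assumes "c - c' \<in> K" "good_denominator c d" shows "good_denominator c' d"
proof -
  obtain k where k: "k \<in> K" "real d *\<^sub>R (c + k) \<in> L" using assms(2) unfolding good_denominator_def by blast
  have "c' + ((c - c') + k) = c + k" by simp
  moreover have "(c - c') + k \<in> K" by (rule subspace_add[OF subspace_K assms(1) k(1)])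
  ultimately show ?thesis using assms(2) k(2) unfolding good_denominator_def by metis
qed

lemma den_cong: assumes "c - c' \<in> K" shows "den c = den c'"
proof -
  have "c' - c \<in> K" using subspace_neg[OF subspace_K assms] by simp
  then have "good_denominator c = good_denominator c'"
    using good_denominator_cong assms by blast
  then show ?thesis by (simp add: den_def)
qed

lemma den_pos: "c \<in> qspace B \<Longrightarrow> 0 < den c"
  using good_denominator_den by (simp add: good_denominator_def)

lemma cell_Int_extreme:
  assumes "c \<in> qspace B" "c' \<in> qspace B"
  shows "extreme_subcone (cell c (den c) p \<inter> cell c' (den c') p') (cell c (den c) p)"
proof (cases "c - c' \<in> K")
  case True
  then show ?thesis using cell_Int_extreme_same[OF True, of "den c" p p'] den_cong[OF True] by simp
next
  case False
  then show ?thesis using cell_Int_extreme_other den_pos assms by blast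
qed

end

section \<open>The action of the arithmetic group\<close>

abbreviation inverse_map :: "('x \<Rightarrow> 'y) \<Rightarrow> 'y \<Rightarrow> 'x" where
  "inverse_map \<equiv> inv_into UNIV"

context unipotent_lattice
begin

text \<open>
  The properties of powers of the monodromy that enter the action on cosets of \<open>K\<close>.
\<close>
definition lattice_symmetry :: "('v \<Rightarrow> 'v) \<Rightarrow> bool" where
  "lattice_symmetry h \<longleftrightarrow> linear h \<and> bij h \<and> h ` L = L \<and> (\<forall>x. h (N x) = N (h x)) \<and> (\<forall>x. N x = 0 \<longrightarrow> h x = x)"

lemma lattice_symmetry_g: "lattice_symmetry g"
  unfolding lattice_symmetry_def
  using g_linear g_bij g_lattice unip_log_commute[OF g_linear g_unipotent g_linear]
    unip_fixes_kernel[OF g_linear g_unipotent] by simp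

lemma lattice_symmetry_inv:
  assumes "lattice_symmetry h" shows "lattice_symmetry (inverse_map h)"
proof -
  have h: "linear h" "bij h" "h ` L = L" "\<And>x. h (N x) = N (h x)" "\<And>x. N x = 0 \<Longrightarrow> h x = x"
    using assms by (auto simp: lattice_symmetry_def)
  have inj: "inj h" and surj: "surj h" using h(2) by (auto simp: bij_def)
  have "inverse_map h ` L = L" using image_inv_f_f[OF inj, of L] h(3) by simp
  moreover have "inverse_map h (N x) = N (inverse_map h x)" for x
    using h(4)[of "inverse_map h x"] surj_f_inv_f[OF surj] inv_f_f[OF inj] by metis
  moreover have "inverse_map h x = x" if "N x = 0" for x using h(5)[OF that] inv_f_f[OF inj] by metis
  moreover have "linear (inverse_map h)"
  proof (rule linearI)
    note hh = surj_f_inv_f[OF surj]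
    show "inverse_map h (x + y) = inverse_map h x + inverse_map h y" for x y
      by (rule inv_f_eq[OF inj]) (simp add: linear_add[OF h(1)] hh)
    show "inverse_map h (r *\<^sub>R x) = r *\<^sub>R inverse_map h x" for r x
      by (rule inv_f_eq[OF inj]) (simp add: linear_cmul[OF h(1)] hh)
  qed
  ultimately show ?thesis using bij_imp_bij_inv[OF h(2)] by (simp add: lattice_symmetry_def)
qed

lemma lattice_symmetry_funpow:
  assumes "lattice_symmetry h" shows "lattice_symmetry (h ^^ n)"
proof (induction n)
  case 0
  show ?case by (simp add: lattice_symmetry_def linear_ident bij_id[unfolded id_def])
next
  case (Suc n)
  have "linear (h ^^ Suc n)" using assms linear_funpow by (auto simp: lattice_symmetry_def simp del: funpow.simps)
  moreover have "bij (h ^^ Suc n)" using assms bij_fn by (auto simp: lattice_symmetry_def simp del: funpow.simps)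
  moreover have "(h ^^ Suc n) ` L = L"
  proof -
    have "(h ^^ Suc n) ` L = h ` (h ^^ n) ` L" by (simp add: image_comp)
    then show ?thesis using assms Suc.IH by (simp add: lattice_symmetry_def)
  qed
  ultimately show ?case using assms Suc.IH by (simp add: lattice_symmetry_def o_def)
qed

lemma lattice_symmetry_Gamma: "h \<in> Gamma_H' g \<Longrightarrow> lattice_symmetry h"
  unfolding Gamma_H'_def
  using lattice_symmetry_funpow[OF lattice_symmetry_g] lattice_symmetry_funpow[OF lattice_symmetry_inv[OF lattice_symmetry_g]]
  by blast

lemma lattice_symmetry_qspace: "lattice_symmetry h \<Longrightarrow> v \<in> qspace B \<Longrightarrow> h v \<in> qspace B"
  using lattice_map_qspace by (simp add: lattice_symmetry_def)

text \<open>
  The action of the arithmetic group on the slice \<open>a = 1\<close>; \<open>e\<close> is the sign on \<open>gr\<^sub>0\<close> and \<open>b\<close> the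
  translation part.
\<close>
definition affine_move :: "real \<Rightarrow> ('v \<Rightarrow> 'v) \<Rightarrow> 'v \<Rightarrow> 'v \<Rightarrow> 'v" where
  "affine_move e h b c = e *\<^sub>R (h c - N b)"

lemma Gamma_H_form:
  assumes "\<gamma> \<in> Gamma_H B form g"
  shows "\<exists>h b e. lattice_symmetry h \<and> b \<in> L \<and> (e = 1 \<or> e = -1) \<and>
    linear \<gamma> \<and> bij \<gamma> \<and> (\<forall>v t. \<gamma> (v, t) = (h v + t *\<^sub>R b, e * t))"
proof -
  have G: "\<gamma> \<in> G_int B form" and h: "gr_minus1 \<gamma> \<in> Gamma_H' g" using assms by (auto simp: Gamma_H_def)
  have lin: "linear \<gamma>" and bij: "bij \<gamma>" and lat: "\<gamma> ` H_int B = H_int B" and W: "\<gamma> ` W k = W k"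
    and gr0: "gr_0 \<gamma> x * gr_0 \<gamma> y = x * y" for k x y
    using G by (simp_all add: G_int_def)
  define b where "b = fst (\<gamma> (0, 1))"
  define e where "e = gr_0 \<gamma> 1"
  have "e * e = 1" using gr0[of 1 1] by (simp add: e_def)
  then have e: "e = 1 \<or> e = -1" by (simp add: square_eq_1_iff)
  have "(0, 1) \<in> H_int B" using L_closed(1) by (simp add: H_int_def)
  then have "\<gamma> (0, 1) \<in> H_int B" using lat by blast
  then have b: "b \<in> L" by (auto simp: H_int_def b_def)
  have "\<gamma> (v, t) = (gr_minus1 \<gamma> v + t *\<^sub>R b, e * t)" for v t
  proof -
    have "(v, 0) \<in> W (-1)" by (simp add: mem_W_iff)
    then have "\<gamma> (v, 0) \<in> W (-1)" using W[of "-1"] by blast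
    then have "snd (\<gamma> (v, 0)) = 0" by (auto simp: mem_W_iff)
    then have 1: "\<gamma> (v, 0) = (gr_minus1 \<gamma> v, 0)" by (simp add: gr_minus1_def prod_eq_iff)
    have 2: "\<gamma> (0, 1) = (b, e)" by (simp add: gr_0_def b_def e_def)
    have "\<gamma> (v, t) = \<gamma> (v, 0) + t *\<^sub>R \<gamma> (0, 1)"
      by (simp add: linear_add[OF lin, symmetric] linear_cmul[OF lin, symmetric])
    also have "\<dots> = (gr_minus1 \<gamma> v, 0) + t *\<^sub>R (b, e)" by (simp only: 1 2)
    finally show ?thesis by (simp add: mult.commute)
  qed
  then show ?thesis
    using lattice_symmetry_Gamma[OF h] b e lin bij
    by (intro exI[of _ "gr_minus1 \<gamma>"] exI[of _ b] exI[of _ e]) simp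
qed

lemma conjugate_endo:
  assumes h: "lattice_symmetry h" and e: "e = 1 \<or> e = (-1::real)" and bij: "bij \<gamma>"
    and \<gamma>: "\<And>v t. \<gamma> (v, t) = (h v + t *\<^sub>R b, e * t)"
  shows "\<gamma> \<circ> endo (a, w) \<circ> inverse_map \<gamma> = endo (a, e *\<^sub>R (h w - a *\<^sub>R N b))"
proof -
  have lin: "linear h" and comm: "\<And>x. h (N x) = N (h x)" using h by (auto simp: lattice_symmetry_def)
  have "\<gamma> (endo (a, w) x) = endo (a, e *\<^sub>R (h w - a *\<^sub>R N b)) (\<gamma> x)" for x
  proof -
    obtain v t where x: "x = (v, t)" by fastforce
    show ?thesis
      using e by (elim disjE)
        (simp_all add: x endo_apply \<gamma> linear_add[OF lin] linear_cmul[OF lin] comm N_simps algebra_simps)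
  qed
  then have "\<gamma> \<circ> endo (a, w) = endo (a, e *\<^sub>R (h w - a *\<^sub>R N b)) \<circ> \<gamma>" by (simp add: fun_eq_iff)
  then have "\<gamma> \<circ> endo (a, w) \<circ> inverse_map \<gamma> = endo (a, e *\<^sub>R (h w - a *\<^sub>R N b)) \<circ> (\<gamma> \<circ> inverse_map \<gamma>)"
    by (simp add: comp_assoc)
  moreover have "\<gamma> \<circ> inverse_map \<gamma> = id" using bij by (simp add: bij_def surj_iff)
  ultimately show ?thesis by simp
qed

lemma good_denominator_affine_move:
  assumes h: "lattice_symmetry h" and e: "e = 1 \<or> e = -1" and b: "b \<in> L" and d: "good_denominator c d"
  shows "good_denominator (affine_move e h b c) d"
proof -
  have lin: "linear h" and L: "h ` L = L" and hfix: "\<And>x. N x = 0 \<Longrightarrow> h x = x"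
    using h by (auto simp: lattice_symmetry_def)
  obtain k where k: "k \<in> K" "real d *\<^sub>R (c + k) \<in> L" and dN: "\<And>u. u \<in> L \<Longrightarrow> real d *\<^sub>R N u \<in> L"
    and d0: "0 < d" using d unfolding good_denominator_def by blast
  have hk: "h k = k" using k(1) hfix by (simp add: K_def)
  have "h (real d *\<^sub>R (c + k)) - real d *\<^sub>R N b \<in> L"
    using L k(2) dN[OF b] by (intro L_closed(3)) auto
  then have "e *\<^sub>R (h (real d *\<^sub>R (c + k)) - real d *\<^sub>R N b) \<in> L" using e by (intro L_closed(5)) auto
  moreover have "e *\<^sub>R (h (real d *\<^sub>R (c + k)) - real d *\<^sub>R N b) = real d *\<^sub>R (affine_move e h b c + e *\<^sub>R k)"
    by (simp add: affine_move_def linear_add[OF lin] linear_cmul[OF lin] hk algebra_simps)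
  moreover have "e *\<^sub>R k \<in> K" by (rule subspace_scale[OF subspace_K k(1)])
  ultimately show ?thesis unfolding good_denominator_def using dN d0 by metis
qed

lemma den_affine_move:
  assumes h: "lattice_symmetry h" and e: "e = 1 \<or> e = -1" and b: "b \<in> L"
  shows "den (affine_move e h b c) = den c"
proof -
  have lin: "linear h" and L: "h ` L = L" and bij: "bij h" using h by (auto simp: lattice_symmetry_def)
  note hi = lattice_symmetry_inv[OF h]
  have lini: "linear (inverse_map h)" and Li: "inverse_map h ` L = L" and comm: "\<And>x. inverse_map h (N x) = N (inverse_map h x)"
    using hi by (auto simp: lattice_symmetry_def)
  let ?b = "- e *\<^sub>R inverse_map h b"
  have b': "?b \<in> L" using b Li e by (intro L_closed(5)) auto
  have ee: "e * e = 1" using e by auto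
  have "affine_move e (inverse_map h) ?b (affine_move e h b c) = inverse_map h (h c)"
    using ee by (simp add: affine_move_def linear_diff[OF lini] linear_cmul[OF lini] comm N_simps algebra_simps)
  also have "\<dots> = c" using bij by (simp add: bij_def)
  finally have undo: "affine_move e (inverse_map h) ?b (affine_move e h b c) = c" .
  have "good_denominator (affine_move e h b c) d \<longleftrightarrow> good_denominator c d" for d
    using good_denominator_affine_move[OF h e b] good_denominator_affine_move[OF hi e b', of "affine_move e h b c"]
    unfolding undo by blast
  then show ?thesis by (simp add: den_def)
qed

lemma affine_move_range: "lattice_symmetry h \<Longrightarrow> c \<in> range N \<Longrightarrow> affine_move e h b c \<in> range N"
proof -
  assume h: "lattice_symmetry h" and "c \<in> range N"
  then obtain u where "c = N u" by blast
  then have "affine_move e h b c = N (e *\<^sub>R (h u - b))"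
    using h by (simp add: affine_move_def lattice_symmetry_def N_simps)
  then show ?thesis by blast
qed

lemma affine_move_qspace:
  assumes h: "lattice_symmetry h" and e: "e = 1 \<or> e = -1" and b: "b \<in> L" and c: "c \<in> qspace B"
  shows "affine_move e h b c \<in> qspace B"
proof -
  have "h c \<in> qspace B" by (rule lattice_symmetry_qspace[OF h c])
  moreover have "N b \<in> qspace B" by (rule N_qspace[OF zlattice_subset_qspace[OF lattice_basis b]])
  ultimately have "h c - N b \<in> qspace B" by (rule Q_closed(3))
  then show ?thesis unfolding affine_move_def using e by (intro Q_closed(4)) auto
qed

text \<open>
  On \<open>c + K\<close> the map is \<open>w \<mapsto> e (w + l)\<close> with one vector \<open>l \<in> (1/d) L\<close>, because \<open>h\<close> fixes \<open>K\<close> and moves a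
  grid point of the coset to a grid point. Such a map permutes the boxes; a sign change turns the
  interval \<open>[p, p + 1]\<close> into \<open>[- p - 1, - p]\<close>.
\<close>
lemma cell_affine_move:
  assumes h: "lattice_symmetry h" and e: "e = 1 \<or> e = -1" and b: "b \<in> L" and c: "c \<in> qspace B"
  shows "\<exists>p'. (\<lambda>(a, w). (a, e *\<^sub>R (h w - a *\<^sub>R N b))) ` cell c (den c) p
    = cell (affine_move e h b c) (den (affine_move e h b c)) p'"
proof -
  have lin: "linear h" and L: "h ` L = L" and hfix: "\<And>x. N x = 0 \<Longrightarrow> h x = x"
    using h by (auto simp: lattice_symmetry_def)
  let ?d = "den c" let ?c = "affine_move e h b c"
  have gd: "good_denominator c ?d" by (rule good_denominator_den[OF c])
  obtain k where k: "k \<in> K" "real ?d *\<^sub>R (c + k) \<in> L" and dN: "\<And>u. u \<in> L \<Longrightarrow> real ?d *\<^sub>R N u \<in> L"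
    using gd unfolding good_denominator_def by blast
  have ee: "e * e = 1" using e by auto
  define l where "l = h (c + k) - (c + k) - N b"
  have "h (real ?d *\<^sub>R (c + k)) - real ?d *\<^sub>R (c + k) - real ?d *\<^sub>R N b \<in> L"
    using L k(2) dN[OF b] by (intro L_closed(3)) auto
  then have "real ?d *\<^sub>R l \<in> L" by (simp only: l_def linear_cmul[OF lin] scaleR_diff_right)
  then have "\<forall>b\<in>B. \<exists>r::int. real ?d * coord B b l = of_int r"
    by (auto simp: zlattice_iff[OF lattice_basis] coord_simps[OF lattice_basis] elim!: Ints_cases)
  then obtain r :: "'v \<Rightarrow> int" where r: "\<And>b. b \<in> B \<Longrightarrow> real ?d * coord B b l = of_int (r b)" by metis
  have c': "?c = e *\<^sub>R (c + l)"
    using k(1) hfix by (simp add: affine_move_def l_def linear_add[OF lin] K_def)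
  have move: "e *\<^sub>R (h w - a *\<^sub>R N b) = e *\<^sub>R (w + a *\<^sub>R l)" if "w - a *\<^sub>R c \<in> K" for a w
  proof -
    have "w - a *\<^sub>R (c + k) \<in> K"
      using subspace_diff[OF subspace_K that subspace_scale[OF subspace_K k(1), of a]] by (simp add: algebra_simps)
    then have "h (w - a *\<^sub>R (c + k)) = w - a *\<^sub>R (c + k)" using hfix by (simp add: K_def)
    then have "h w = w - a *\<^sub>R (c + k) + a *\<^sub>R h (c + k)"
      unfolding linear_diff[OF lin] linear_cmul[OF lin] by (simp only: diff_eq_eq)
    then have "h w - a *\<^sub>R N b = w + a *\<^sub>R l" by (simp add: l_def algebra_simps)
    then show ?thesis by simp
  qed
  have K_sign: "e *\<^sub>R x \<in> K \<longleftrightarrow> x \<in> K" for x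
  proof -
    have "- x \<in> K \<longleftrightarrow> x \<in> K" by (metis subspace_neg[OF subspace_K] minus_minus)
    then show ?thesis using e by (elim disjE) simp_all
  qed
  define p' where "p' = (\<lambda>b. if e = 1 then p b + r b else - p b - r b - 1)"
  have half: "(a, e *\<^sub>R (w + a *\<^sub>R l)) \<in> half_space_cone ?c \<longleftrightarrow> (a, w) \<in> half_space_cone c" for a w
  proof -
    have "e *\<^sub>R (w + a *\<^sub>R l) - a *\<^sub>R ?c = e *\<^sub>R (w - a *\<^sub>R c)" unfolding c' by (simp add: algebra_simps)
    then show ?thesis using K_sign by (simp add: half_space_cone_def)
  qed
  have box: "(a, e *\<^sub>R (w + a *\<^sub>R l)) \<in> box_cone ?d p' \<longleftrightarrow> (a, w) \<in> box_cone ?d p" for a w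
  proof -
    have "(of_int (p' b) * a \<le> real ?d * coord B b (e *\<^sub>R (w + a *\<^sub>R l)) \<and>
        real ?d * coord B b (e *\<^sub>R (w + a *\<^sub>R l)) \<le> (of_int (p' b) + 1) * a) \<longleftrightarrow>
      (of_int (p b) * a \<le> real ?d * coord B b w \<and> real ?d * coord B b w \<le> (of_int (p b) + 1) * a)"
      if b: "b \<in> B" for b
    proof -
      have X: "real ?d * coord B b (e *\<^sub>R (w + a *\<^sub>R l)) = e * (real ?d * coord B b w + a * of_int (r b))"
        unfolding r[OF b, symmetric] by (simp add: coord_simps[OF lattice_basis] algebra_simps)
      show ?thesis
        unfolding X p'_def using e by (elim disjE) (auto simp: algebra_simps)
    qed
    then show ?thesis by (simp add: box_cone_def)
  qed
  have iff: "(a, e *\<^sub>R (w + a *\<^sub>R l)) \<in> cell ?c ?d p' \<longleftrightarrow> (a, w) \<in> cell c ?d p" for a w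
    using half box by (simp add: cell_def)
  have "(\<lambda>(a, w). (a, e *\<^sub>R (h w - a *\<^sub>R N b))) ` cell c ?d p = cell ?c ?d p'"
  proof (rule subset_antisym; rule subsetI)
    fix y assume "y \<in> (\<lambda>(a, w). (a, e *\<^sub>R (h w - a *\<^sub>R N b))) ` cell c ?d p"
    then obtain a w where y: "y = (a, e *\<^sub>R (h w - a *\<^sub>R N b))" "(a, w) \<in> cell c ?d p" by auto
    then have "w - a *\<^sub>R c \<in> K" by (simp add: cell_def half_space_cone_def)
    then show "y \<in> cell ?c ?d p'" using y iff move by simp
  next
    fix y assume y: "y \<in> cell ?c ?d p'"
    obtain a w' where y': "y = (a, w')" by fastforce
    define w where "w = e *\<^sub>R w' - a *\<^sub>R l"
    have w': "w' = e *\<^sub>R (w + a *\<^sub>R l)" using ee by (simp add: w_def)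
    then have w: "(a, w) \<in> cell c ?d p" using y iff by (simp add: y')
    then have "w - a *\<^sub>R c \<in> K" by (simp add: cell_def half_space_cone_def)
    from move[OF this] have "y = (a, e *\<^sub>R (h w - a *\<^sub>R N b))" by (simp only: y' w')
    then show "y \<in> (\<lambda>(a, w). (a, e *\<^sub>R (h w - a *\<^sub>R N b))) ` cell c ?d p"
      using w by (intro image_eqI[of _ _ "(a, w)"]) simp_all
  qed
  then show ?thesis using den_affine_move[OF h e b, of c] by (intro exI[of _ p']) simp
qed

text \<open>
  The cocycle \<open>z\<^sub>i = g\<^sup>i u - u\<close> takes values in one lattice \<open>(1/d) L\<close>, hence finitely many values modulo
  \<open>L\<close>. If \<open>z\<^sub>i\<close> and \<open>z\<^sub>j\<close> agree modulo \<open>L\<close>, then \<open>g\<^sup>i z\<^sub>j\<^sub>-\<^sub>i \<in> L\<close>, and \<open>g\<close> preserves \<open>L\<close>.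
\<close>
lemma return_to_lattice:
  assumes u: "N u \<in> qspace B"
  shows "\<exists>n>0. (g ^^ n) u - u \<in> L"
proof -
  define z where "z i = (g ^^ i) u - u" for i
  have "z 1 \<in> qspace B"
  proof -
    have funpow_one: "(g ^^ 1) u = g u" by simp
    have fact: "1 / fact (Suc k) \<in> (\<rat> :: real set)" for k
      by (metis Rats_1 Rats_divide Rats_of_nat of_nat_fact)
    have pow: "(N ^^ k) (N u) \<in> qspace B" for k by (induction k) (simp_all add: u N_qspace)
    then show ?thesis
      unfolding z_def funpow_one unip_minus_id[OF g_linear g_unipotent, of u]
      by (intro qspace_sum[OF lattice_basis] Q_closed(4) fact pow)
  qed
  then obtain d :: nat where d: "0 < d" "real d *\<^sub>R z 1 \<in> L"
    using qspace_common_denominator[OF lattice_basis, of "{z 1}"] by auto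
  have dz: "real d *\<^sub>R z i \<in> L" for i
  proof (induction i)
    case 0
    show ?case by (simp add: z_def L_closed)
  next
    case (Suc i)
    have "z (Suc i) = g (z i) + z 1" by (simp add: z_def linear_diff[OF g_linear])
    then have "real d *\<^sub>R z (Suc i) = g (real d *\<^sub>R z i) + real d *\<^sub>R z 1"
      by (simp add: linear_cmul[OF g_linear] scaleR_add_right)
    then show ?case using Suc d(2) g_lattice L_closed(2) by (metis imageI)
  qed
  define m where "m i b = \<lfloor>real d * coord B b (z i)\<rfloor>" for i b
  have m: "of_int (m i b) = real d * coord B b (z i)" if "b \<in> B" for i b
    using dz[of i] that unfolding m_def by (auto simp: zlattice_iff[OF lattice_basis] coord_simps[OF lattice_basis])
  \<comment> \<open>If the integral coordinates of \<open>d z\<^sub>i\<close> and \<open>d z\<^sub>j\<close> agree modulo \<open>d\<close>, then \<open>z\<^sub>i\<close> and \<open>z\<^sub>j\<close>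
    agree modulo \<open>L\<close>.\<close>
  define \<phi> where "\<phi> i = (\<lambda>b\<in>B. m i b mod int d)" for i
  have "\<phi> i \<in> PiE B (\<lambda>_. {0..<int d})" for i using d(1) by (auto simp: \<phi>_def)
  then have "range \<phi> \<subseteq> PiE B (\<lambda>_. {0..<int d})" by blast
  moreover have "finite (PiE B (\<lambda>_. {0..<int d}))" using lattice_basis_props(1)[OF lattice_basis] by (intro finite_PiE) auto
  ultimately have "finite (range \<phi>)" by (rule finite_subset)
  then have "\<not> inj \<phi>" using finite_imageD infinite_UNIV_nat by blast
  then obtain i j where ij: "i < j" "\<phi> i = \<phi> j"
    unfolding inj_def by (metis linorder_neqE_nat)
  have "coord B b (z j - z i) \<in> \<int>" if b: "b \<in> B" for b
  proof -
    have "m j b mod int d = m i b mod int d" using fun_cong[OF ij(2), of b] b by (simp add: \<phi>_def)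
    then obtain q where q: "m j b - m i b = int d * q" by (metis mod_eq_dvd_iff dvd_def)
    have "real d * coord B b (z j - z i) = of_int (m j b - m i b)"
      using m[OF b] by (simp add: coord_simps[OF lattice_basis] right_diff_distrib)
    also have "\<dots> = real d * of_int q" by (simp add: q)
    finally show ?thesis using d(1) by simp
  qed
  then have "z j - z i \<in> L" by (simp add: zlattice_iff[OF lattice_basis])
  moreover have "z j - z i = (g ^^ i) ((g ^^ (j - i)) u - u)"
  proof -
    have "(g ^^ j) u = (g ^^ i) ((g ^^ (j - i)) u)"
      using ij(1) by (metis funpow_apply_add le_add_diff_inverse less_imp_le)
    then show ?thesis by (simp add: z_def linear_diff[OF linear_funpow[OF g_linear]])
  qed
  moreover have "(g ^^ i) ` L = L" "inj (g ^^ i)"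
    using lattice_symmetry_funpow[OF lattice_symmetry_g, of i] by (auto simp: lattice_symmetry_def bij_def)
  ultimately have "(g ^^ (j - i)) u - u \<in> L" by (metis inj_image_mem_iff)
  then show ?thesis using ij(1) by (intro exI[of _ "j - i"]) simp
qed

text \<open>
  Conjugation by the shear \<open>(v, t) \<mapsto> (v + t u, t)\<close> reduces this to \<open>exp(n N) = g\<^sup>n\<close>.
\<close>
lemma nil_exp_endo:
  "nil_exp (endo (real n, real n *\<^sub>R N u)) (x, t) = ((g ^^ n) x + t *\<^sub>R ((g ^^ n) u - u), t)"
proof -
  let ?M = "endo (real n, real n *\<^sub>R N u)" let ?n = "\<lambda>v. real n *\<^sub>R N v"
  have nlin: "linear ?n" by (rule scaled_N_linear)
  obtain m where m: "\<And>v. (?n ^^ m) v = 0"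
    using nilpotent_scale[OF N_linear N_nilpotent, of "real n"] unfolding nilpotent_map_def by blast
  have step: "?M (x, t) = (?n (x + t *\<^sub>R u), 0)" for x t
    by (simp add: endo_apply N_simps algebra_simps)
  have pow: "(?M ^^ Suc k) (x, t) = ((?n ^^ Suc k) (x + t *\<^sub>R u), 0)" for k x t
    by (induction k) (simp_all add: step)
  have zero: "(?M ^^ Suc m) y = 0" for y
  proof -
    obtain x t where y: "y = (x, t)" by fastforce
    have "(?n ^^ Suc m) (x + t *\<^sub>R u) = 0" by (rule funpow_eq_0_mono[OF nlin m]) simp
    then show ?thesis unfolding y pow by (simp add: zero_prod_def)
  qed
  let ?y = "x + t *\<^sub>R u"
  define s where "s = (\<Sum>k<m. (1 / fact (Suc k)) *\<^sub>R (?n ^^ Suc k) ?y)"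
  have "(g ^^ n) ?y = nil_exp ?n ?y"
    by (rule nil_exp_scaled_unip_log[OF g_linear g_unipotent, symmetric])
  also have "\<dots> = (\<Sum>k<Suc m. fps_nth (fps_exp 1) k *\<^sub>R (?n ^^ k) ?y)"
    unfolding nil_exp_eq_fps_at by (rule fps_at_eq[OF nlin]) (rule funpow_eq_0_mono[OF nlin m], simp)
  also have "\<dots> = ?y + s"
    unfolding s_def by (subst sum.lessThan_Suc_shift) (simp del: funpow.simps fact_Suc)
  finally have gy: "(g ^^ n) ?y = ?y + s" .
  have "nil_exp ?M (x, t) = (\<Sum>k<Suc m. fps_nth (fps_exp 1) k *\<^sub>R (?M ^^ k) (x, t))"
    unfolding nil_exp_eq_fps_at by (rule fps_at_eq[OF endo_linear zero])
  also have "\<dots> = (x, t) + (\<Sum>k<m. (1 / fact (Suc k)) *\<^sub>R ((?n ^^ Suc k) ?y, 0))"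
    by (subst sum.lessThan_Suc_shift) (simp add: pow del: funpow.simps fact_Suc scaleR_Pair)
  also have "(\<Sum>k<m. (1 / fact (Suc k)) *\<^sub>R ((?n ^^ Suc k) ?y, 0)) = (s, 0::real)"
    unfolding s_def by (simp add: prod_eq_iff fst_sum snd_sum del: funpow.simps fact_Suc)
  also have "s = (g ^^ n) ?y - ?y" using gy by simp
  finally show ?thesis
    by (simp add: linear_add[OF linear_funpow[OF g_linear]] linear_cmul[OF linear_funpow[OF g_linear]] algebra_simps)
qed

lemma nil_exp_endo_in_Gamma:
  assumes z: "(g ^^ n) u - u \<in> L"
  shows "nil_exp (endo (real n, real n *\<^sub>R N u)) \<in> Gamma_H B form g"
proof -
  let ?\<gamma> = "nil_exp (endo (real n, real n *\<^sub>R N u))" let ?h = "g ^^ n"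
  define z where "z = ?h u - u"
  have zL: "z \<in> L" using assms by (simp add: z_def)
  have \<gamma>: "?\<gamma> (x, t) = (?h x + t *\<^sub>R z, t)" for x t by (simp add: nil_exp_endo z_def)
  have sym: "lattice_symmetry ?h" by (rule lattice_symmetry_funpow[OF lattice_symmetry_g])
  have hlin: "linear ?h" and hbij: "bij ?h" and hL: "?h ` L = L" using sym by (auto simp: lattice_symmetry_def)
  let ?i = "inverse_map ?h"
  have ilin: "linear ?i" and iL: "?i ` L = L"
    using lattice_symmetry_inv[OF sym] by (auto simp: lattice_symmetry_def)
  have hi: "?h (?i x) = x" "?i (?h x) = x" for x using hbij by (simp_all add: bij_def surj_f_inv_f)
  define \<delta> where "\<delta> = (\<lambda>(x, t). (?i (x - t *\<^sub>R z), t :: real))"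
  have \<gamma>\<delta>: "?\<gamma> (\<delta> y) = y" and \<delta>\<gamma>: "\<delta> (?\<gamma> y) = y" for y
    by (cases y; simp add: \<gamma> \<delta>_def hi)+
  have "linear ?\<gamma>"
    unfolding nil_exp_eq_fps_at by (rule linear_fps_at[OF endo_linear])
  moreover have "bij ?\<gamma>" by (rule o_bij[of \<delta>]) (auto simp: \<gamma>\<delta> \<delta>\<gamma>)
  moreover have "?\<gamma> ` H_int B = H_int B"
  proof -
    have 1: "?\<gamma> y \<in> H_int B" if yH: "y \<in> H_int B" for y
    proof -
      obtain x t where y: "y = (x, t)" "x \<in> L" "t \<in> \<int>" using yH unfolding H_int_def by (elim SigmaE)
      have "?h x + t *\<^sub>R z \<in> L" using y hL by (intro L_closed(2) L_closed(5) zL) auto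
      then show ?thesis using y by (simp add: \<gamma> H_int_def)
    qed
    have 2: "\<delta> y \<in> H_int B" if yH: "y \<in> H_int B" for y
    proof -
      obtain x t where y: "y = (x, t)" "x \<in> L" "t \<in> \<int>" using yH unfolding H_int_def by (elim SigmaE)
      have "x - t *\<^sub>R z \<in> L" using y by (intro L_closed(3) L_closed(5) zL) auto
      then have "?i (x - t *\<^sub>R z) \<in> L" using iL by blast
      then show ?thesis using y by (simp add: \<delta>_def H_int_def)
    qed
    show ?thesis using 1 2 \<gamma>\<delta> by (metis (no_types, lifting) image_eqI image_subsetI subsetI subset_antisym)
  qed
  moreover have "?\<gamma> ` W k = W k" for k
  proof -
    have s: "snd (?\<gamma> y) = snd y" "snd (\<delta> y) = snd y" for y by (cases y; simp add: \<gamma> \<delta>_def)+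
    have z: "?\<gamma> 0 = 0" "\<delta> 0 = 0"
      by (simp_all add: zero_prod_def \<gamma> \<delta>_def linear_0[OF hlin] linear_0[OF ilin])
    have 1: "?\<gamma> y \<in> W k" if "y \<in> W k" for y using that s z unfolding mem_W_iff by metis
    have 2: "\<delta> y \<in> W k" if "y \<in> W k" for y using that s z unfolding mem_W_iff by metis
    show ?thesis using 1 2 \<gamma>\<delta> by (metis (no_types, lifting) image_eqI image_subsetI subsetI subset_antisym)
  qed
  moreover have "gr_0 ?\<gamma> a = a" for a by (simp add: gr_0_def \<gamma>)
  moreover have gr1: "gr_minus1 ?\<gamma> = ?h" by (simp add: gr_minus1_def fun_eq_iff \<gamma>)
  moreover have "form (?h x) (?h y) = form x y" for x y by (induction n) (simp_all add: g_form)
  ultimately have "?\<gamma> \<in> G_int B form" by (simp add: G_int_def)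
  then show ?thesis unfolding Gamma_H_def gr1 Gamma_H'_def mem_Collect_eq using gr1 by auto
qed

end

section \<open>The fan\<close>

context unipotent_lattice
begin

text \<open>
  All boxes over all cosets \<open>c + K\<close> in the image of \<open>N\<close> that have a rational point, which is taken
  as the representative \<open>c\<close>.
\<close>
definition full_cells :: "'v endo set set" where
  "full_cells = {endo ` cell c (den c) p | c p. c \<in> range N \<and> c \<in> qspace B}"

definition coset_fan :: "'v endo set set" where
  "coset_fan = {F. \<exists>P\<in>full_cells. extreme_subcone F P}"

lemma full_cellsE:
  assumes "P \<in> full_cells"
  obtains c p where "P = endo ` cell c (den c) p" "c \<in> range N" "c \<in> qspace B"
  using assms unfolding full_cells_def mem_Collect_eq by (elim exE conjE)

lemma full_cellsI: "c \<in> range N \<Longrightarrow> c \<in> qspace B \<Longrightarrow> endo ` cell c (den c) p \<in> full_cells"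
  unfolding full_cells_def by blast

lemma convex_cone_full_cell: "P \<in> full_cells \<Longrightarrow> convex_cone P"
  by (elim full_cellsE) (simp add: convex_cone_linear_image linear_endo convex_cone_cell)

lemma fan_coset_fan:
  assumes nz: "\<exists>v. N v \<noteq> 0" shows "fan B form coset_fan"
  unfolding coset_fan_def
proof (rule fan_of_faces)
  have "0 \<in> range N" using N_simps(1) by (metis rangeI)
  then show "full_cells \<noteq> {}" using full_cellsI[of 0] Q_closed(1) by blast
next
  fix P assume "P \<in> full_cells"
  then obtain c p where P: "P = endo ` cell c (den c) p" and c: "c \<in> range N" "c \<in> qspace B" by (rule full_cellsE)
  obtain S where S: "finite S" "S \<subseteq> rational_points" "convex_cone hull S = cell c (den c) p"
    using cell_rational[OF c, of "den c" p] by (elim exE conjE)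
  have "S \<subseteq> ray_cone c"
    using hull_subset[of S convex_cone] S(3) cell_subset_ray_cone[OF den_pos[OF c(2)]] by blast
  then show "rational_nilpotent_cone B form P"
    using rational_nilpotent_cone_endo[OF nz S(1,2)] S(3) P by simp
next
  fix P Q assume "P \<in> full_cells" "Q \<in> full_cells"
  from this(1) obtain c p where "c \<in> range N" and P: "P = endo ` cell c (den c) p" "c \<in> qspace B"
    by (elim full_cellsE)
  from \<open>Q \<in> full_cells\<close> obtain c' p' where "c' \<in> range N" and Q: "Q = endo ` cell c' (den c') p'" "c' \<in> qspace B"
    by (elim full_cellsE)
  have "P \<inter> Q = endo ` (cell c (den c) p \<inter> cell c' (den c') p')"
    unfolding P Q by (rule image_Int[OF endo_inj[OF nz], symmetric])
  then show "extreme_subcone (P \<inter> Q) P"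
    using extreme_subcone_linear_image[OF linear_endo endo_inj[OF nz] cell_Int_extreme[OF P(2) Q(2)]] P(1) by simp
qed

lemma coset_fan_admissible:
  assumes nz: "\<exists>v. N v \<noteq> 0" and \<sigma>: "\<sigma> \<in> coset_fan"
  shows "admissible \<sigma> \<and> restricts_into_ray N \<sigma>"
proof -
  obtain P where P: "P \<in> full_cells" "extreme_subcone \<sigma> P" using \<sigma> unfolding coset_fan_def by blast
  obtain c p where Pc: "P = endo ` cell c (den c) p" and c: "c \<in> range N" "c \<in> qspace B" by (rule full_cellsE[OF P(1)])
  have "convex_cone \<sigma>" "\<sigma> \<subseteq> P" using P(2) by (auto simp: extreme_subcone_def)
  moreover have "P \<subseteq> endo ` ray_cone c"
    unfolding Pc by (rule image_mono[OF cell_subset_ray_cone[OF den_pos[OF c(2)]]])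
  ultimately show ?thesis using admissible_ray[OF nz c(1)] by blast
qed

lemma coset_fan_compatible: "compatible (Gamma_H B form g) coset_fan"
  unfolding compatible_def
proof (intro ballI)
  fix \<gamma> \<sigma> assume \<gamma>: "\<gamma> \<in> Gamma_H B form g" and \<sigma>: "\<sigma> \<in> coset_fan"
  obtain h b e where h: "lattice_symmetry h" and b: "b \<in> L" and e: "e = 1 \<or> e = -1"
    and lin: "linear \<gamma>" and bij: "bij \<gamma>" and all: "\<forall>v t. \<gamma> (v, t) = (h v + t *\<^sub>R b, e * t)"
    using Gamma_H_form[OF \<gamma>] by (elim exE conjE)
  from all have eq: "\<gamma> (v, t) = (h v + t *\<^sub>R b, e * t)" for v t by blast
  let ?Ad = "\<lambda>M. \<gamma> \<circ> M \<circ> inverse_map \<gamma>"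
  have Ad: "linear ?Ad"
    by (rule linearI) (simp_all add: fun_eq_iff scaleR_fun_def linear_add[OF lin] linear_cmul[OF lin])
  have inv: "inverse_map \<gamma> (\<gamma> x) = x" for x using bij by (simp add: bij_def)
  have inj: "inj ?Ad"
  proof (rule injI)
    fix M M' assume "?Ad M = ?Ad M'"
    then have "\<gamma> (M (inverse_map \<gamma> (\<gamma> x))) = \<gamma> (M' (inverse_map \<gamma> (\<gamma> x)))" for x
      by (metis comp_apply)
    then have "M x = M' x" for x using bij by (simp add: inv bij_def inj_eq)
    then show "M = M'" by blast
  qed
  obtain P where P: "P \<in> full_cells" "extreme_subcone \<sigma> P" using \<sigma> unfolding coset_fan_def by blast
  obtain c p where Pc: "P = endo ` cell c (den c) p" and c: "c \<in> range N" "c \<in> qspace B" by (rule full_cellsE[OF P(1)])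
  let ?c = "affine_move e h b c" let ?m = "\<lambda>(a, w). (a, e *\<^sub>R (h w - a *\<^sub>R N b))"
  obtain p' where p': "?m ` cell c (den c) p = cell ?c (den ?c) p'"
    using cell_affine_move[OF h e b c(2)] by blast
  have "?Ad (endo x) = endo (?m x)" for x
    using conjugate_endo[OF h e bij eq] by (cases x) simp
  then have "?Ad ` endo ` cell c (den c) p = endo ` ?m ` cell c (den c) p" unfolding image_image by simp
  then have "?Ad ` P = endo ` cell ?c (den ?c) p'" unfolding Pc p' .
  then have "?Ad ` P \<in> full_cells"
    using full_cellsI[OF affine_move_range[OF h c(1)] affine_move_qspace[OF h e b c(2)]] by simp
  moreover have "extreme_subcone (?Ad ` \<sigma>) (?Ad ` P)"
    by (rule extreme_subcone_linear_image[OF Ad inj P(2)])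
  ultimately show "?Ad ` \<sigma> \<in> coset_fan" unfolding coset_fan_def by blast
qed

lemma multiple_in_Gamma:
  assumes p: "p \<in> rational_points" "p \<in> ray_cone c" and c: "c \<in> range N"
  shows "\<exists>r>0. nil_exp (r *\<^sub>R endo p) \<in> Gamma_H B form g"
proof -
  obtain a w where aw: "p = (a, w)" by fastforce
  obtain u where u: "w = a *\<^sub>R N u" using ray_cone_range[OF c] p(2) aw by blast
  show ?thesis
  proof (cases "a = 0")
    case True
    then have "endo p = endo (real 0, real 0 *\<^sub>R N u)" using u aw by simp
    moreover have "(g ^^ 0) u - u \<in> L" by (simp add: L_closed)
    then have "nil_exp (endo (real 0, real 0 *\<^sub>R N u)) \<in> Gamma_H B form g" by (rule nil_exp_endo_in_Gamma)
    ultimately show ?thesis by (intro exI[of _ 1]) simp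
  next
    case False
    then have a: "0 < a" using p(2) by (simp add: aw ray_cone_def)
    have "a \<in> \<rat>" "w \<in> qspace B" using p(1) by (auto simp: aw rational_points_def)
    then have "(1 / a) *\<^sub>R w \<in> qspace B" by (intro Q_closed(4)) auto
    then have "N u \<in> qspace B" using False by (simp add: u)
    then obtain n where n: "0 < n" "(g ^^ n) u - u \<in> L" using return_to_lattice by blast
    have "(real n / a) *\<^sub>R endo p = endo ((real n / a) *\<^sub>R p)" by (simp add: linear_cmul[OF linear_endo])
    also have "(real n / a) *\<^sub>R p = (real n, real n *\<^sub>R N u)" using False by (simp add: aw u)
    finally show ?thesis
      using nil_exp_endo_in_Gamma[OF n(2)] n(1) a by (intro exI[of _ "real n / a"]) simp
  qed
qed

lemma coset_fan_strongly_compatible: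
  assumes nz: "\<exists>v. N v \<noteq> 0" shows "strongly_compatible (Gamma_H B form g) coset_fan"
  unfolding strongly_compatible_def
proof (intro conjI ballI)
  show "compatible (Gamma_H B form g) coset_fan" by (rule coset_fan_compatible)
next
  fix \<sigma> M assume \<sigma>: "\<sigma> \<in> coset_fan" and M: "M \<in> \<sigma>"
  obtain P where P: "P \<in> full_cells" "extreme_subcone \<sigma> P" using \<sigma> unfolding coset_fan_def by blast
  obtain c p where Pc: "P = endo ` cell c (den c) p" and c: "c \<in> range N" "c \<in> qspace B" by (rule full_cellsE[OF P(1)])
  have cc: "convex_cone \<sigma>" using P(2) by (simp add: extreme_subcone_def)
  have sub: "\<sigma> \<subseteq> endo ` ray_cone c"
    using P(2) image_mono[OF cell_subset_ray_cone[OF den_pos[OF c(2)]], of endo c p] unfolding extreme_subcone_def Pc by blast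
  have "rational_nilpotent_cone B form \<sigma>" using fan_coset_fan[OF nz] \<sigma> by (simp add: fan_def)
  then obtain S where S: "finite S" "S \<subseteq> lie_g_rat B form" "\<sigma> = convex_cone hull S"
    unfolding rational_nilpotent_cone_def by metis
  have S\<sigma>: "s \<in> \<sigma>" if "s \<in> S" for s unfolding S(3) by (rule hull_inc[OF that])
  have "\<exists>r>0. nil_exp (r *\<^sub>R s) \<in> Gamma_H B form g" if s: "s \<in> S" for s
  proof -
    obtain x where x: "s = endo x" "x \<in> ray_cone c" using S\<sigma>[OF s] sub by (metis imageE subsetD)
    have "x \<in> rational_points"
      using endo_lie_g_rat_D[OF nz] S(2) s x(1) unfolding rational_points_def by blast
    then show ?thesis using multiple_in_Gamma x c(1) by blast
  qed
  then obtain r where r: "\<And>s. s \<in> S \<Longrightarrow> 0 < r s" "\<And>s. s \<in> S \<Longrightarrow> nil_exp (r s *\<^sub>R s) \<in> Gamma_H B form g"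
    by metis
  let ?S = "(\<lambda>s. r s *\<^sub>R s) ` S"
  obtain a where a: "M = (\<Sum>s\<in>S. a s *\<^sub>R s)" "\<forall>s\<in>S. 0 \<le> a s"
    using mem_convex_cone_hull_finite[OF S(1) M[unfolded S(3)]] by (elim exE conjE)
  have "M = (\<Sum>s\<in>S. (a s / r s) *\<^sub>R (r s *\<^sub>R s))"
    unfolding a(1)
  proof (intro sum.cong refl)
    fix s assume "s \<in> S"
    then show "a s *\<^sub>R s = (a s / r s) *\<^sub>R (r s *\<^sub>R s)" using r(1)[of s] by simp
  qed
  also have "\<dots> \<in> convex_cone hull ?S"
    using a(2) r(1) by (intro convex_cone_sum[OF convex_cone_convex_cone_hull] hull_inc divide_nonneg_pos) auto
  finally have "M \<in> convex_cone hull ?S" .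
  from mem_convex_cone_hull_finite[OF finite_imageI[OF S(1)] this]
  obtain a' where a': "M = (\<Sum>s\<in>?S. a' s *\<^sub>R s)" "\<forall>s\<in>?S. 0 \<le> a' s" by (elim exE conjE)
  have "?S \<subseteq> {N' \<in> \<sigma>. nil_exp N' \<in> Gamma_H B form g}"
  proof (rule image_subsetI)
    fix s assume s: "s \<in> S"
    have "r s *\<^sub>R s \<in> \<sigma>" using r(1)[OF s] by (intro convex_cone_scaleR[OF cc _ S\<sigma>[OF s]]) simp
    then show "r s *\<^sub>R s \<in> {N' \<in> \<sigma>. nil_exp N' \<in> Gamma_H B form g}" using r(2)[OF s] by simp
  qed
  then show "\<exists>S a. finite S \<and> S \<subseteq> {N' \<in> \<sigma>. nil_exp N' \<in> Gamma_H B form g} \<and>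
      (\<forall>N'\<in>S. a N' \<ge> (0::real)) \<and> M = (\<Sum>N'\<in>S. a N' *\<^sub>R N')"
    by (intro exI[of _ ?S] exI[of _ a'] conjI) (use S(1) a' in \<open>simp_all only: finite_imageI\<close>)
qed

lemma hull_commute:
  assumes lin: "\<And>M. M \<in> S \<Longrightarrow> linear M" and comm: "\<And>M M'. M \<in> S \<Longrightarrow> M' \<in> S \<Longrightarrow> M \<circ> M' = M' \<circ> M"
    and M: "M \<in> convex_cone hull S" "M' \<in> convex_cone hull S"
  shows "M \<circ> M' = M' \<circ> (M :: 'v endo)"
proof -
  have cc: "convex_cone {M. \<forall>M'\<in>T. M \<circ> M' = M' \<circ> M}" if T: "\<And>M'. M' \<in> T \<Longrightarrow> linear M'" for T :: "'v endo set"
    unfolding convex_cone_iff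
    by (auto simp: fun_eq_iff scaleR_fun_def linear_0[OF T] linear_add[OF T] linear_cmul[OF T])
  have 1: "convex_cone hull S \<subseteq> {M. \<forall>M'\<in>S. M \<circ> M' = M' \<circ> M}"
  proof (rule hull_minimal)
    show "S \<subseteq> {M. \<forall>M'\<in>S. M \<circ> M' = M' \<circ> M}" using comm by blast
    show "convex_cone {M. \<forall>M'\<in>S. M \<circ> M' = M' \<circ> M}" by (rule cc[OF lin])
  qed
  have lin': "linear M" if "M \<in> convex_cone hull S" for M
  proof -
    have "convex_cone (Collect (linear :: 'v endo \<Rightarrow> bool))"
      unfolding convex_cone_iff
    proof (intro conjI ballI allI impI)
      show "0 \<in> Collect (linear :: 'v endo \<Rightarrow> bool)" by (auto intro!: linearI)
      show "M + M' \<in> Collect linear" if "M \<in> Collect linear" "M' \<in> Collect linear" for M M' :: "'v endo"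
        using linear_compose_add[of M M'] that by (simp add: plus_fun_def)
      show "c *\<^sub>R M \<in> Collect linear" if "M \<in> Collect linear" for c and M :: "'v endo"
        using linear_compose_scale_right[of M c] that by (simp add: scaleR_fun_def)
    qed
    then have "convex_cone hull S \<subseteq> Collect linear" using lin by (intro hull_minimal) auto
    then show ?thesis using that by blast
  qed
  have "convex_cone hull S \<subseteq> {M. \<forall>M'\<in>convex_cone hull S. M \<circ> M' = M' \<circ> M}"
  proof (rule hull_minimal)
    show "convex_cone {M. \<forall>M'\<in>convex_cone hull S. M \<circ> M' = M' \<circ> M}" by (rule cc[OF lin'])
    show "S \<subseteq> {M. \<forall>M'\<in>convex_cone hull S. M \<circ> M' = M' \<circ> M}"
    proof (intro subsetI CollectI ballI)
      fix M M' assume "M \<in> S" "M' \<in> convex_cone hull S"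
      then show "M \<circ> M' = M' \<circ> M" using 1 by (metis (mono_tags, lifting) mem_Collect_eq subsetD)
    qed
  qed
  then show ?thesis using M by blast
qed

lemma rational_nilpotent_cone_commute:
  assumes \<sigma>: "rational_nilpotent_cone B form \<sigma>" and M: "M \<in> \<sigma>" "M' \<in> \<sigma>"
  shows "M \<circ> M' = M' \<circ> M"
proof -
  obtain S where S: "S \<subseteq> lie_g form" "\<forall>N\<in>S. \<forall>N'\<in>S. N \<circ> N' = N' \<circ> N" "\<sigma> = convex_cone hull S"
    using \<sigma> unfolding rational_nilpotent_cone_def nilpotent_cone_def by metis
  show ?thesis
  proof (rule hull_commute)
    show "linear M" if "M \<in> S" for M using S(1) that by (auto simp: lie_g_def)
    show "M \<circ> M' = M' \<circ> M" if "M \<in> S" "M' \<in> S" for M M' using S(2) that by blast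
    show "M \<in> convex_cone hull S" "M' \<in> convex_cone hull S" using M S(3) by simp_all
  qed
qed

lemma admissible_element:
  assumes M: "M \<in> lie_g form" and F: "is_relative_filtration M F"
    and ray: "\<exists>a\<ge>0. \<forall>u. M (u, 0) = (a *\<^sub>R N u, 0)"
  shows "\<exists>a u. 0 \<le> a \<and> M = endo (a, a *\<^sub>R N u)"
proof -
  obtain a where a: "0 \<le> a" "\<And>u. M (u, 0) = (a *\<^sub>R N u, 0)" using ray by blast
  have eq: "M = endo (a, fst (M (0, 1)))" by (rule endo_of_restriction[OF M a(2)])
  obtain u where "fst (M (0, 1)) = a *\<^sub>R N u"
    using relative_filtration_endo[of a "fst (M (0, 1))" F] F eq by metis
  then show ?thesis using a(1) eq by metis
qed

text \<open>
  All generators are of the form \<open>(a, a N u)\<close>. The slope of one of them with \<open>a > 0\<close> serves as \<open>c\<close>;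
  it is rational, and commutativity puts the slopes of the other ones into \<open>c + K\<close>.
\<close>
lemma admissible_cone_in_ray:
  assumes nz: "\<exists>v. N v \<noteq> 0" and \<sigma>: "rational_nilpotent_cone B form \<sigma>" "admissible \<sigma>" "restricts_into_ray N \<sigma>"
  shows "\<exists>c S. c \<in> range N \<and> c \<in> qspace B \<and> finite S \<and> S \<subseteq> rational_points \<and> S \<subseteq> ray_cone c \<and>
    \<sigma> = endo ` (convex_cone hull S)"
proof -
  obtain T where T: "finite T" "T \<subseteq> lie_g_rat B form" "\<sigma> = convex_cone hull T"
    using \<sigma>(1) unfolding rational_nilpotent_cone_def by metis
  have T\<sigma>: "M \<in> \<sigma>" if "M \<in> T" for M unfolding T(3) by (rule hull_inc[OF that])
  have "\<exists>p. M = endo p \<and> 0 \<le> fst p \<and> p \<in> rational_points \<and> (\<exists>u. snd p = fst p *\<^sub>R N u)" if M: "M \<in> T" for M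
  proof -
    have "M \<in> lie_g form" using T(2) M by (auto simp: lie_g_rat_def)
    moreover obtain F where "is_relative_filtration M F"
      using \<sigma>(2) T\<sigma>[OF M] unfolding admissible_def by blast
    moreover have "\<exists>a\<ge>0. \<forall>u. M (u, 0) = (a *\<^sub>R N u, 0)"
      using \<sigma>(3) T\<sigma>[OF M] unfolding restricts_into_ray_def by blast
    ultimately obtain a u where au: "0 \<le> a" "M = endo (a, a *\<^sub>R N u)" using admissible_element by blast
    then have "(a, a *\<^sub>R N u) \<in> rational_points"
      using endo_lie_g_rat_D[OF nz, of "(a, a *\<^sub>R N u)"] T(2) M unfolding rational_points_def by blast
    then show ?thesis using au by (intro exI[of _ "(a, a *\<^sub>R N u)"]) auto
  qed
  then obtain f where f: "\<And>M. M \<in> T \<Longrightarrow> M = endo (f M)" "\<And>M. M \<in> T \<Longrightarrow> 0 \<le> fst (f M)"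
    "\<And>M. M \<in> T \<Longrightarrow> f M \<in> rational_points" "\<And>M. M \<in> T \<Longrightarrow> \<exists>u. snd (f M) = fst (f M) *\<^sub>R N u" by metis
  let ?S = "f ` T"
  have "endo ` ?S = T" using f(1) by (force simp: image_image)
  then have \<sigma>S: "\<sigma> = endo ` (convex_cone hull ?S)"
    unfolding T(3) convex_cone_hull_linear_image[OF linear_endo, symmetric] by simp
  have S: "?S \<subseteq> rational_points" using f(3) by blast
  have zero: "snd p = 0" if "p \<in> ?S" "fst p = 0" for p using f(4) that by (metis imageE scaleR_zero_left)
  obtain c where c: "c \<in> range N" "c \<in> qspace B" "?S \<subseteq> ray_cone c"
  proof (cases "\<exists>M\<in>T. fst (f M) \<noteq> 0")
    case True
    then obtain M0 where M0: "M0 \<in> T" "fst (f M0) \<noteq> 0" by blast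
    obtain u0 where u0: "snd (f M0) = fst (f M0) *\<^sub>R N u0" using f(4) M0(1) by blast
    obtain a0 where a0: "f M0 = (a0, a0 *\<^sub>R N u0)" "a0 \<noteq> 0" using u0 M0(2) by (metis prod.collapse)
    have "a0 \<in> \<rat>" "a0 *\<^sub>R N u0 \<in> qspace B" using f(3)[OF M0(1)] by (auto simp: a0 rational_points_def)
    then have "(1 / a0) *\<^sub>R (a0 *\<^sub>R N u0) \<in> qspace B" by (intro Q_closed(4)[OF _ \<open>a0 *\<^sub>R N u0 \<in> qspace B\<close>]) simp
    then have q: "N u0 \<in> qspace B" using a0(2) by simp
    have "f M \<in> ray_cone (N u0)" if M: "M \<in> T" for M
    proof -
      obtain a u where a: "f M = (a, a *\<^sub>R N u)" "0 \<le> a" using f(2,4)[OF M] by (metis prod.collapse)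
      have "endo (a0, a0 *\<^sub>R N u0) \<circ> endo (a, a *\<^sub>R N u) = endo (a, a *\<^sub>R N u) \<circ> endo (a0, a0 *\<^sub>R N u0)"
        using rational_nilpotent_cone_commute[OF \<sigma>(1) T\<sigma>[OF M0(1)] T\<sigma>[OF M]]
        unfolding f(1)[OF M0(1), unfolded a0(1), symmetric] f(1)[OF M, unfolded a(1), symmetric] .
      then have "N (a0 *\<^sub>R (a *\<^sub>R N u) - a *\<^sub>R (a0 *\<^sub>R N u0)) = 0" by (rule endo_commute_D)
      then have "a0 *\<^sub>R N (a *\<^sub>R N u - a *\<^sub>R N u0) = 0" by (simp add: N_simps algebra_simps)
      then have "N (a *\<^sub>R N u - a *\<^sub>R N u0) = 0" using a0(2) by simp
      moreover have "a *\<^sub>R N u - a *\<^sub>R N u0 = N (a *\<^sub>R u - a *\<^sub>R u0)" by (simp add: N_simps)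
      ultimately have "a *\<^sub>R N u - a *\<^sub>R N u0 \<in> K" unfolding K_def by blast
      then show ?thesis using a by (simp add: ray_cone_def)
    qed
    then show ?thesis using that[of "N u0"] q by blast
  next
    case False
    have "f M = 0" if "M \<in> T" for M
      using False that zero[of "f M"] by (auto simp: prod_eq_iff)
    then have "?S \<subseteq> ray_cone 0" using convex_cone_contains_0[OF convex_cone_ray_cone] by auto
    moreover have "0 \<in> range N" using N_simps(1) by (metis rangeI)
    ultimately show ?thesis using that[of 0] Q_closed(1) by blast
  qed
  then show ?thesis using T(1) S \<sigma>S by (intro exI[of _ c] exI[of _ ?S]) auto
qed

text \<open>
  Only \<open>0\<close> lies over \<open>a = 0\<close>, so the slopes of the finitely many nonzero generators bound all slopes.
\<close>
lemma bounded_slopes: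
  assumes S: "finite S" "S \<subseteq> ray_cone c"
  shows "\<exists>m::nat. \<forall>x\<in>convex_cone hull S. \<forall>b\<in>B. \<bar>real d * coord B b (snd x)\<bar> \<le> real m * fst x"
proof -
  let ?f = "\<lambda>(x, b). \<bar>real d * coord B b (snd x)\<bar> / fst x"
  have fin: "finite (S \<times> B)" using S(1) lattice_basis_props(1)[OF lattice_basis] by simp
  have nonneg: "0 \<le> fst x" if "x \<in> S" for x using S(2) that by (auto simp: ray_cone_def)
  obtain m :: nat where m: "(\<Sum>i\<in>S \<times> B. ?f i) \<le> real m" using real_arch_simple by blast
  let ?C = "{x. \<forall>b\<in>B. \<bar>real d * coord B b (snd x)\<bar> \<le> real m * fst x}"
  have "S \<subseteq> ?C"
  proof (intro subsetI CollectI ballI)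
    fix x b assume x: "x \<in> S" and b: "b \<in> B"
    show "\<bar>real d * coord B b (snd x)\<bar> \<le> real m * fst x"
    proof (cases "fst x = 0")
      case True
      then have "snd x = 0" using S(2) x by (auto simp: ray_cone_def)
      then show ?thesis using True by (simp add: linear_0[OF linear_coord[OF lattice_basis]])
    next
      case False
      have "?f (x, b) \<le> (\<Sum>i\<in>S \<times> B. ?f i)"
        by (rule member_le_sum[OF _ _ fin]) (use x b nonneg in \<open>auto intro!: divide_nonneg_nonneg\<close>)
      then have "\<bar>real d * coord B b (snd x)\<bar> / fst x \<le> real m" using m by simp
      then show ?thesis using False nonneg[OF x] by (simp add: pos_divide_le_eq)
    qed
  qed
  moreover have "convex_cone ?C"
    unfolding convex_cone_iff
  proof (intro conjI ballI allI impI)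
    show "0 \<in> ?C" by (simp add: linear_0[OF linear_coord[OF lattice_basis]])
    show "x + y \<in> ?C" if xy: "x \<in> ?C" "y \<in> ?C" for x y
    proof (intro CollectI ballI)
      fix b assume b: "b \<in> B"
      have "\<bar>real d * coord B b (snd (x + y))\<bar> \<le> \<bar>real d * coord B b (snd x)\<bar> + \<bar>real d * coord B b (snd y)\<bar>"
        by (simp add: coord_simps[OF lattice_basis] distrib_left abs_triangle_ineq)
      also have "\<dots> \<le> real m * fst x + real m * fst y" using xy b by (intro add_mono) auto
      finally show "\<bar>real d * coord B b (snd (x + y))\<bar> \<le> real m * fst (x + y)" by (simp add: distrib_left)
    qed
    show "r *\<^sub>R x \<in> ?C" if x: "x \<in> ?C" and r: "0 \<le> r" for x and r :: real
    proof (intro CollectI ballI)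
      fix b assume b: "b \<in> B"
      have "\<bar>real d * coord B b (snd (r *\<^sub>R x))\<bar> = r * \<bar>real d * coord B b (snd x)\<bar>"
        using r by (simp add: coord_simps[OF lattice_basis] abs_mult)
      also have "\<dots> \<le> r * (real m * fst x)" using x b r by (intro mult_left_mono) auto
      finally show "\<bar>real d * coord B b (snd (r *\<^sub>R x))\<bar> \<le> real m * fst (r *\<^sub>R x)" by (simp add: mult_ac)
    qed
  qed
  ultimately have "convex_cone hull S \<subseteq> ?C" by (rule hull_minimal)
  then show ?thesis by blast
qed

lemma finite_faces_hull:
  assumes "finite S" shows "finite {F. extreme_subcone F (convex_cone hull S)}"
proof (rule finite_subset)
  show "{F. extreme_subcone F (convex_cone hull S)} \<subseteq> (\<lambda>A. convex_cone hull A) ` Pow S"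
  proof (intro subsetI)
    fix F assume "F \<in> {F. extreme_subcone F (convex_cone hull S)}"
    then have "F = convex_cone hull (S \<inter> F)" using extreme_subcone_hull[OF assms] by blast
    then show "F \<in> (\<lambda>A. convex_cone hull A) ` Pow S" by (rule image_eqI) blast
  qed
qed (use assms in simp)

text \<open>
  The pieces are the intersections with those boxes that slopes below the bound can reach, together
  with all their faces.
\<close>
lemma subdivision_exists:
  assumes nz: "\<exists>v. N v \<noteq> 0" and c: "c \<in> range N" "c \<in> qspace B"
    and S: "finite S" "S \<subseteq> rational_points" "S \<subseteq> ray_cone c"
  shows "\<exists>T. finite_subdivision B form (endo ` (convex_cone hull S)) T \<and> (\<forall>\<sigma>\<in>T. \<exists>\<tau>\<in>coset_fan. \<sigma> \<subseteq> \<tau>)"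
proof -
  let ?d = "den c" let ?H = "convex_cone hull S"
  have fin: "finite B" using lattice_basis_props(1)[OF lattice_basis] .
  have Hray: "?H \<subseteq> ray_cone c" by (rule hull_minimal) (rule S(3), rule convex_cone_ray_cone)
  obtain m :: nat where m: "\<forall>x\<in>?H. \<forall>b\<in>B. \<bar>real ?d * coord B b (snd x)\<bar> \<le> real m * fst x"
    using bounded_slopes[OF S(1,3)] by blast
  \<comment> \<open>A box depends only on the values of \<open>p\<close> on \<open>B\<close>; fixing \<open>p\<close> outside \<open>B\<close> makes the index set finite.\<close>
  define I where "I = PiE B (\<lambda>_. {- int m..int m})"
  have finI: "finite I" unfolding I_def using fin by (intro finite_PiE) auto
  define PP where "PP = (\<lambda>p. endo ` (?H \<inter> cell c ?d p)) ` I"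
  define T where "T = {F. \<exists>P\<in>PP. extreme_subcone F P}"
  have Hcell: "?H \<inter> cell c ?d p = ?H \<inter> box_cone ?d p" for p
    using Hray by (auto simp: cell_def half_space_cone_def ray_cone_def)
  have gen: "\<exists>S'. finite S' \<and> S' \<subseteq> rational_points \<and> S' \<subseteq> ray_cone c \<and> convex_cone hull S' = ?H \<inter> cell c ?d p" for p
  proof -
    obtain S' where S': "finite S'" "S' \<subseteq> rational_points" "convex_cone hull S' = ?H \<inter> box_cone ?d p"
      using box_cone_Int_rational[OF S(1,2), of ?d p] by (elim exE conjE)
    have "S' \<subseteq> ray_cone c" using hull_subset[of S' convex_cone] S'(3) Hray by blast
    then show ?thesis using S' Hcell by metis
  qed
  have rat: "rational_nilpotent_cone B form P" if P: "P \<in> PP" for P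
  proof -
    obtain p where p: "P = endo ` (?H \<inter> cell c ?d p)" using P unfolding PP_def by (rule imageE)
    obtain S' where "finite S'" "S' \<subseteq> rational_points" "S' \<subseteq> ray_cone c" "convex_cone hull S' = ?H \<inter> cell c ?d p"
      using gen[of p] by (elim exE conjE)
    then show ?thesis using rational_nilpotent_cone_endo[OF nz, of S' c] p by simp
  qed
  have finfaces: "finite {F. extreme_subcone F P}" if P: "P \<in> PP" for P
  proof -
    obtain p where p: "P = endo ` (?H \<inter> cell c ?d p)" using P unfolding PP_def by (rule imageE)
    obtain S' where S': "finite S'" "convex_cone hull S' = ?H \<inter> cell c ?d p"
      using gen[of p] by (elim exE conjE)
    have "P = convex_cone hull (endo ` S')"
      unfolding p S'(2)[symmetric] by (rule convex_cone_hull_linear_image[OF linear_endo, symmetric])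
    then show ?thesis using finite_faces_hull[of "endo ` S'"] S'(1) by simp
  qed
  have cover: "\<exists>p\<in>I. x \<in> cell c ?d p" if x: "x \<in> ?H" for x
  proof -
    obtain a w where aw: "x = (a, w)" by fastforce
    have ray: "0 \<le> a" "w - a *\<^sub>R c \<in> K" "a = 0 \<longrightarrow> w = 0" using Hray x by (auto simp: aw ray_cone_def)
    define p where "p = (\<lambda>b\<in>B. \<lfloor>real ?d * coord B b w / a\<rfloor>)"
    have "p b \<in> {- int m..int m}" if b: "b \<in> B" for b
    proof (cases "a = 0")
      case False
      then have a: "0 < a" using ray(1) by simp
      define q where "q = real ?d * coord B b w / a"
      have "\<bar>real ?d * coord B b w\<bar> \<le> real m * a" using m x b by (auto simp: aw)
      then have "\<bar>q\<bar> \<le> real m" unfolding q_def abs_divide using a by (simp add: pos_divide_le_eq)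
      then have "- real m \<le> q" "q < real m + 1" by linarith+
      then have "- int m \<le> \<lfloor>q\<rfloor>" "\<lfloor>q\<rfloor> \<le> int m" by (simp_all add: le_floor_iff floor_le_iff)
      moreover have "p b = \<lfloor>q\<rfloor>" using b by (simp add: p_def q_def)
      ultimately show ?thesis by simp
    qed (use b in \<open>simp add: p_def\<close>)
    then have "p \<in> I" unfolding I_def p_def by (auto simp: restrict_def)
    moreover have "x \<in> box_cone ?d p"
    proof -
      have "of_int (p b) * a \<le> real ?d * coord B b w \<and> real ?d * coord B b w \<le> (of_int (p b) + 1) * a" if b: "b \<in> B" for b
      proof (cases "a = 0")
        case True
        then show ?thesis using ray(3) by (simp add: linear_0[OF linear_coord[OF lattice_basis]])
      next
        case False
        then have a: "0 < a" using ray(1) by simp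
        let ?q = "real ?d * coord B b w / a"
        have "of_int (p b) \<le> ?q" "?q \<le> of_int (p b) + 1" using b by (simp_all add: p_def)
        then have "of_int (p b) * a \<le> ?q * a" "?q * a \<le> (of_int (p b) + 1) * a"
          using a by (simp_all only: mult_right_mono less_imp_le)
        then show ?thesis using False by simp
      qed
      then show ?thesis by (simp add: aw box_cone_def)
    qed
    moreover have "x \<in> half_space_cone c" using ray by (simp add: aw half_space_cone_def)
    ultimately show ?thesis unfolding cell_def by blast
  qed
  have "finite T"
  proof -
    have "T = (\<Union>P\<in>PP. {F. extreme_subcone F P})" unfolding T_def by blast
    moreover have "finite PP" unfolding PP_def using finI by simp
    ultimately show ?thesis using finfaces by simp
  qed
  moreover have "fan B form T"
    unfolding T_def
  proof (rule fan_of_faces)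
    have "I \<noteq> {}" unfolding I_def by (simp add: PiE_eq_empty_iff)
    then show "PP \<noteq> {}" unfolding PP_def by simp
    show "rational_nilpotent_cone B form P" if "P \<in> PP" for P by (rule rat[OF that])
    show "extreme_subcone (P \<inter> Q) P" if PQ: "P \<in> PP" "Q \<in> PP" for P Q
    proof -
      obtain p where p: "P = endo ` (?H \<inter> cell c ?d p)" using PQ(1) unfolding PP_def by (rule imageE)
      obtain q where q: "Q = endo ` (?H \<inter> cell c ?d q)" using PQ(2) unfolding PP_def by (rule imageE)
      have "P \<inter> Q = endo ` ((cell c ?d p \<inter> cell c ?d q) \<inter> ?H)"
        unfolding p q image_Int[OF endo_inj[OF nz], symmetric] by (rule arg_cong[where f = "image endo"]) blast
      moreover have "P = endo ` (cell c ?d p \<inter> ?H)" unfolding p by (simp add: Int_commute)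
      moreover have "extreme_subcone ((cell c ?d p \<inter> cell c ?d q) \<inter> ?H) (cell c ?d p \<inter> ?H)"
        by (rule extreme_subcone_Int[OF cell_Int_extreme[OF c(2) c(2)] convex_cone_convex_cone_hull])
      ultimately show ?thesis
        using extreme_subcone_linear_image[OF linear_endo endo_inj[OF nz]] by metis
    qed
  qed
  moreover have "\<Union> T = endo ` ?H"
  proof (rule subset_antisym; rule subsetI)
    fix M assume "M \<in> \<Union> T"
    then obtain F P where F: "M \<in> F" "P \<in> PP" "extreme_subcone F P" unfolding T_def by blast
    then have "M \<in> P" by (auto simp: extreme_subcone_def)
    then show "M \<in> endo ` ?H" using F(2) unfolding PP_def by blast
  next
    fix M assume "M \<in> endo ` ?H"
    then obtain x where x: "M = endo x" "x \<in> ?H" by (rule imageE)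
    then obtain p where p: "p \<in> I" "x \<in> cell c ?d p" using cover by blast
    let ?P = "endo ` (?H \<inter> cell c ?d p)"
    have P: "?P \<in> PP" unfolding PP_def using p(1) by blast
    have "M \<in> ?P" using x p(2) by blast
    moreover have "?P \<in> T"
      unfolding T_def using P extreme_subcone_refl[OF convex_cone_rational_nilpotent_cone[OF rat[OF P]]] by blast
    ultimately show "M \<in> \<Union> T" by blast
  qed
  moreover have "\<exists>\<tau>\<in>coset_fan. F \<subseteq> \<tau>" if F: "F \<in> T" for F
  proof -
    obtain P where P: "P \<in> PP" "F \<subseteq> P" using F unfolding T_def extreme_subcone_def by blast
    obtain p where p: "P = endo ` (?H \<inter> cell c ?d p)" using P(1) unfolding PP_def by (rule imageE)
    have "endo ` cell c ?d p \<in> coset_fan"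
      unfolding coset_fan_def using full_cellsI[OF c] extreme_subcone_refl[OF convex_cone_full_cell] by blast
    moreover have "F \<subseteq> endo ` cell c ?d p" using P(2) p by blast
    ultimately show ?thesis by blast
  qed
  ultimately show ?thesis unfolding finite_subdivision_def by blast
qed

lemma zero_in_lie_g_rat: "(0 :: 'v endo) \<in> lie_g_rat B form"
proof -
  have "endo (0, 0) = (0 :: 'v endo)" by (simp add: endo_def extension_map_def fun_eq_iff zero_prod_def)
  then show ?thesis using endo_lie_g_rat[of "(0, 0)"] Q_closed(1) by simp
qed

lemma rational_nilpotent_cone_0: "rational_nilpotent_cone B form {0}"
proof -
  have hull: "{0} = convex_cone hull {0 :: 'v endo}"
    using hull_same[of convex_cone "{0 :: 'v endo}"] convex_cone_singleton by metis
  have lie: "(0 :: 'v endo) \<in> lie_g form" using zero_in_lie_g_rat by (simp add: lie_g_rat_def)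
  have nil: "nilpotent_map (0 :: 'v endo)"
    unfolding nilpotent_map_def by (intro exI[of _ 1]) simp
  show ?thesis
    unfolding rational_nilpotent_cone_def nilpotent_cone_def
    using hull lie nil zero_in_lie_g_rat by (intro conjI exI[of _ "{0}"]) auto
qed

text \<open>
  For trivial monodromy the only admissible cone is \<open>{0}\<close>, and the pairs \<open>(a, 0)\<close> all represent \<open>0\<close>, so
  that this case is not covered by the construction with pairs.
\<close>
lemma zero_fan:
  assumes z: "\<And>v. N v = 0"
  shows "\<exists>\<Sigma>. fan B form \<Sigma> \<and>
    ((\<forall>\<sigma>\<in>\<Sigma>. admissible \<sigma> \<and> restricts_into_ray N \<sigma>) \<and> strongly_compatible (Gamma_H B form g) \<Sigma>) \<and>
    (\<forall>\<sigma>. rational_nilpotent_cone B form \<sigma> \<and> admissible \<sigma> \<and> restricts_into_ray N \<sigma> \<longrightarrow>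
       (\<exists>T. finite_subdivision B form \<sigma> T \<and> (\<forall>\<tau>\<in>T. \<exists>\<tau>'\<in>\<Sigma>. \<tau> \<subseteq> \<tau>')))"
proof -
  have e0: "endo (a, 0) = (0 :: 'v endo)" for a
    by (simp add: endo_def extension_map_def fun_eq_iff zero_prod_def z)
  have "{F. \<exists>P\<in>{{0 :: 'v endo}}. extreme_subcone F P} = {{0}}"
    using extreme_subcone_refl[OF convex_cone_singleton] convex_cone_contains_0
    by (auto simp: extreme_subcone_def)
  then have fan: "fan B form {{0}}"
    using fan_of_faces[of "{{0 :: 'v endo}}" B form] rational_nilpotent_cone_0
      extreme_subcone_refl[OF convex_cone_singleton] by simp
  have adm: "admissible {0 :: 'v endo}"
  proof -
    have "\<exists>M. is_relative_filtration (0 :: 'v endo) M"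
      using relative_filtration_endo_exists[of 0 0] e0 by simp
    moreover have "M1 = M2" if "is_relative_filtration (0 :: 'v endo) M1" "is_relative_filtration (0 :: 'v endo) M2" for M1 M2
      using relative_filtration_0_unique[of M1 M2] that e0 by simp
    ultimately show ?thesis unfolding admissible_def by blast
  qed
  have ray: "restricts_into_ray N {0 :: 'v endo}"
    unfolding restricts_into_ray_def by (auto simp: z zero_prod_def intro: exI[of _ 0])
  have "compatible (Gamma_H B form g) {{0}}"
    unfolding compatible_def
  proof (intro ballI)
    fix \<gamma> and \<sigma> :: "'v endo set" assume "\<gamma> \<in> Gamma_H B form g" "\<sigma> \<in> {{0}}"
    then have "linear \<gamma>" and \<sigma>: "\<sigma> = {0}" by (auto simp: Gamma_H_def G_int_def)
    then have "\<gamma> \<circ> 0 \<circ> inverse_map \<gamma> = 0" using linear_0[of \<gamma>] by (simp add: fun_eq_iff)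
    then show "(\<lambda>M. \<gamma> \<circ> M \<circ> inverse_map \<gamma>) ` \<sigma> \<in> {{0}}" unfolding \<sigma> by simp
  qed
  then have sc: "strongly_compatible (Gamma_H B form g) {{0}}"
    unfolding strongly_compatible_def by (auto intro!: exI[of _ "{}"])
  have "finite_subdivision B form \<sigma> {{0}}"
    if \<sigma>: "rational_nilpotent_cone B form \<sigma>" "admissible \<sigma>" "restricts_into_ray N \<sigma>" for \<sigma>
  proof -
    obtain S where S: "S \<subseteq> lie_g form" "\<sigma> = convex_cone hull S"
      using \<sigma>(1) unfolding rational_nilpotent_cone_def nilpotent_cone_def by metis
    have "M = 0" if M: "M \<in> S" for M
    proof -
      have M\<sigma>: "M \<in> \<sigma>" unfolding S(2) by (rule hull_inc[OF M])
      obtain F where "is_relative_filtration M F" using \<sigma>(2) M\<sigma> unfolding admissible_def by blast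
      moreover have "\<exists>a\<ge>0. \<forall>u. M (u, 0) = (a *\<^sub>R N u, 0)"
        using \<sigma>(3) M\<sigma> unfolding restricts_into_ray_def by blast
      moreover have "M \<in> lie_g form" using S(1) M by blast
      ultimately obtain a u where "M = endo (a, a *\<^sub>R N u)" using admissible_element by blast
      then show ?thesis using z e0 by simp
    qed
    then have "S \<subseteq> {0}" by blast
    then have "\<sigma> \<subseteq> {0}" unfolding S(2) by (rule hull_minimal) (rule convex_cone_singleton)
    moreover have "0 \<in> \<sigma>" unfolding S(2) by (rule convex_cone_hull_contains_0)
    ultimately have "\<sigma> = {0}" by blast
    then show ?thesis unfolding finite_subdivision_def using fan by simp
  qed
  then show ?thesis using fan adm ray sc
    by (intro exI[of _ "{{0}}"]) (metis singletonD singletonI subset_refl)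
qed

theorem relatively_complete_fan:
  "\<exists>\<Sigma>. fan B form \<Sigma> \<and>
    ((\<forall>\<sigma>\<in>\<Sigma>. admissible \<sigma> \<and> restricts_into_ray N \<sigma>) \<and> strongly_compatible (Gamma_H B form g) \<Sigma>) \<and>
    (\<forall>\<sigma>. rational_nilpotent_cone B form \<sigma> \<and> admissible \<sigma> \<and> restricts_into_ray N \<sigma> \<longrightarrow>
       (\<exists>T. finite_subdivision B form \<sigma> T \<and> (\<forall>\<tau>\<in>T. \<exists>\<tau>'\<in>\<Sigma>. \<tau> \<subseteq> \<tau>')))"
proof (cases "\<exists>v. N v \<noteq> 0")
  case True
  have "\<exists>T. finite_subdivision B form \<sigma> T \<and> (\<forall>\<tau>\<in>T. \<exists>\<tau>'\<in>coset_fan. \<tau> \<subseteq> \<tau>')"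
    if \<sigma>: "rational_nilpotent_cone B form \<sigma>" "admissible \<sigma>" "restricts_into_ray N \<sigma>" for \<sigma>
  proof -
    obtain c S where c: "c \<in> range N" "c \<in> qspace B" and S: "finite S" "S \<subseteq> rational_points" "S \<subseteq> ray_cone c"
      and eq: "\<sigma> = endo ` (convex_cone hull S)"
      using admissible_cone_in_ray[OF True \<sigma>] by (elim exE conjE)
    show ?thesis unfolding eq by (rule subdivision_exists[OF True c S])
  qed
  then have "\<forall>\<sigma>. rational_nilpotent_cone B form \<sigma> \<and> admissible \<sigma> \<and> restricts_into_ray N \<sigma> \<longrightarrow>
      (\<exists>T. finite_subdivision B form \<sigma> T \<and> (\<forall>\<tau>\<in>T. \<exists>\<tau>'\<in>coset_fan. \<tau> \<subseteq> \<tau>'))" by simp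
  moreover have "\<forall>\<sigma>\<in>coset_fan. admissible \<sigma> \<and> restricts_into_ray N \<sigma>"
    using coset_fan_admissible[OF True] by simp
  ultimately show ?thesis
    using fan_coset_fan[OF True] coset_fan_strongly_compatible[OF True]
    by (intro exI[of _ coset_fan] conjI)
next
  case False
  then have "N v = 0" for v by blast
  then show ?thesis by (rule zero_fan)
qed

end

theorem mainTheorem1:
  fixes X :: "'a topology"
    and A :: "('a set \<times> ('a \<Rightarrow> complex^'d)) set"
    and f :: "'a \<Rightarrow> complex"
    and \<iota> :: "'a \<Rightarrow> (complex^'n) set"
    and \<eta> :: "('a, int) cochain"
    and r :: nat and s :: complex
    and B :: "'v::real_vector set"
    and cl :: "('a, int) cochain \<Rightarrow> 'v"
    and form :: "'v \<Rightarrow> 'v \<Rightarrow> real"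
    and \<gamma>' N' :: "'v \<Rightarrow> 'v"
    and \<Gamma> :: "('v \<times> real \<Rightarrow> 'v \<times> real) set"
  assumes "semistable_degeneration X A f"
    and "polarization X A f \<iota> \<eta>"
    and "r \<ge> 1"
    and "s \<in> ball 0 1 - {0}"
    and "cohomology_lattice (2 * r - 1) (fibre X f s) B cl"
    and "is_polarization_pairing X A f \<eta> s (2 * r - 1) cl form"
    and "lattice_pairing B form"
    and "is_local_monodromy X f s (2 * r - 1) cl \<gamma>'"
    and "unipotent_lattice_isometry B form \<gamma>'"
    and "N' = unip_log \<gamma>'"
    and "\<Gamma> = Gamma_H B form \<gamma>'"
  shows "\<exists>\<Sigma>. fan B form \<Sigma> \<and>
    ((\<forall>\<sigma>\<in>\<Sigma>. admissible \<sigma> \<and> restricts_into_ray N' \<sigma>) \<and> strongly_compatible \<Gamma> \<Sigma>) \<and>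
    (\<forall>\<sigma>. rational_nilpotent_cone B form \<sigma> \<and> admissible \<sigma> \<and> restricts_into_ray N' \<sigma> \<longrightarrow>
       (\<exists>T. finite_subdivision B form \<sigma> T \<and> (\<forall>\<sigma>\<^sub>j\<in>T. \<exists>\<tau>\<in>\<Sigma>. \<sigma>\<^sub>j \<subseteq> \<tau>)))"
proof -
  have "lattice_basis B" using assms(5) by (simp add: cohomology_lattice_def)
  then interpret unipotent_lattice B form \<gamma>'
    by (rule unipotent_lattice.intro) (rule assms(7), rule assms(9))
  show ?thesis unfolding assms(10,11) by (rule relatively_complete_fan)
qed

end
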